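(* Let $(W,S)$ be a Coxeter system of type $(4,4,4)$ with $S=\{r,s,t\}$, and let $(G,(U_\alpha)_{\alpha\in\Phi})$ be an RGD-system of type $(W,S)$ over $\mathbb{F}_2$. Let $V_{\{s,t\}}:=\langle U_s,U_t\rangle\le G$. Then the canonical homomorphism $$U_{sr}\star_{U_s}V_{\{s,t\}}\star_{U_t}U_{trt}\longrightarrow G$$ (induced by the inclusions of $U_{sr}$, $V_{\{s,t\}}$ and $U_{trt}$ into $G$) is injective.
   Context: Type $(4,4,4)$ means $|S|=3$ and every product of two distinct elements of $S$ has order $4$ in $W$. Let $\ell$ be the length function. For $u\in S$ let $\alpha_u=\{w\in W\mid \ell(uw)>\ell(w)\}$. Roots are the subsets $v\alpha_u$ ($v\in W,u\in S$) of $W$; $\Phi$ is the set of roots, $\Phi_+$ (resp. $\Phi_-$) the set of roots containing (resp. not containing) $1_W$, and $-\alpha=W\setminus\alpha$. A pair $\{\alpha,\beta\}$ of roots is prenilpotent if $\alpha\cap\beta\ne\emptyset\ne(-\alpha)\cap(-\beta)$; then $[\alpha,\beta]=\{\gamma\in\Phi\mid \alpha\cap\beta\subseteq\gamma,\ (-\alpha)\cap(-\beta)\subseteq-\gamma\}$ and $(\alpha,\beta)=[\alpha,\beta]\setminus\{\alpha,\beta\}$. An RGD-system of type $(W,S)$ is a group $G$ with a family of subgroups $(U_\alpha)_{\alpha\in\Phi}$ (root groups) such that, with $H=\bigcap_{\alpha\in\Phi}N_G(U_\alpha)$ and $U_\pm=\langle U_\alpha\mid\alpha\in\Phi_\pm\rangle$: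 (RGD0) $U_\alpha\neq\{1\}$ for all $\alpha\in\Phi$; (RGD1) $[U_\alpha,U_\beta]\le\langle U_\gamma\mid\gamma\in(\alpha,\beta)\rangle$ for each prenilpotent pair $\alpha\ne\beta$; (RGD2) for every $u\in S$ and $x\in U_{\alpha_u}\setminus\{1\}$ there are $x',x''\in U_{-\alpha_u}$ such that $m(x):=x'xx''$ conjugates $U_\beta$ onto $U_{u\beta}$ for each $\beta\in\Phi$; (RGD3) $U_{-\alpha_u}\not\le U_+$ for each $u\in S$; (RGD4) $G=H\langle U_\alpha\mid\alpha\in\Phi\rangle$. It is over $\mathbb{F}_2$ if every root group has cardinality $2$. For $w\in W$: $U_w:=\langle U_\alpha\mid\alpha\in\Phi_+,\ w\notin\alpha\rangle\le G$ (so $U_s=U_{\alpha_s}$, $U_t=U_{\alpha_t}$). $G_1\star_{H_1}G_2\star_{H_2}G_3$ denotes the tree product, i.e. the direct limit of the diagram $G_1\leftarrow H_1\to G_2\leftarrow H_2\to G_3$; here the edge maps are the inclusions $U_s\le U_{sr}$, $U_s\le V_{\{s,t\}}$, $U_t\le V_{\{s,t\}}$, $U_t\le U_{trt}$. *)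

theory Defs
  imports "HOL-Algebra.Multiplicative_Group" "HOL-Algebra.Group_Action" "HOL-Algebra.Generated_Groups"
begin

section \<open>Words and presentations\<close>

text \<open>
  \<open>word_prod K f ws\<close> is the product in \<open>K\<close> of the images under \<open>f\<close> of the letters of \<open>ws\<close>.
\<close>

definition word_prod :: "('b, 'm) monoid_scheme \<Rightarrow> ('a \<Rightarrow> 'b) \<Rightarrow> 'a list \<Rightarrow> 'b" where
  "word_prod K f ws = foldr (\<lambda>x y. f x \<otimes>\<^bsub>K\<^esub> y) ws \<one>\<^bsub>K\<^esub>"

text \<open>
  \<open>word_cong A R\<close> is the congruence on the free monoid of words over the alphabet \<open>A\<close> generated
  by the pairs in \<open>R\<close>, and \<open>presented A R\<close> is the quotient monoid.  Only for
  presentations in which every letter is invertible modulo \<open>R\<close>, as in all uses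
  below, is this the group with generators \<open>A\<close> and defining relations \<open>R\<close>.
\<close>

inductive_set word_cong :: "'a set \<Rightarrow> ('a list \<times> 'a list) set \<Rightarrow> ('a list \<times> 'a list) set"
  for A :: "'a set" and R :: "('a list \<times> 'a list) set" where
  base: "\<lbrakk>(u, v) \<in> R; u \<in> lists A; v \<in> lists A; xs \<in> lists A; ys \<in> lists A\<rbrakk>
      \<Longrightarrow> (xs @ u @ ys, xs @ v @ ys) \<in> word_cong A R"
| refl: "xs \<in> lists A \<Longrightarrow> (xs, xs) \<in> word_cong A R"
| sym: "(xs, ys) \<in> word_cong A R \<Longrightarrow> (ys, xs) \<in> word_cong A R"
| trans: "\<lbrakk>(xs, ys) \<in> word_cong A R; (ys, zs) \<in> word_cong A R\<rbrakk> \<Longrightarrow> (xs, zs) \<in> word_cong A R"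

definition presented :: "'a set \<Rightarrow> ('a list \<times> 'a list) set \<Rightarrow> 'a list set monoid" where
  "presented A R =
    \<lparr>carrier = lists A // word_cong A R,
     mult = (\<lambda>X Y. \<Union>x\<in>X. \<Union>y\<in>Y. word_cong A R `` {x @ y}),
     one = word_cong A R `` {[]}\<rparr>"

lemma word_cong_in_lists:
  assumes "(xs, ys) \<in> word_cong A R"
  shows "xs \<in> lists A" "ys \<in> lists A"
  using assms by (induction rule: word_cong.induct) auto

lemma word_cong_context:
  assumes "(u, v) \<in> word_cong A R" "p \<in> lists A" "q \<in> lists A"
  shows "(p @ u @ q, p @ v @ q) \<in> word_cong A R"
  using assms
proof (induction rule: word_cong.induct)
  case (base u v xs ys)
  have "((p @ xs) @ u @ (ys @ q), (p @ xs) @ v @ (ys @ q)) \<in> word_cong A R"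
    using base by (intro word_cong.base) auto
  then show ?case by simp
next
  case (refl xs)
  then show ?case by (intro word_cong.refl) auto
next
  case (sym xs ys)
  then show ?case by (simp add: word_cong.sym)
next
  case (trans xs ys zs)
  then show ?case using word_cong.trans by metis
qed

lemma word_cong_append:
  assumes "(u, u') \<in> word_cong A R" "(v, v') \<in> word_cong A R"
  shows "(u @ v, u' @ v') \<in> word_cong A R"
proof -
  note l = word_cong_in_lists[OF assms(1)] word_cong_in_lists[OF assms(2)]
  have "(u @ v, u' @ v) \<in> word_cong A R"
    using word_cong_context[OF assms(1), of "[]" v] l by simp
  moreover have "(u' @ v, u' @ v') \<in> word_cong A R"
    using word_cong_context[OF assms(2), of u' "[]"] l by simp
  ultimately show ?thesis by (rule word_cong.trans)
qed

lemma equiv_word_cong: "equiv (lists A) (word_cong A R)"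
proof (rule equivI)
  show "word_cong A R \<subseteq> lists A \<times> lists A"
    using word_cong_in_lists by fast
  show "refl_on (lists A) (word_cong A R)"
    by (auto simp: refl_on_def intro: word_cong.refl)
  show "Relation.sym (word_cong A R)"
    by (rule symI) (erule word_cong.sym)
  show "Relation.trans (word_cong A R)"
    by (rule transI) (erule word_cong.trans)
qed

lemma presented_carrier_cases:
  assumes "X \<in> carrier (presented A R)"
  obtains ws where "ws \<in> lists A" "X = word_cong A R `` {ws}"
proof -
  have "X \<in> lists A // word_cong A R"
    using assms by (simp add: presented_def)
  then show thesis
    using that by (rule quotientE)
qed

lemma presented_class_in_carrier:
  "ws \<in> lists A \<Longrightarrow> word_cong A R `` {ws} \<in> carrier (presented A R)"
  by (auto simp: presented_def intro: quotientI)

lemma presented_mult: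
  assumes "u \<in> lists A" "v \<in> lists A"
  shows "word_cong A R `` {u} \<otimes>\<^bsub>presented A R\<^esub> word_cong A R `` {v} = word_cong A R `` {u @ v}"
proof -
  have *: "word_cong A R `` {x @ y} = word_cong A R `` {u @ v}"
    if "x \<in> word_cong A R `` {u}" "y \<in> word_cong A R `` {v}" for x y
  proof -
    have "(u @ v, x @ y) \<in> word_cong A R"
      using that by (intro word_cong_append) auto
    then show ?thesis
      using equiv_class_eq[OF equiv_word_cong] by metis
  qed
  have "u \<in> word_cong A R `` {u}" "v \<in> word_cong A R `` {v}"
    using assms by (auto intro: word_cong.refl)
  then have "(\<Union>x\<in>word_cong A R `` {u}. \<Union>y\<in>word_cong A R `` {v}. word_cong A R `` {x @ y})
      = word_cong A R `` {u @ v}"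
    using * by blast
  then show ?thesis by (simp add: presented_def)
qed

lemma presented_one: "\<one>\<^bsub>presented A R\<^esub> = word_cong A R `` {[]}"
  by (simp add: presented_def)

lemma presented_group:
  assumes inv: "\<And>a. a \<in> A \<Longrightarrow> \<exists>b\<in>A. ([b, a], []) \<in> word_cong A R"
  shows "group (presented A R)"
proof (rule groupI)
  fix X Y assume "X \<in> carrier (presented A R)" "Y \<in> carrier (presented A R)"
  then show "X \<otimes>\<^bsub>presented A R\<^esub> Y \<in> carrier (presented A R)"
    by (elim presented_carrier_cases) (simp add: presented_mult presented_class_in_carrier)
next
  show "\<one>\<^bsub>presented A R\<^esub> \<in> carrier (presented A R)"
    by (simp add: presented_one presented_class_in_carrier)
next
  fix X Y Z
  assume "X \<in> carrier (presented A R)" "Y \<in> carrier (presented A R)"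
    "Z \<in> carrier (presented A R)"
  then show "X \<otimes>\<^bsub>presented A R\<^esub> Y \<otimes>\<^bsub>presented A R\<^esub> Z
      = X \<otimes>\<^bsub>presented A R\<^esub> (Y \<otimes>\<^bsub>presented A R\<^esub> Z)"
    by (elim presented_carrier_cases) (simp add: presented_mult)
next
  fix X assume "X \<in> carrier (presented A R)"
  then show "\<one>\<^bsub>presented A R\<^esub> \<otimes>\<^bsub>presented A R\<^esub> X = X"
    by (elim presented_carrier_cases) (simp add: presented_one presented_mult)
next
  fix X assume "X \<in> carrier (presented A R)"
  then obtain ws where ws: "ws \<in> lists A" "X = word_cong A R `` {ws}"
    by (rule presented_carrier_cases)
  have "\<exists>vs\<in>lists A. (vs @ ws, []) \<in> word_cong A R"
    using ws(1)
  proof (induction ws)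
    case Nil
    then show ?case by (intro bexI[of _ "[]"]) (auto intro: word_cong.refl)
  next
    case (Cons a ws)
    then obtain vs where vs: "vs \<in> lists A" "(vs @ ws, []) \<in> word_cong A R" by auto
    from inv Cons.hyps obtain b where b: "b \<in> A" "([b, a], []) \<in> word_cong A R" by blast
    have "(vs @ [b, a] @ ws, vs @ [] @ ws) \<in> word_cong A R"
      using vs b Cons.hyps by (intro word_cong_context) auto
    then have "((vs @ [b]) @ (a # ws), []) \<in> word_cong A R"
      using word_cong.trans[of "vs @ [b, a] @ ws" "vs @ ws" A R "[]"] vs(2) by simp
    then show ?case
      using vs(1) b(1) by (intro bexI[of _ "vs @ [b]"]) auto
  qed
  then obtain vs where vs: "vs \<in> lists A" "(vs @ ws, []) \<in> word_cong A R" by blast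
  then have "word_cong A R `` {vs @ ws} = word_cong A R `` {[]}"
    using equiv_class_eq[OF equiv_word_cong] by metis
  then show "\<exists>Y\<in>carrier (presented A R). Y \<otimes>\<^bsub>presented A R\<^esub> X = \<one>\<^bsub>presented A R\<^esub>"
    using vs(1) ws
    by (intro bexI[of _ "word_cong A R `` {vs}"])
      (simp_all add: presented_mult presented_one presented_class_in_carrier)
qed

lemma (in monoid) word_prod_closed:
  assumes "\<And>a. a \<in> A \<Longrightarrow> f a \<in> carrier G" "ws \<in> lists A"
  shows "word_prod G f ws \<in> carrier G"
  using assms(2) by (induction ws) (auto simp: word_prod_def assms(1))

lemma (in monoid) word_prod_append:
  assumes "\<And>a. a \<in> A \<Longrightarrow> f a \<in> carrier G" "us \<in> lists A" "vs \<in> lists A"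
  shows "word_prod G f (us @ vs) = word_prod G f us \<otimes> word_prod G f vs"
proof -
  have v: "word_prod G f vs \<in> carrier G"
    using assms by (intro word_prod_closed[of A]) auto
  show ?thesis
    using assms(2)
  proof (induction us)
    case Nil
    then show ?case using v by (simp add: word_prod_def)
  next
    case (Cons a us)
    then have "word_prod G f us \<in> carrier G" "f a \<in> carrier G"
      using assms(1) by (auto intro: word_prod_closed[of A])
    then show ?case using Cons v by (simp add: word_prod_def m_assoc)
  qed
qed

lemma (in monoid) word_prod_cong:
  assumes f: "\<And>a. a \<in> A \<Longrightarrow> f a \<in> carrier G"
    and R: "\<And>u v. \<lbrakk>(u, v) \<in> R; u \<in> lists A; v \<in> lists A\<rbrakk> \<Longrightarrow> word_prod G f u = word_prod G f v"
    and "(xs, ys) \<in> word_cong A R"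
  shows "word_prod G f xs = word_prod G f ys"
  using assms(3)
proof (induction rule: word_cong.induct)
  case (base u v xs ys)
  then show ?case
    using R[OF base(1-3)] by (simp add: word_prod_append[of A f, OF f])
qed auto

section \<open>Tree products\<close>

text \<open>
  The direct limit of a diagram of groups with underlying graph
  \<open>G1 \<leftarrow>a1\<midarrow> H1 \<midarrow>b1\<rightarrow> G2 \<leftarrow>a2\<midarrow> H2 \<midarrow>b2\<rightarrow> G3\<close>: its generators are the elements of the
  disjoint union of \<open>G1\<close>, \<open>G2\<close>, \<open>G3\<close>, and its relations are the multiplication tables of these
  groups together with the identifications along \<open>H1\<close> and \<open>H2\<close>.  The lemmas
  \<open>tree_product_map_hom\<close>, \<open>tree_product_map_in\<close> and \<open>tree_product_map_unique\<close> below give the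
  universal property.
\<close>

abbreviation in1 :: "'a \<Rightarrow> 'a + 'b + 'c" where "in1 \<equiv> Inl"
abbreviation in2 :: "'b \<Rightarrow> 'a + 'b + 'c" where "in2 x \<equiv> Inr (Inl x)"
abbreviation in3 :: "'c \<Rightarrow> 'a + 'b + 'c" where "in3 x \<equiv> Inr (Inr x)"

definition table_rels :: "('l \<Rightarrow> 'a) \<Rightarrow> ('l, 'm) monoid_scheme \<Rightarrow> ('a list \<times> 'a list) set" where
  "table_rels \<iota> K = insert ([\<iota> \<one>\<^bsub>K\<^esub>], [])
    {([\<iota> x, \<iota> y], [\<iota> (x \<otimes>\<^bsub>K\<^esub> y)]) | x y. x \<in> carrier K \<and> y \<in> carrier K}"

definition tree_rels ::
  "('a, 'k) monoid_scheme \<Rightarrow> ('h \<Rightarrow> 'a) \<Rightarrow> ('h, 'l) monoid_scheme \<Rightarrow> ('h \<Rightarrow> 'b) \<Rightarrow>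
   ('b, 'm) monoid_scheme \<Rightarrow> ('i \<Rightarrow> 'b) \<Rightarrow> ('i, 'n) monoid_scheme \<Rightarrow> ('i \<Rightarrow> 'c) \<Rightarrow>
   ('c, 'o) monoid_scheme \<Rightarrow> (('a + 'b + 'c) list \<times> ('a + 'b + 'c) list) set" where
  "tree_rels G1 a1 H1 b1 G2 a2 H2 b2 G3 =
     table_rels in1 G1 \<union> table_rels in2 G2 \<union> table_rels in3 G3
     \<union> {([in1 (a1 h)], [in2 (b1 h)]) | h. h \<in> carrier H1}
     \<union> {([in2 (a2 h)], [in3 (b2 h)]) | h. h \<in> carrier H2}"

definition tree_product ::
  "('a, 'k) monoid_scheme \<Rightarrow> ('h \<Rightarrow> 'a) \<Rightarrow> ('h, 'l) monoid_scheme \<Rightarrow> ('h \<Rightarrow> 'b) \<Rightarrow>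
   ('b, 'm) monoid_scheme \<Rightarrow> ('i \<Rightarrow> 'b) \<Rightarrow> ('i, 'n) monoid_scheme \<Rightarrow> ('i \<Rightarrow> 'c) \<Rightarrow>
   ('c, 'o) monoid_scheme \<Rightarrow> ('a + 'b + 'c) list set monoid" where
  "tree_product G1 a1 H1 b1 G2 a2 H2 b2 G3 =
     presented (carrier G1 <+> carrier G2 <+> carrier G3)
       (tree_rels G1 a1 H1 b1 G2 a2 H2 b2 G3)"

text \<open>The homomorphism into \<open>K\<close> induced by \<open>f1\<close>, \<open>f2\<close>, \<open>f3\<close>.\<close>

definition tree_product_map ::
  "('d, 'm) monoid_scheme \<Rightarrow> ('a \<Rightarrow> 'd) \<Rightarrow> ('b \<Rightarrow> 'd) \<Rightarrow> ('c \<Rightarrow> 'd) \<Rightarrow>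
   ('a + 'b + 'c) list set \<Rightarrow> 'd" where
  "tree_product_map K f1 f2 f3 X =
     the_elem (word_prod K (case_sum f1 (case_sum f2 f3)) ` X)"

locale tree_diagram =
  G1: group G1 + G2: group G2 + G3: group G3
  for G1 :: "('a, 'k) monoid_scheme" and a1 :: "'h \<Rightarrow> 'a" and H1 :: "('h, 'l) monoid_scheme"
    and b1 :: "'h \<Rightarrow> 'b" and G2 :: "('b, 'm) monoid_scheme" and a2 :: "'i \<Rightarrow> 'b"
    and H2 :: "('i, 'n) monoid_scheme" and b2 :: "'i \<Rightarrow> 'c" and G3 :: "('c, 'o) monoid_scheme" +
  assumes edge_homs: "a1 \<in> hom H1 G1" "b1 \<in> hom H1 G2" "a2 \<in> hom H2 G2" "b2 \<in> hom H2 G3"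
begin

abbreviation "A \<equiv> carrier G1 <+> carrier G2 <+> carrier G3"
abbreviation "R \<equiv> tree_rels G1 a1 H1 b1 G2 a2 H2 b2 G3"
abbreviation "T \<equiv> tree_product G1 a1 H1 b1 G2 a2 H2 b2 G3"
abbreviation "cls ws \<equiv> word_cong A R `` {ws}"

lemma rel_cong:
  assumes "(u, v) \<in> R" "u \<in> lists A" "v \<in> lists A"
  shows "(u, v) \<in> word_cong A R"
  using word_cong.base[OF assms, of "[]" "[]"] by simp

lemma cls_eq: "(u, v) \<in> word_cong A R \<Longrightarrow> cls u = cls v"
  using equiv_class_eq[OF equiv_word_cong] by metis

lemma tree_product_group: "group T"
  unfolding tree_product_def
proof (rule presented_group)
  fix a assume a: "a \<in> A"
  have table: "\<exists>b\<in>A. ([b, a], []) \<in> word_cong A R"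
    if K: "group K" and sub: "table_rels \<iota> K \<subseteq> R" and \<iota>: "\<iota> ` carrier K \<subseteq> A"
      and x: "x \<in> carrier K" "a = \<iota> x" for K :: "('x, 'y) monoid_scheme" and \<iota> x
  proof -
    interpret K: group K by (rule K)
    have "([\<iota> (inv\<^bsub>K\<^esub> x), \<iota> x], [\<iota> (inv\<^bsub>K\<^esub> x \<otimes>\<^bsub>K\<^esub> x)]) \<in> table_rels \<iota> K"
      using x(1) K.inv_closed unfolding table_rels_def by blast
    moreover have "([\<iota> \<one>\<^bsub>K\<^esub>], []) \<in> table_rels \<iota> K"
      by (simp add: table_rels_def)
    moreover have "\<iota> (inv\<^bsub>K\<^esub> x) \<in> A" "\<iota> x \<in> A" "\<iota> \<one>\<^bsub>K\<^esub> \<in> A"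
      using x(1) K.inv_closed K.one_closed \<iota> by blast+
    ultimately have "([\<iota> (inv\<^bsub>K\<^esub> x), \<iota> x], [\<iota> \<one>\<^bsub>K\<^esub>]) \<in> word_cong A R"
      "([\<iota> \<one>\<^bsub>K\<^esub>], []) \<in> word_cong A R"
      using x(1) sub by (auto intro!: rel_cong)
    then show ?thesis
      using \<open>\<iota> (inv\<^bsub>K\<^esub> x) \<in> A\<close> x(2) word_cong.trans by metis
  qed
  from a consider x where "x \<in> carrier G1" "a = in1 x" | x where "x \<in> carrier G2" "a = in2 x"
    | x where "x \<in> carrier G3" "a = in3 x" by auto
  then show "\<exists>b\<in>A. ([b, a], []) \<in> word_cong A R"
  proof cases
    case 1
    with table[OF G1.is_group, of in1] show ?thesis by (auto simp: tree_rels_def)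
  next
    case 2
    with table[OF G2.is_group, of in2] show ?thesis by (auto simp: tree_rels_def)
  next
    case 3
    with table[OF G3.is_group, of in3] show ?thesis by (auto simp: tree_rels_def)
  qed
qed

lemma tree_product_in_hom:
  "(\<lambda>x. cls [in1 x]) \<in> hom G1 T" "(\<lambda>x. cls [in2 x]) \<in> hom G2 T" "(\<lambda>x. cls [in3 x]) \<in> hom G3 T"
proof -
  have *: "cls [\<iota> x] \<in> carrier T \<and> cls [\<iota> (x \<otimes>\<^bsub>K\<^esub> y)] = cls [\<iota> x] \<otimes>\<^bsub>T\<^esub> cls [\<iota> y]"
    if K: "group K" and sub: "table_rels \<iota> K \<subseteq> R" and \<iota>: "\<iota> ` carrier K \<subseteq> A"
      and x: "x \<in> carrier K" "y \<in> carrier K" for K :: "('x, 'y) monoid_scheme" and \<iota> x y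
  proof -
    interpret K: group K by (rule K)
    have A: "\<iota> x \<in> A" "\<iota> y \<in> A" "\<iota> (x \<otimes>\<^bsub>K\<^esub> y) \<in> A"
      using x K.m_closed \<iota> by blast+
    have "([\<iota> x, \<iota> y], [\<iota> (x \<otimes>\<^bsub>K\<^esub> y)]) \<in> table_rels \<iota> K"
      using x unfolding table_rels_def by blast
    then have "cls [\<iota> x, \<iota> y] = cls [\<iota> (x \<otimes>\<^bsub>K\<^esub> y)]"
      using A sub by (intro cls_eq rel_cong) auto
    then show ?thesis
      using A by (simp add: tree_product_def presented_mult presented_class_in_carrier)
  qed
  show "(\<lambda>x. cls [in1 x]) \<in> hom G1 T"
    using *[OF G1.is_group, of in1] by (auto intro!: homI simp: tree_rels_def)
  show "(\<lambda>x. cls [in2 x]) \<in> hom G2 T"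
    using *[OF G2.is_group, of in2] by (auto intro!: homI simp: tree_rels_def)
  show "(\<lambda>x. cls [in3 x]) \<in> hom G3 T"
    using *[OF G3.is_group, of in3] by (auto intro!: homI simp: tree_rels_def)
qed

lemma tree_product_in_edges:
  "h \<in> carrier H1 \<Longrightarrow> cls [in1 (a1 h)] = cls [in2 (b1 h)]"
  "k \<in> carrier H2 \<Longrightarrow> cls [in2 (a2 k)] = cls [in3 (b2 k)]"
proof -
  note closed = edge_homs[THEN hom_in_carrier]
  show "cls [in1 (a1 h)] = cls [in2 (b1 h)]" if "h \<in> carrier H1"
  proof (rule cls_eq, rule rel_cong)
    show "([in1 (a1 h)], [in2 (b1 h)]) \<in> R"
      using that by (auto simp: tree_rels_def)
  qed (use that closed in auto)
  show "cls [in2 (a2 k)] = cls [in3 (b2 k)]" if "k \<in> carrier H2"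
  proof (rule cls_eq, rule rel_cong)
    show "([in2 (a2 k)], [in3 (b2 k)]) \<in> R"
      using that by (auto simp: tree_rels_def)
  qed (use that closed in auto)
qed

context
  fixes K :: "('d, 'p) monoid_scheme" and f1 :: "'a \<Rightarrow> 'd" and f2 :: "'b \<Rightarrow> 'd" and f3 :: "'c \<Rightarrow> 'd"
  assumes K: "group K"
    and f: "f1 \<in> hom G1 K" "f2 \<in> hom G2 K" "f3 \<in> hom G3 K"
    and compat: "\<And>h. h \<in> carrier H1 \<Longrightarrow> f1 (a1 h) = f2 (b1 h)"
      "\<And>k. k \<in> carrier H2 \<Longrightarrow> f2 (a2 k) = f3 (b2 k)"
begin

interpretation K: group K by (rule K)

private abbreviation "F \<equiv> case_sum f1 (case_sum f2 f3)"

private lemma F_closed: "a \<in> A \<Longrightarrow> F a \<in> carrier K"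
  using f by (auto dest: hom_in_carrier)

private lemma F_cong:
  assumes "(u, v) \<in> word_cong A R"
  shows "word_prod K F u = word_prod K F v"
proof (rule K.word_prod_cong[OF F_closed _ assms])
  fix u v assume uv: "(u, v) \<in> R" "u \<in> lists A" "v \<in> lists A"
  have one: "f1 \<one>\<^bsub>G1\<^esub> = \<one>\<^bsub>K\<^esub>" "f2 \<one>\<^bsub>G2\<^esub> = \<one>\<^bsub>K\<^esub>" "f3 \<one>\<^bsub>G3\<^esub> = \<one>\<^bsub>K\<^esub>"
    using f hom_one G1.is_group G2.is_group G3.is_group K by blast+
  have closed: "\<And>x. x \<in> carrier G1 \<Longrightarrow> f1 x \<in> carrier K" "\<And>x. x \<in> carrier G2 \<Longrightarrow> f2 x \<in> carrier K"
    "\<And>x. x \<in> carrier G3 \<Longrightarrow> f3 x \<in> carrier K"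
    using f by (auto dest: hom_in_carrier)
  show "word_prod K F u = word_prod K F v"
    using uv closed f
    by (auto simp: tree_rels_def table_rels_def word_prod_def one compat hom_mult)
qed

private lemma map_cls:
  assumes "ws \<in> lists A"
  shows "tree_product_map K f1 f2 f3 (cls ws) = word_prod K F ws"
proof -
  have "ws \<in> cls ws"
    using assms by (simp add: word_cong.refl)
  moreover have "word_prod K F us = word_prod K F ws" if "us \<in> cls ws" for us
    using that F_cong[of ws us] by simp
  ultimately have "word_prod K F ` cls ws = {word_prod K F ws}"
    by blast
  then show ?thesis by (simp add: tree_product_map_def)
qed

lemma tree_product_map_hom: "tree_product_map K f1 f2 f3 \<in> hom T K"
proof (rule homI)
  fix X assume "X \<in> carrier T"
  then show "tree_product_map K f1 f2 f3 X \<in> carrier K"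
    unfolding tree_product_def
    by (elim presented_carrier_cases) (simp add: map_cls K.word_prod_closed[of A, OF F_closed])
next
  fix X Y assume "X \<in> carrier T" "Y \<in> carrier T"
  then show "tree_product_map K f1 f2 f3 (X \<otimes>\<^bsub>T\<^esub> Y)
      = tree_product_map K f1 f2 f3 X \<otimes>\<^bsub>K\<^esub> tree_product_map K f1 f2 f3 Y"
    unfolding tree_product_def
    by (elim presented_carrier_cases)
      (simp add: presented_mult map_cls K.word_prod_append[of A, OF F_closed])
qed

lemma tree_product_map_in:
  "x \<in> carrier G1 \<Longrightarrow> tree_product_map K f1 f2 f3 (cls [in1 x]) = f1 x"
  "y \<in> carrier G2 \<Longrightarrow> tree_product_map K f1 f2 f3 (cls [in2 y]) = f2 y"
  "z \<in> carrier G3 \<Longrightarrow> tree_product_map K f1 f2 f3 (cls [in3 z]) = f3 z"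
proof -
  note closed = f[THEN hom_in_carrier]
  show "tree_product_map K f1 f2 f3 (cls [in1 x]) = f1 x" if "x \<in> carrier G1"
    using that closed map_cls[of "[in1 x]"] by (simp add: word_prod_def InlI)
  show "tree_product_map K f1 f2 f3 (cls [in2 y]) = f2 y" if "y \<in> carrier G2"
    using that closed map_cls[of "[in2 y]"] by (simp add: word_prod_def InlI InrI)
  show "tree_product_map K f1 f2 f3 (cls [in3 z]) = f3 z" if "z \<in> carrier G3"
    using that closed map_cls[of "[in3 z]"] by (simp add: word_prod_def InrI)
qed

lemma tree_product_map_unique:
  assumes g: "g \<in> hom T K"
    and "\<And>x. x \<in> carrier G1 \<Longrightarrow> g (cls [in1 x]) = f1 x"
    and "\<And>y. y \<in> carrier G2 \<Longrightarrow> g (cls [in2 y]) = f2 y"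
    and "\<And>z. z \<in> carrier G3 \<Longrightarrow> g (cls [in3 z]) = f3 z"
    and X: "X \<in> carrier T"
  shows "g X = tree_product_map K f1 f2 f3 X"
proof -
  from X obtain ws where ws: "ws \<in> lists A" "X = cls ws"
    unfolding tree_product_def by (rule presented_carrier_cases)
  have "g (cls ws) = word_prod K F ws"
    using ws(1)
  proof (induction ws)
    case Nil
    have "g \<one>\<^bsub>T\<^esub> = \<one>\<^bsub>K\<^esub>"
      using hom_one[OF g tree_product_group K] .
    then show ?case by (simp add: tree_product_def presented_one word_prod_def)
  next
    case (Cons a ws)
    have "cls (a # ws) = cls [a] \<otimes>\<^bsub>T\<^esub> cls ws"
      using Cons.hyps by (simp add: tree_product_def presented_mult)
    moreover have "cls [a] \<in> carrier T" "cls ws \<in> carrier T"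
      using Cons.hyps by (simp_all add: tree_product_def presented_class_in_carrier)
    moreover have "g (cls [a]) = F a"
      using Cons.hyps assms(2-4) by auto
    ultimately show ?case
      using hom_mult[OF g] Cons.IH by (simp add: word_prod_def)
  qed
  then show ?thesis using ws by (simp add: map_cls)
qed

end

end

section \<open>Coxeter systems\<close>

text \<open>
  The relation for \<open>s = t\<close> is \<open>s s = 1\<close>, so the letters are invertible and no formal inverses are
  needed.  For \<open>s t\<close> of infinite order \<open>ord\<close> is \<open>0\<close> and the relation is void.
\<close>

definition coxeter_rels :: "('w, 'm) monoid_scheme \<Rightarrow> 'w set \<Rightarrow> ('w list \<times> 'w list) set" where
  "coxeter_rels W S =
     {(concat (replicate (group.ord W (s \<otimes>\<^bsub>W\<^esub> t)) [s, t]), []) | s t. s \<in> S \<and> t \<in> S}"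

locale coxeter_system = group W
  for W :: "('w, 'm) monoid_scheme" (structure) and S :: "'w set" +
  assumes S_subset: "S \<subseteq> carrier W"
    and S_generates: "generate W S = carrier W"
    and S_involution: "s \<in> S \<Longrightarrow> ord s = 2"
    and presentation: "\<lbrakk>us \<in> lists S; vs \<in> lists S; word_prod W id us = word_prod W id vs\<rbrakk>
      \<Longrightarrow> (us, vs) \<in> word_cong S (coxeter_rels W S)"

context coxeter_system
begin

lemma generator_involutive: "s \<in> S \<Longrightarrow> s \<otimes> s = \<one>"
  using S_involution[of s] S_subset pow_ord_eq_1[of s] by (auto simp: numeral_2_eq_2)

lemma generator_word:
  assumes "w \<in> carrier W"
  shows "\<exists>ws\<in>lists S. word_prod W id ws = w"
proof -
  have closed: "\<And>s. s \<in> S \<Longrightarrow> id s \<in> carrier W"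
    using S_subset by auto
  have "w \<in> generate W S"
    using assms S_generates by simp
  then show ?thesis
  proof (induction rule: generate.induct)
    case one
    show ?case by (intro bexI[of _ "[]"]) (auto simp: word_prod_def)
  next
    case (incl s)
    then show ?case
      using closed by (intro bexI[of _ "[s]"]) (auto simp: word_prod_def)
  next
    case (inv s)
    then have "inv s = s"
      using closed generator_involutive by (intro inv_equality) auto
    then show ?case
      using inv closed by (intro bexI[of _ "[s]"]) (auto simp: word_prod_def)
  next
    case (eng h1 h2)
    then obtain us vs where "us \<in> lists S" "vs \<in> lists S"
      "word_prod W id us = h1" "word_prod W id vs = h2" by blast
    then show ?case
      using word_prod_append[of S id us vs, OF closed]
      by (intro bexI[of _ "us @ vs"]) (simp_all del: id_apply)
  qed
qed

text \<open>The universal property of the presentation.\<close>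

lemma coxeter_extend_hom:
  assumes "group K" and f: "\<And>s. s \<in> S \<Longrightarrow> f s \<in> carrier K"
    and rel: "\<And>s t. \<lbrakk>s \<in> S; t \<in> S\<rbrakk> \<Longrightarrow> (f s \<otimes>\<^bsub>K\<^esub> f t) [^]\<^bsub>K\<^esub> ord (s \<otimes> t) = \<one>\<^bsub>K\<^esub>"
  shows "\<exists>\<phi>\<in>hom W K. \<forall>s\<in>S. \<phi> s = f s"
proof -
  interpret K: group K by fact
  have closed: "\<And>s. s \<in> S \<Longrightarrow> id s \<in> carrier W"
    using S_subset by auto
  have pow: "word_prod K f (concat (replicate n [s, t])) = (f s \<otimes>\<^bsub>K\<^esub> f t) [^]\<^bsub>K\<^esub> n"
    if "s \<in> S" "t \<in> S" for s t and n :: nat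
  proof (induction n)
    case 0
    then show ?case by (simp add: word_prod_def)
  next
    case (Suc n)
    have "(f s \<otimes>\<^bsub>K\<^esub> f t) [^]\<^bsub>K\<^esub> Suc n = (f s \<otimes>\<^bsub>K\<^esub> f t) \<otimes>\<^bsub>K\<^esub> (f s \<otimes>\<^bsub>K\<^esub> f t) [^]\<^bsub>K\<^esub> n"
      using that f by (intro K.nat_pow_Suc2) auto
    then show ?case
      using Suc that f by (simp add: word_prod_def K.m_assoc)
  qed
  have respects: "word_prod K f us = word_prod K f vs"
    if "us \<in> lists S" "vs \<in> lists S" "word_prod W id us = word_prod W id vs" for us vs
  proof (rule K.word_prod_cong[OF f _ presentation[OF that]])
    fix u v assume "(u, v) \<in> coxeter_rels W S"
    then obtain s t where "s \<in> S" "t \<in> S" "u = concat (replicate (ord (s \<otimes> t)) [s, t])" "v = []"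
      unfolding coxeter_rels_def by blast
    then show "word_prod K f u = word_prod K f v"
      using pow rel by (simp add: word_prod_def)
  qed
  obtain wd where wd: "\<And>w. w \<in> carrier W \<Longrightarrow> wd w \<in> lists S \<and> word_prod W id (wd w) = w"
    using generator_word by metis
  define \<phi> where "\<phi> w = word_prod K f (wd w)" for w
  have \<phi>: "\<phi> (word_prod W id ws) = word_prod K f ws" if "ws \<in> lists S" for ws
    unfolding \<phi>_def using that wd[of "word_prod W id ws"] word_prod_closed[of S id ws, OF closed]
    by (intro respects) auto
  have "\<phi> \<in> hom W K"
  proof (rule homI)
    fix x assume "x \<in> carrier W"
    then show "\<phi> x \<in> carrier K"
      unfolding \<phi>_def using wd by (intro K.word_prod_closed[of S, OF f]) auto
  next
    fix x y assume xy: "x \<in> carrier W" "y \<in> carrier W"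
    then have l: "wd x \<in> lists S" "wd y \<in> lists S"
      and p: "word_prod W id (wd x) = x" "word_prod W id (wd y) = y"
      using wd by auto
    have "x \<otimes> y = word_prod W id (wd x @ wd y)"
      using word_prod_append[of S id, OF closed l] p by simp
    then have "\<phi> (x \<otimes> y) = word_prod K f (wd x @ wd y)"
      using \<phi>[of "wd x @ wd y"] l by simp
    also have "\<dots> = \<phi> x \<otimes>\<^bsub>K\<^esub> \<phi> y"
      unfolding \<phi>_def using K.word_prod_append[of S f, OF f l] .
    finally show "\<phi> (x \<otimes> y) = \<phi> x \<otimes>\<^bsub>K\<^esub> \<phi> y" .
  qed
  moreover have "\<phi> s = f s" if "s \<in> S" for s
    using \<phi>[of "[s]"] that f closed by (simp add: word_prod_def)
  ultimately show ?thesis by blast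
qed

end

definition type_444 :: "('w, 'm) monoid_scheme \<Rightarrow> 'w set \<Rightarrow> bool" where
  "type_444 W S \<longleftrightarrow> card S = 3 \<and> (\<forall>x\<in>S. \<forall>y\<in>S. x \<noteq> y \<longrightarrow> group.ord W (x \<otimes>\<^bsub>W\<^esub> y) = 4)"

definition cox_length :: "('w, 'm) monoid_scheme \<Rightarrow> 'w set \<Rightarrow> 'w \<Rightarrow> nat" where
  "cox_length W S w = (LEAST n. \<exists>ws\<in>lists S. length ws = n \<and> word_prod W id ws = w)"

section \<open>Roots\<close>

definition simple_root :: "('w, 'm) monoid_scheme \<Rightarrow> 'w set \<Rightarrow> 'w \<Rightarrow> 'w set" where
  "simple_root W S u = {w \<in> carrier W. cox_length W S (u \<otimes>\<^bsub>W\<^esub> w) > cox_length W S w}"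

definition roots :: "('w, 'm) monoid_scheme \<Rightarrow> 'w set \<Rightarrow> 'w set set" where
  "roots W S = {v <#\<^bsub>W\<^esub> simple_root W S u | v u. v \<in> carrier W \<and> u \<in> S}"

definition pos_roots :: "('w, 'm) monoid_scheme \<Rightarrow> 'w set \<Rightarrow> 'w set set" where
  "pos_roots W S = {\<alpha> \<in> roots W S. \<one>\<^bsub>W\<^esub> \<in> \<alpha>}"

definition opp :: "('w, 'm) monoid_scheme \<Rightarrow> 'w set \<Rightarrow> 'w set" where
  "opp W \<alpha> = carrier W - \<alpha>"

definition prenilpotent :: "('w, 'm) monoid_scheme \<Rightarrow> 'w set \<Rightarrow> 'w set \<Rightarrow> bool" where
  "prenilpotent W \<alpha> \<beta> \<longleftrightarrow> \<alpha> \<inter> \<beta> \<noteq> {} \<and> opp W \<alpha> \<inter> opp W \<beta> \<noteq> {}"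

definition root_interval :: "('w, 'm) monoid_scheme \<Rightarrow> 'w set \<Rightarrow> 'w set \<Rightarrow> 'w set \<Rightarrow> 'w set set" where
  "root_interval W S \<alpha> \<beta> =
     {\<gamma> \<in> roots W S. \<alpha> \<inter> \<beta> \<subseteq> \<gamma> \<and> opp W \<alpha> \<inter> opp W \<beta> \<subseteq> opp W \<gamma>}"

definition open_root_interval ::
  "('w, 'm) monoid_scheme \<Rightarrow> 'w set \<Rightarrow> 'w set \<Rightarrow> 'w set \<Rightarrow> 'w set set" where
  "open_root_interval W S \<alpha> \<beta> = root_interval W S \<alpha> \<beta> - {\<alpha>, \<beta>}"

section \<open>RGD-systems\<close>

definition commutator_subgroup :: "('g, 'n) monoid_scheme \<Rightarrow> 'g set \<Rightarrow> 'g set \<Rightarrow> 'g set" where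
  "commutator_subgroup G A B =
     generate G {inv\<^bsub>G\<^esub> a \<otimes>\<^bsub>G\<^esub> inv\<^bsub>G\<^esub> b \<otimes>\<^bsub>G\<^esub> a \<otimes>\<^bsub>G\<^esub> b | a b. a \<in> A \<and> b \<in> B}"

text \<open>
  A family of root groups is a function on all subsets of \<open>W\<close>; only its values on roots matter.
\<close>

locale RGD_system = coxeter_system W S + G: group G
  for W :: "('w, 'm) monoid_scheme" and S :: "'w set"
    and G :: "('g, 'n) monoid_scheme" and U :: "'w set \<Rightarrow> 'g set" +
  assumes root_subgroup: "\<alpha> \<in> roots W S \<Longrightarrow> subgroup (U \<alpha>) G"
    and RGD0: "\<alpha> \<in> roots W S \<Longrightarrow> U \<alpha> \<noteq> {\<one>\<^bsub>G\<^esub>}"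
    and RGD1: "\<lbrakk>\<alpha> \<in> roots W S; \<beta> \<in> roots W S; \<alpha> \<noteq> \<beta>; prenilpotent W \<alpha> \<beta>\<rbrakk> \<Longrightarrow>
      commutator_subgroup G (U \<alpha>) (U \<beta>) \<subseteq> generate G (\<Union>\<gamma>\<in>open_root_interval W S \<alpha> \<beta>. U \<gamma>)"
    and RGD2: "\<lbrakk>u \<in> S; x \<in> U (simple_root W S u) - {\<one>\<^bsub>G\<^esub>}\<rbrakk> \<Longrightarrow>
      \<exists>x'\<in>U (opp W (simple_root W S u)). \<exists>x''\<in>U (opp W (simple_root W S u)).
        \<forall>\<beta>\<in>roots W S.
          (x' \<otimes>\<^bsub>G\<^esub> x \<otimes>\<^bsub>G\<^esub> x'') <#\<^bsub>G\<^esub> U \<beta> #>\<^bsub>G\<^esub> inv\<^bsub>G\<^esub> (x' \<otimes>\<^bsub>G\<^esub> x \<otimes>\<^bsub>G\<^esub> x'') = U (u <#\<^bsub>W\<^esub> \<beta>)"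
    and RGD3: "u \<in> S \<Longrightarrow>
      \<not> U (opp W (simple_root W S u)) \<subseteq> generate G (\<Union>\<alpha>\<in>pos_roots W S. U \<alpha>)"
    and RGD4: "carrier G =
      (\<Inter>\<alpha>\<in>roots W S. normalizer G (U \<alpha>)) <#>\<^bsub>G\<^esub> generate G (\<Union>\<alpha>\<in>roots W S. U \<alpha>)"

definition over_F2 :: "('w, 'm) monoid_scheme \<Rightarrow> 'w set \<Rightarrow> ('w set \<Rightarrow> 'g set) \<Rightarrow> bool" where
  "over_F2 W S U \<longleftrightarrow> (\<forall>\<alpha>\<in>roots W S. card (U \<alpha>) = 2)"

definition U_of ::
  "('w, 'm) monoid_scheme \<Rightarrow> 'w set \<Rightarrow> ('g, 'n) monoid_scheme \<Rightarrow> ('w set \<Rightarrow> 'g set) \<Rightarrow> 'w \<Rightarrow> 'g set"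
where
  "U_of W S G U w = generate G (\<Union>\<alpha>\<in>{\<alpha> \<in> pos_roots W S. w \<notin> \<alpha>}. U \<alpha>)"

abbreviation restr :: "('g, 'n) monoid_scheme \<Rightarrow> 'g set \<Rightarrow> ('g, 'n) monoid_scheme" where
  "restr G H \<equiv> G\<lparr>carrier := H\<rparr>"

text \<open>
  The tree product of three subgroups \<open>A\<close>, \<open>B\<close>, \<open>C\<close> of \<open>G\<close> along subgroups \<open>H\<close> of
  \<open>A\<close> and \<open>B\<close> and \<open>K\<close> of \<open>B\<close> and \<open>C\<close>, all edge maps being inclusions, and its canonical
  homomorphism to \<open>G\<close>.
\<close>

definition subgroup_tree_product ::
  "('g, 'n) monoid_scheme \<Rightarrow> 'g set \<Rightarrow> 'g set \<Rightarrow> 'g set \<Rightarrow> 'g set \<Rightarrow> 'g set \<Rightarrow>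
   ('g + 'g + 'g) list set monoid" where
  "subgroup_tree_product G A H B K C =
     tree_product (restr G A) id (restr G H) id (restr G B) id (restr G K) id (restr G C)"

definition canonical_map :: "('g, 'n) monoid_scheme \<Rightarrow> ('g + 'g + 'g) list set \<Rightarrow> 'g" where
  "canonical_map G = tree_product_map G id id id"

end

theory Submission
  imports Defs
begin

text \<open>
  We let the syllables of the tree product play ping-pong on the chambers of the negative building of
  the RGD-system. There \<open>V\<close> stabilises the \<open>{s, t}\<close>-residue \<open>R\<close> of the fundamental chamber and fixes the
  chamber of \<open>R\<close> opposite to it. A nontrivial reduced product moves this chamber out of \<open>R\<close>: after
  each syllable from \<open>U\<^bsub>sr\<^esub>\<close> or \<open>U\<^bsub>trt\<^esub>\<close>, the projection of the chamber to \<open>R\<close> and the cone type of its Weyl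
  distance to \<open>R\<close> are controlled. The cone types are manageable since in type (4,4,4) an element with left
  descent \<open>i\<close> has no reduced word that starts with \<open>j k\<close>. The delicate syllables are those in
  \<open>V\<close>; over the field with two elements, the commutator of the generators of \<open>U\<^sub>s\<close> and \<open>U\<^sub>t\<close> is
  the product of the generators of the root groups of \<open>s \<alpha>\<^sub>t\<close> and \<open>t \<alpha>\<^sub>s\<close>.

  The Bruhat decomposition of the negative building requires axiom RGD3 with the signs exchanged. It
  follows from simple connectedness of the positive building: the codistance from the negative
  fundamental chamber can be propagated along minimal galleries and depends on the chamber only.
\<close>

section \<open>Inversions and roots\<close>

text \<open>The positive building cannot serve for ping-pong: all three vertex groups lie in the
  group generated by the positive root groups and fix its fundamental chamber. On the negative side
  RGD3 says nothing, and without it different double cosets of the negative Borel subgroup are not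
  known to be disjoint; so the codistance has to be built first. Over the field with two elements a
  root group is a single involution. A system thus becomes a family \<open>x\<close> of group
  elements (\<open>rgd_F2\<close>), and the change of signs is composition of \<open>x\<close> with
  \<open>opp W\<close> (\<open>opposite\<close>); the facts on double cosets are proved once and
  used for both signs. A reduced product is tested on the single chamber of \<open>d0\<close>. As
  \<open>V\<close> fixes it, the starting position does not depend on the last syllable from
  \<open>V\<close>. Since \<open>V\<close> has at most eight elements, each syllable is discussed
  case by case; most lead to words in \<open>s\<close> and \<open>t\<close> of length at most four,
  which stay reduced. Those with a naive word of length five force the use of the
  commutator.\<close>

context coxeter_system
begin

abbreviation len :: "'w \<Rightarrow> nat" where "len \<equiv> cox_length W S"

definition wprod :: "'w list \<Rightarrow> 'w" where "wprod ws = word_prod W id ws"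

lemma S_closed [simp]: "u \<in> S \<Longrightarrow> u \<in> carrier W"
  using S_subset by auto

lemma inv_gen [simp]: "u \<in> S \<Longrightarrow> inv u = u"
  using generator_involutive by (intro inv_equality) auto

lemma gen_cancel [simp]: "u \<in> S \<Longrightarrow> w \<in> carrier W \<Longrightarrow> u \<otimes> (u \<otimes> w) = w"
  using generator_involutive by (simp flip: m_assoc)

lemma wprod_Nil [simp]: "wprod [] = \<one>"
  by (simp add: wprod_def word_prod_def)

lemma wprod_Cons [simp]: "wprod (u # ws) = u \<otimes> wprod ws"
  by (simp add: wprod_def word_prod_def)

lemma wprod_closed [simp]: "ws \<in> lists S \<Longrightarrow> wprod ws \<in> carrier W"
  by (induction ws) auto

lemma wprod_append: "us \<in> lists S \<Longrightarrow> vs \<in> lists S \<Longrightarrow> wprod (us @ vs) = wprod us \<otimes> wprod vs"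
  by (induction us) (auto simp: m_assoc)

text \<open>The parity of the number of occurrences of \<open>t\<close> among the reflections \<open>v u (inv v)\<close> for the prefixes
  \<open>v u\<close> of the word; unlike the number itself it depends on the product of the word only.\<close>

primrec inversion_parity :: "'w list \<Rightarrow> 'w \<Rightarrow> bool" where
  "inversion_parity [] t = False"
| "inversion_parity (u # ws) t = ((t = u) \<noteq> inversion_parity ws (u \<otimes> t \<otimes> u))"

text \<open>A cocycle rule: the reflections that come from the prefixes reaching into
  \<open>vs\<close> are conjugated by the product of \<open>us\<close>.\<close>

lemma inversion_parity_append:
  assumes "us \<in> lists S" "t \<in> carrier W"
  shows "inversion_parity (us @ vs) t =
    (inversion_parity us t \<noteq> inversion_parity vs (inv (wprod us) \<otimes> t \<otimes> wprod us))"
  using assms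
proof (induction us arbitrary: t)
  case (Cons u us)
  have "inv (u \<otimes> wprod us) \<otimes> t \<otimes> (u \<otimes> wprod us) = inv (wprod us) \<otimes> (u \<otimes> t \<otimes> u) \<otimes> wprod us"
    using Cons by (simp add: inv_mult_group m_assoc)
  then show ?case
    using Cons by auto
qed auto

lemma odd_card_less_2: "odd (card {i::nat. i < 2 \<and> P i}) \<longleftrightarrow> (P 0 \<noteq> P 1)"
proof -
  have "{i::nat. i < 2 \<and> P i} = (if P 0 then {0} else {}) \<union> (if P 1 then {1} else {})"
    by (auto simp: less_2_cases_iff intro!: gr0I)
  then show ?thesis by auto
qed

text \<open>The prefixes of the alternating word give the reflections \<open>(a b)^i a\<close>. The
  induction strips two letters, and conjugation by them shifts \<open>i\<close> by two.\<close>

lemma inversion_parity_dihedral: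
  assumes "a \<in> S" "b \<in> S" "z \<in> carrier W"
  shows "inversion_parity (concat (replicate n [a, b])) z =
    odd (card {i. i < 2 * n \<and> z = (a \<otimes> b) [^] i \<otimes> a})"
  using assms(3)
proof (induction n arbitrary: z)
  case 0
  then show ?case by simp
next
  case (Suc n)
  let ?c = "a \<otimes> b"
  let ?z = "b \<otimes> (a \<otimes> z \<otimes> a) \<otimes> b"
  have shift: "?z = ?c [^] i \<otimes> a \<longleftrightarrow> z = ?c [^] (i + 2) \<otimes> a" for i :: nat
  proof -
    let ?y = "?c [^] i \<otimes> a"
    have "?y \<in> carrier W" "?z \<in> carrier W" "?c \<in> carrier W" "b \<otimes> a \<in> carrier W"
      using assms(1,2) Suc.prems by auto
    then have "?z = ?y \<longleftrightarrow> ?c \<otimes> ?z \<otimes> (b \<otimes> a) = ?c \<otimes> ?y \<otimes> (b \<otimes> a)"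
      by (metis Units_eq Units_l_cancel m_closed right_cancel)
    moreover have "?c \<otimes> ?z \<otimes> (b \<otimes> a) = z"
      using assms(1,2) Suc.prems by (simp add: m_assoc generator_involutive)
    moreover have "?c \<otimes> (?c [^] i \<otimes> a) \<otimes> (b \<otimes> a) = ?c [^] (i + 2) \<otimes> a"
    proof -
      have "?c \<otimes> ?c [^] i = ?c [^] Suc i"
        using assms(1,2) nat_pow_Suc2[of ?c i] by simp
      then have "?c \<otimes> (?c [^] i \<otimes> a) \<otimes> (b \<otimes> a) = ?c [^] Suc i \<otimes> ?c \<otimes> a"
        using assms(1,2) by (simp flip: m_assoc)
      then show ?thesis by simp
    qed
    ultimately show ?thesis by simp
  qed
  let ?P = "\<lambda>i::nat. z = ?c [^] i \<otimes> a"
  have "{i. i < 2 * Suc n \<and> ?P i} =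
      {i. i < 2 \<and> ?P i} \<union> (\<lambda>i. i + 2) ` {i. i < 2 * n \<and> ?P (i + 2)}"
    (is "?L = ?A \<union> ?f ` ?B")
  proof (intro equalityI subsetI)
    fix i assume i: "i \<in> ?L"
    show "i \<in> ?A \<union> ?f ` ?B"
    proof (cases "i < 2")
      case False
      then obtain k where "i = k + 2" by (metis add.commute le_Suc_ex not_less)
      then show ?thesis using i by auto
    qed (use i in auto)
  qed auto
  moreover have "card (?A \<union> ?f ` ?B) = card ?A + card ?B"
  proof -
    have "card (?f ` ?B) = card ?B" by (intro card_image inj_onI) simp
    then show ?thesis by (subst card_Un_disjoint) (auto simp del: nat_pow_Suc)
  qed
  moreover have "odd (card ?A) \<longleftrightarrow> (?P 0 \<noteq> ?P 1)"
    by (rule odd_card_less_2)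
  moreover have "inversion_parity (concat (replicate n [a, b])) ?z = odd (card ?B)"
    using Suc.IH[of ?z] assms(1,2) Suc.prems by (simp only: shift) simp
  moreover have P1: "?P 1 \<longleftrightarrow> a \<otimes> z \<otimes> a = b"
  proof -
    have "a \<otimes> z \<otimes> a = b \<longleftrightarrow> a \<otimes> (a \<otimes> z \<otimes> a) \<otimes> a = a \<otimes> b \<otimes> a"
      using assms(1,2) Suc.prems by auto
    moreover have "a \<otimes> (a \<otimes> z \<otimes> a) \<otimes> a = z"
      using assms(1,2) Suc.prems by (simp add: m_assoc generator_involutive)
    ultimately show ?thesis
      using assms(1,2) by auto
  qed
  ultimately have "odd (card {i. i < 2 * Suc n \<and> ?P i}) \<longleftrightarrow>
      ((?P 0 \<noteq> ?P 1) \<noteq> inversion_parity (concat (replicate n [a, b])) ?z)"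
    by (simp only: even_add) argo
  moreover have "?P 0 \<longleftrightarrow> z = a"
    using assms(1) by simp
  moreover note P1
  ultimately have "odd (card {i. i < 2 * Suc n \<and> ?P i}) \<longleftrightarrow>
      ((z = a) \<noteq> inversion_parity (b # concat (replicate n [a, b])) (a \<otimes> z \<otimes> a))"
    by (simp only: inversion_parity.simps) argo
  then show ?case
    by simp
qed

text \<open>The reflections \<open>(a b)^i a\<close> have period \<open>ord (a \<otimes> b)\<close>
  in \<open>i\<close>, so each is met an even number of times along the relator. For infinite order
  the relator is empty.\<close>

lemma inversion_parity_relator:
  assumes "a \<in> S" "b \<in> S" "z \<in> carrier W"
  shows "\<not> inversion_parity (concat (replicate (ord (a \<otimes> b)) [a, b])) z"
proof -
  let ?m = "ord (a \<otimes> b)"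
  let ?P = "\<lambda>i::nat. z = (a \<otimes> b) [^] i \<otimes> a"
  have per: "?P (i + ?m) \<longleftrightarrow> ?P i" for i
    using assms(1,2) by (simp flip: nat_pow_mult)
  have "{i. i < 2 * ?m \<and> ?P i} = {i. i < ?m \<and> ?P i} \<union> (\<lambda>i. i + ?m) ` {i. i < ?m \<and> ?P i}"
    (is "?L = ?A \<union> ?f ` ?A")
  proof (intro equalityI subsetI)
    fix i assume i: "i \<in> ?L"
    show "i \<in> ?A \<union> ?f ` ?A"
    proof (cases "i < ?m")
      case False
      then obtain k where "i = k + ?m" by (metis add.commute le_Suc_ex not_less)
      then show ?thesis using i per by auto
    qed (use i in auto)
  qed (use per in auto)
  moreover have "card (?A \<union> ?f ` ?A) = card ?A + card ?A"
    by (subst card_Un_disjoint) (auto simp: card_image)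
  ultimately show ?thesis
    using inversion_parity_dihedral[OF assms, of ?m] by simp
qed

text \<open>Here the presentation of \<open>W\<close> enters: inserting a relator does not change
  the parity, since the relator has product \<open>\<one>\<close> and contributes evenly.\<close>

lemma inversion_parity_cong:
  assumes "us \<in> lists S" "vs \<in> lists S" "wprod us = wprod vs" "t \<in> carrier W"
  shows "inversion_parity us t = inversion_parity vs t"
proof -
  have "(us, vs) \<in> word_cong S (coxeter_rels W S)"
    using assms by (intro presentation) (simp_all only: wprod_def)
  then have "wprod us = wprod vs \<and> (\<forall>t\<in>carrier W. inversion_parity us t = inversion_parity vs t)"
  proof (induction rule: word_cong.induct)
    case (base u v xs ys)
    then obtain a b where ab: "a \<in> S" "b \<in> S" "u = concat (replicate (ord (a \<otimes> b)) [a, b])" "v = []"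
      unfolding coxeter_rels_def by blast
    have "wprod (concat (replicate n [a, b])) = (a \<otimes> b) [^] n" for n
    proof (induction n)
      case (Suc n)
      have "(a \<otimes> b) [^] Suc n = (a \<otimes> b) \<otimes> (a \<otimes> b) [^] n"
        using ab by (intro nat_pow_Suc2) auto
      with Suc show ?case using ab by (simp add: m_assoc)
    qed simp
    then have u: "wprod u = \<one>"
      using ab by simp
    have "inversion_parity (xs @ u @ ys) t = inversion_parity (xs @ v @ ys) t"
      if "t \<in> carrier W" for t
      using base(2-5) that ab u inversion_parity_relator[of a b]
      by (simp add: inversion_parity_append)
    then show ?case
      using base(2-5) ab(4) u by (simp add: wprod_append)
  qed auto
  then show ?thesis
    using assms by blast
qed

text \<open>For a reflection \<open>t\<close> this says that the wall of \<open>t\<close> separates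
  \<open>\<one>\<close> from \<open>w\<close>. The choice of the word does not matter by
  \<open>inversion_parity_cong\<close>.\<close>

definition inversion :: "'w \<Rightarrow> 'w \<Rightarrow> bool" where
  "inversion w t = inversion_parity (SOME ws. ws \<in> lists S \<and> wprod ws = w) t"

lemma inversion_wprod:
  assumes "ws \<in> lists S" "t \<in> carrier W"
  shows "inversion (wprod ws) t = inversion_parity ws t"
proof -
  have "\<exists>vs. vs \<in> lists S \<and> wprod vs = wprod ws"
    using assms by blast
  then have "(SOME vs. vs \<in> lists S \<and> wprod vs = wprod ws) \<in> lists S \<and>
      wprod (SOME vs. vs \<in> lists S \<and> wprod vs = wprod ws) = wprod ws"
    by (rule someI_ex)
  then show ?thesis
    unfolding inversion_def using assms by (intro inversion_parity_cong) auto
qed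

lemma inversion_one [simp]: "t \<in> carrier W \<Longrightarrow> \<not> inversion \<one> t"
  using inversion_wprod[of "[]" t] by simp

lemma inversion_mult:
  assumes "v \<in> carrier W" "w \<in> carrier W" "t \<in> carrier W"
  shows "inversion (v \<otimes> w) t = (inversion v t \<noteq> inversion w (inv v \<otimes> t \<otimes> v))"
proof -
  obtain us vs where us: "us \<in> lists S" "wprod us = v" and vs: "vs \<in> lists S" "wprod vs = w"
    using assms generator_word unfolding wprod_def by metis
  have "inversion (v \<otimes> w) t = inversion_parity (us @ vs) t"
    using us vs assms inversion_wprod[of "us @ vs" t] by (simp add: wprod_append)
  then show ?thesis
    using us vs assms inversion_wprod[of us] inversion_wprod[of vs]
    by (simp add: inversion_parity_append)
qed

lemma inversion_gen: "u \<in> S \<Longrightarrow> t \<in> carrier W \<Longrightarrow> inversion u t \<longleftrightarrow> t = u"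
  using inversion_wprod[of "[u]" t] by simp

lemma inversion_gen_mult:
  "u \<in> S \<Longrightarrow> w \<in> carrier W \<Longrightarrow> t \<in> carrier W \<Longrightarrow>
    inversion (u \<otimes> w) t = ((t = u) \<noteq> inversion w (u \<otimes> t \<otimes> u))"
  by (simp add: inversion_mult inversion_gen)

section \<open>Length, the deletion condition and left descents\<close>

lemma len_le: "ws \<in> lists S \<Longrightarrow> len (wprod ws) \<le> length ws"
  unfolding cox_length_def wprod_def by (rule Least_le) blast

lemma reduced_word:
  assumes "w \<in> carrier W"
  obtains ws where "ws \<in> lists S" "wprod ws = w" "length ws = len w"
proof -
  have "\<exists>n. \<exists>ws\<in>lists S. length ws = n \<and> wprod ws = w"
    using generator_word[OF assms] unfolding wprod_def by blast
  then have "\<exists>ws\<in>lists S. length ws = len w \<and> wprod ws = w"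
    unfolding cox_length_def wprod_def by (rule LeastI_ex)
  then show thesis using that by blast
qed

lemma len_mult_le:
  assumes "v \<in> carrier W" "w \<in> carrier W"
  shows "len (v \<otimes> w) \<le> len v + len w"
proof -
  obtain us vs where "us \<in> lists S" "wprod us = v" "length us = len v"
    "vs \<in> lists S" "wprod vs = w" "length vs = len w"
    using assms reduced_word by metis
  then show ?thesis
    using len_le[of "us @ vs"] by (simp add: wprod_append)
qed

lemma len_gen_mult_le: "u \<in> S \<Longrightarrow> w \<in> carrier W \<Longrightarrow> len (u \<otimes> w) \<le> Suc (len w)"
  using len_mult_le[of u w] len_le[of "[u]"] by simp

text \<open>An odd count is positive, so some prefix has reflection \<open>t\<close>; dropping the
  last letter of the first such prefix multiplies the product by \<open>t\<close> from the
  left.\<close>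

lemma inversion_deletion:
  assumes "ws \<in> lists S" "t \<in> carrier W" "inversion_parity ws t"
  shows "\<exists>vs\<in>lists S. length vs < length ws \<and> wprod vs = t \<otimes> wprod ws"
  using assms
proof (induction ws arbitrary: t)
  case (Cons u ws)
  show ?case
  proof (cases "t = u")
    case True
    then show ?thesis using Cons by (intro bexI[of _ ws]) auto
  next
    case False
    then have "inversion_parity ws (u \<otimes> t \<otimes> u)" using Cons.prems by simp
    then obtain vs where "vs \<in> lists S" "length vs < length ws"
      "wprod vs = u \<otimes> t \<otimes> u \<otimes> wprod ws"
      using Cons.IH[of "u \<otimes> t \<otimes> u"] Cons.hyps Cons.prems by auto
    then show ?thesis
      using Cons.hyps Cons.prems by (intro bexI[of _ "u # vs"]) (auto simp: m_assoc)
  qed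
qed simp

lemma inversion_len:
  assumes "w \<in> carrier W" "t \<in> carrier W" "inversion w t"
  shows "len (t \<otimes> w) < len w"
proof -
  obtain ws where ws: "ws \<in> lists S" "wprod ws = w" "length ws = len w"
    using assms reduced_word by metis
  then have "inversion_parity ws t"
    using assms inversion_wprod by blast
  then obtain vs where "vs \<in> lists S" "length vs < length ws" "wprod vs = t \<otimes> w"
    using inversion_deletion ws assms by metis
  then show ?thesis using len_le[of vs] ws by simp
qed

abbreviation des :: "'w \<Rightarrow> 'w \<Rightarrow> bool" where "des u w \<equiv> inversion w u"

lemma des_flip [simp]: "u \<in> S \<Longrightarrow> w \<in> carrier W \<Longrightarrow> des u (u \<otimes> w) \<longleftrightarrow> \<not> des u w"
  by (simp add: inversion_gen_mult m_assoc generator_involutive)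

lemma des_len:
  assumes "u \<in> S" "w \<in> carrier W" "des u w"
  shows "len w = Suc (len (u \<otimes> w))"
  using inversion_len[of w u] len_gen_mult_le[of u "u \<otimes> w"] assms by simp

lemma not_des_len:
  assumes "u \<in> S" "w \<in> carrier W" "\<not> des u w"
  shows "len (u \<otimes> w) = Suc (len w)"
  using des_len[of u "u \<otimes> w"] assms by simp

lemma len_one [simp]: "len \<one> = 0"
  using len_le[of "[]"] by simp

lemma ex_des:
  assumes "w \<in> carrier W" "w \<noteq> \<one>"
  shows "\<exists>u\<in>S. des u w"
proof -
  obtain ws where ws: "ws \<in> lists S" "wprod ws = w" "length ws = len w"
    using assms reduced_word by metis
  then obtain u vs where u: "ws = u # vs" using assms by (cases ws) auto
  then have "u \<in> S" "vs \<in> lists S" "w = u \<otimes> wprod vs" using ws by auto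
  then have "u \<in> S" "len (u \<otimes> w) \<le> length vs" using len_le[of vs] by auto
  moreover from this have "des u w"
    using not_des_len[of u w] assms(1) ws(3) u by fastforce
  ultimately show ?thesis by blast
qed

lemma len_inv [simp]:
  assumes "w \<in> carrier W"
  shows "len (inv w) = len w"
proof -
  have le: "len (inv v) \<le> len v" if "v \<in> carrier W" for v
  proof -
    obtain ws where ws: "ws \<in> lists S" "wprod ws = v" "length ws = len v"
      using reduced_word[OF \<open>v \<in> carrier W\<close>] by blast
    have "wprod (rev ws) = inv (wprod ws)"
      using ws(1) by (induction ws) (auto simp: wprod_append inv_mult_group in_lists_conv_set)
    then have "wprod (rev ws) = inv v" "rev ws \<in> lists S" using ws by auto
    then show ?thesis using len_le[of "rev ws"] ws by simp
  qed
  show ?thesis using le[of w] le[of "inv w"] assms by simp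
qed

lemma simple_root_eq: "u \<in> S \<Longrightarrow> simple_root W S u = {w \<in> carrier W. \<not> des u w}"
  unfolding simple_root_def using des_len[of u] not_des_len[of u] by (intro Collect_cong) force

section \<open>Roots and the action of \<open>W\<close> on them\<close>

abbreviation rts :: "'w set set" where "rts \<equiv> roots W S"
abbreviation prts :: "'w set set" where "prts \<equiv> pos_roots W S"
abbreviation sr :: "'w \<Rightarrow> 'w set" where "sr \<equiv> simple_root W S"
abbreviation act :: "'w \<Rightarrow> 'w set \<Rightarrow> 'w set"  (infixr "\<cdot>" 75) where "w \<cdot> \<gamma> \<equiv> w <# \<gamma>"

lemma sr_subset: "u \<in> S \<Longrightarrow> sr u \<subseteq> carrier W"
  by (auto simp: simple_root_def)

lemma root_subset: "\<gamma> \<in> rts \<Longrightarrow> \<gamma> \<subseteq> carrier W"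
proof -
  assume "\<gamma> \<in> rts"
  then obtain v u where "v \<in> carrier W" "u \<in> S" "\<gamma> = v \<cdot> sr u" unfolding roots_def by blast
  then show ?thesis using l_coset_subset_G[OF sr_subset] by simp
qed

lemma act_iff:
  assumes "\<gamma> \<subseteq> carrier W" "v \<in> carrier W" "w \<in> carrier W"
  shows "w \<in> v \<cdot> \<gamma> \<longleftrightarrow> inv v \<otimes> w \<in> \<gamma>"
proof
  assume "w \<in> v \<cdot> \<gamma>"
  then obtain h where h: "h \<in> \<gamma>" "w = v \<otimes> h" unfolding l_coset_def by blast
  then have "inv v \<otimes> w = h" using assms by (subst h(2), subst m_assoc[symmetric]) auto
  then show "inv v \<otimes> w \<in> \<gamma>" using h by simp
next
  assume "inv v \<otimes> w \<in> \<gamma>"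
  moreover have "w = v \<otimes> (inv v \<otimes> w)" using assms by (simp flip: m_assoc)
  ultimately show "w \<in> v \<cdot> \<gamma>" unfolding l_coset_def by blast
qed

lemma sr_root: "u \<in> S \<Longrightarrow> sr u \<in> rts"
proof -
  assume u: "u \<in> S"
  then have "sr u = \<one> \<cdot> sr u" using lcos_mult_one[OF sr_subset] by simp
  then show ?thesis unfolding roots_def using u by blast
qed

lemma act_root: "w \<in> carrier W \<Longrightarrow> \<gamma> \<in> rts \<Longrightarrow> w \<cdot> \<gamma> \<in> rts"
proof -
  assume w: "w \<in> carrier W" and "\<gamma> \<in> rts"
  then obtain v u where "v \<in> carrier W" "u \<in> S" "\<gamma> = v \<cdot> sr u" unfolding roots_def by blast
  then have "w \<cdot> \<gamma> = (w \<otimes> v) \<cdot> sr u" "w \<otimes> v \<in> carrier W" "u \<in> S"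
    using lcos_m_assoc[OF sr_subset] w by auto
  then show ?thesis unfolding roots_def by blast
qed

lemma act_act: "\<gamma> \<in> rts \<Longrightarrow> v \<in> carrier W \<Longrightarrow> w \<in> carrier W \<Longrightarrow> v \<cdot> (w \<cdot> \<gamma>) = (v \<otimes> w) \<cdot> \<gamma>"
  using lcos_m_assoc[OF root_subset] by simp

lemma act_one: "\<gamma> \<in> rts \<Longrightarrow> \<one> \<cdot> \<gamma> = \<gamma>"
  using lcos_mult_one[OF root_subset] .

lemma in_act_iff: "\<gamma> \<in> rts \<Longrightarrow> v \<in> carrier W \<Longrightarrow> w \<in> carrier W \<Longrightarrow> w \<in> v \<cdot> \<gamma> \<longleftrightarrow> inv v \<otimes> w \<in> \<gamma>"
  using act_iff[OF root_subset] .

lemma in_sr: "u \<in> S \<Longrightarrow> w \<in> carrier W \<Longrightarrow> w \<in> sr u \<longleftrightarrow> \<not> des u w"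
  by (simp add: simple_root_eq)

lemma opp_opp: "\<gamma> \<in> rts \<Longrightarrow> opp W (opp W \<gamma>) = \<gamma>"
  using root_subset by (auto simp: opp_def)

lemma opp_sr:
  assumes "u \<in> S"
  shows "opp W (sr u) = u \<cdot> sr u"
proof (rule Set.set_eqI)
  fix w
  show "w \<in> opp W (sr u) \<longleftrightarrow> w \<in> u \<cdot> sr u"
  proof (cases "w \<in> carrier W")
    case True
    then show ?thesis using assms by (simp add: opp_def in_act_iff sr_root in_sr)
  next
    case False
    then show ?thesis
      using root_subset[OF act_root[OF S_closed sr_root]] assms by (auto simp: opp_def)
  qed
qed

lemma opp_act:
  assumes "\<gamma> \<in> rts" "v \<in> carrier W"
  shows "opp W (v \<cdot> \<gamma>) = v \<cdot> opp W \<gamma>"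
proof (rule Set.set_eqI)
  fix w
  have sub: "opp W \<gamma> \<subseteq> carrier W" by (auto simp: opp_def)
  show "w \<in> opp W (v \<cdot> \<gamma>) \<longleftrightarrow> w \<in> v \<cdot> opp W \<gamma>"
  proof (cases "w \<in> carrier W")
    case True
    then show ?thesis using assms sub by (simp add: act_iff root_subset) (simp add: opp_def act_iff root_subset)
  next
    case False
    then show ?thesis using l_coset_subset_G[OF sub assms(2)] by (auto simp: opp_def)
  qed
qed

lemma opp_root: "\<gamma> \<in> rts \<Longrightarrow> opp W \<gamma> \<in> rts"
proof -
  assume "\<gamma> \<in> rts"
  then obtain v u where "v \<in> carrier W" "u \<in> S" "\<gamma> = v \<cdot> sr u" unfolding roots_def by blast
  then show ?thesis by (simp add: opp_act sr_root opp_sr act_root)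
qed

lemma root_nonempty: "\<gamma> \<in> rts \<Longrightarrow> \<exists>w\<in>carrier W. w \<in> \<gamma>"
proof -
  assume "\<gamma> \<in> rts"
  then obtain v u where vu: "v \<in> carrier W" "u \<in> S" "\<gamma> = v \<cdot> sr u" unfolding roots_def by blast
  then have "v \<in> \<gamma>" by (simp add: in_act_iff sr_root in_sr)
  then show ?thesis using vu by blast
qed

text \<open>For \<open>\<gamma> = v \<cdot> sr a\<close> the letter \<open>a\<close> is a descent of
  exactly one of \<open>inv v\<close> and \<open>inv v \<otimes> u\<close>. By the cocycle rule the
  reflection \<open>v a (inv v)\<close> is then an inversion of \<open>u\<close>, hence equal to
  \<open>u\<close>; so the two roots have the same wall.\<close>

lemma root_separation:
  assumes "\<gamma> \<in> rts" "u \<in> S" "\<one> \<in> \<gamma>" "u \<notin> \<gamma>"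
  shows "\<gamma> = sr u"
proof -
  obtain v a where va: "v \<in> carrier W" "a \<in> S" "\<gamma> = v \<cdot> sr a"
    using assms unfolding roots_def by blast
  let ?p = "inv v"
  have in_iff: "w \<in> \<gamma> \<longleftrightarrow> \<not> des a (?p \<otimes> w)" if "w \<in> carrier W" for w
    using that va by (simp add: in_act_iff sr_root in_sr)
  have p: "\<not> des a ?p" "des a (?p \<otimes> u)"
    using in_iff[of \<one>] in_iff[of u] assms va by auto
  then have "inversion u (v \<otimes> a \<otimes> ?p)"
    using va assms by (simp add: inversion_mult)
  then have eq: "v \<otimes> a \<otimes> ?p = u"
    using va assms by (simp add: inversion_gen)
  have "w \<in> \<gamma> \<longleftrightarrow> w \<in> sr u" if "w \<in> carrier W" for w
    using that in_iff[OF that] va assms p eq by (simp add: inversion_mult in_sr)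
  then show ?thesis
    using root_subset[OF assms(1)] sr_subset[OF assms(2)] by blast
qed

lemma root_separation_at:
  assumes "\<gamma> \<in> rts" "u \<in> S" "v \<in> carrier W" "v \<in> \<gamma>" "v \<otimes> u \<notin> \<gamma>"
  shows "\<gamma> = v \<cdot> sr u"
proof -
  have "inv v \<cdot> \<gamma> = sr u"
    using assms by (intro root_separation) (auto simp: act_root in_act_iff)
  then show ?thesis
    using assms by (metis act_act act_one inv_closed r_inv)
qed

lemma prts_rts: "\<gamma> \<in> prts \<Longrightarrow> \<gamma> \<in> rts"
  by (simp add: pos_roots_def)

lemma sr_pos: "u \<in> S \<Longrightarrow> sr u \<in> prts"
  by (simp add: pos_roots_def sr_root in_sr)

lemma gen_in_pos_root: "\<gamma> \<in> prts \<Longrightarrow> u \<in> S \<Longrightarrow> \<gamma> \<noteq> sr u \<Longrightarrow> u \<in> \<gamma>"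
  using root_separation by (auto simp: pos_roots_def)

lemma act_pos: "\<gamma> \<in> prts \<Longrightarrow> u \<in> S \<Longrightarrow> \<gamma> \<noteq> sr u \<Longrightarrow> u \<cdot> \<gamma> \<in> prts"
  using gen_in_pos_root[of \<gamma> u] by (simp add: pos_roots_def act_root in_act_iff)

lemma act_cancel: "\<gamma> \<in> rts \<Longrightarrow> u \<in> S \<Longrightarrow> u \<cdot> (u \<cdot> \<gamma>) = \<gamma>"
  by (simp add: act_act generator_involutive act_one)

lemma act_neq_sr:
  assumes "\<gamma> \<in> prts" "u \<in> S"
  shows "u \<cdot> \<gamma> \<noteq> sr u"
proof
  assume "u \<cdot> \<gamma> = sr u"
  then have "\<gamma> = opp W (sr u)" using assms act_cancel[of \<gamma> u] by (simp add: prts_rts opp_sr)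
  then show False using assms by (auto simp: pos_roots_def opp_def in_sr)
qed

lemma root_int_opp: "\<gamma> \<in> rts \<Longrightarrow> w \<in> carrier W \<Longrightarrow> w \<in> opp W \<gamma> \<longleftrightarrow> w \<notin> \<gamma>"
  by (simp add: opp_def)

lemma open_interval_opp:
  assumes "\<alpha> \<in> rts" "\<beta> \<in> rts"
  shows "open_root_interval W S (opp W \<alpha>) (opp W \<beta>) = opp W ` open_root_interval W S \<alpha> \<beta>"
proof (rule Set.set_eqI)
  fix \<gamma>
  have *: "opp W \<gamma> \<in> open_root_interval W S \<alpha> \<beta> \<longleftrightarrow>
      \<gamma> \<in> open_root_interval W S (opp W \<alpha>) (opp W \<beta>)" if "\<gamma> \<in> rts"
  proof -
    have "opp W \<gamma> = \<delta> \<longleftrightarrow> \<gamma> = opp W \<delta>" if "\<delta> \<in> rts" for \<delta>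
      using opp_opp that \<open>\<gamma> \<in> rts\<close> by blast
    then show ?thesis
      using assms that opp_root[OF that]
      by (auto simp: open_root_interval_def root_interval_def opp_opp)
  qed
  show "\<gamma> \<in> open_root_interval W S (opp W \<alpha>) (opp W \<beta>) \<longleftrightarrow>
      \<gamma> \<in> opp W ` open_root_interval W S \<alpha> \<beta>"
  proof
    assume \<gamma>: "\<gamma> \<in> open_root_interval W S (opp W \<alpha>) (opp W \<beta>)"
    then have "\<gamma> \<in> rts" by (simp add: open_root_interval_def root_interval_def)
    with * \<gamma> opp_opp show "\<gamma> \<in> opp W ` open_root_interval W S \<alpha> \<beta>" by (metis image_eqI)
  next
    assume "\<gamma> \<in> opp W ` open_root_interval W S \<alpha> \<beta>"
    then obtain \<delta> where \<delta>: "\<delta> \<in> open_root_interval W S \<alpha> \<beta>" "\<gamma> = opp W \<delta>" by blast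
    then have "\<delta> \<in> rts" by (simp add: open_root_interval_def root_interval_def)
    with * \<delta> opp_opp opp_root show "\<gamma> \<in> open_root_interval W S (opp W \<alpha>) (opp W \<beta>)" by metis
  qed
qed

end

section \<open>The Coxeter group of type (4,4,4)\<close>

locale coxeter_444 = coxeter_system W S
  for W :: "('w, 'm) monoid_scheme" (structure) and S :: "'w set" +
  assumes type_444: "type_444 W S"
begin

lemma ord_4: "i \<in> S \<Longrightarrow> j \<in> S \<Longrightarrow> i \<noteq> j \<Longrightarrow> ord (i \<otimes> j) = 4"
  using type_444 unfolding type_444_def by blast

lemma braid:
  assumes "i \<in> S" "j \<in> S" "i \<noteq> j" "w \<in> carrier W"
  shows "i \<otimes> (j \<otimes> (i \<otimes> (j \<otimes> w))) = j \<otimes> (i \<otimes> (j \<otimes> (i \<otimes> w)))"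
proof -
  have "(i \<otimes> j) [^] (4::nat) = \<one>"
    using pow_ord_eq_1[of "i \<otimes> j"] ord_4 assms by simp
  then have 8: "i \<otimes> (j \<otimes> (i \<otimes> (j \<otimes> (i \<otimes> (j \<otimes> (i \<otimes> j)))))) = \<one>"
    using assms by (simp add: numeral_eq_Suc m_assoc)
  have "i \<otimes> (j \<otimes> (i \<otimes> (j \<otimes> (i \<otimes> (j \<otimes> (i \<otimes> (j \<otimes> v))))))) = v" if "v \<in> carrier W" for v
    using arg_cong[OF 8, of "\<lambda>x. x \<otimes> v"] assms that by (simp add: m_assoc)
  from this[of "j \<otimes> (i \<otimes> (j \<otimes> (i \<otimes> w)))"] show ?thesis
    using assms by simp
qed

lemma conj_neq:
  assumes "i \<in> S" "j \<in> S" "i \<noteq> j"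
  shows "j \<otimes> i \<otimes> j \<noteq> i"
proof
  assume "j \<otimes> i \<otimes> j = i"
  then have "i \<otimes> j \<otimes> (i \<otimes> j) = i \<otimes> i"
    using assms by (simp add: m_assoc)
  then have "(i \<otimes> j) [^] (2::nat) = \<one>"
    using assms by (simp add: numeral_2_eq_2 generator_involutive)
  then have "4 dvd (2::nat)"
    using pow_eq_id[of "i \<otimes> j" 2] assms ord_4 by simp
  then show False by simp
qed

lemma des_iff_inversion:
  assumes "i \<in> S" "j \<in> S" "i \<noteq> j" "w \<in> carrier W"
  shows "des i (j \<otimes> w) \<longleftrightarrow> inversion w (j \<otimes> i \<otimes> j)"
  using assms by (simp add: inversion_gen_mult)

text \<open>Because \<open>(i j)^4 = 1\<close>, \<open>i\<close> commutes with the reflection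
  \<open>j i j\<close> and differs from it. So multiplication by \<open>i\<close> does not affect
  whether \<open>j i j\<close> is an inversion.\<close>

lemma des_aba [simp]:
  assumes "i \<in> S" "j \<in> S" "i \<noteq> j" "w \<in> carrier W"
  shows "des i (j \<otimes> (i \<otimes> w)) \<longleftrightarrow> des i (j \<otimes> w)"
proof -
  have "i \<otimes> (j \<otimes> i \<otimes> j) \<otimes> i = j \<otimes> i \<otimes> j"
    using braid[OF assms(1-3), of i] assms by (simp add: m_assoc generator_involutive)
  then show ?thesis
    using assms conj_neq[OF assms(1-3)]
    by (simp add: des_iff_inversion inversion_gen_mult[of i w "j \<otimes> i \<otimes> j"])
qed

text \<open>Otherwise \<open>j i j\<close> is an inversion of \<open>w\<close>, and comparing
  lengths shows that the mirror image \<open>v = j i j w\<close> is exactly one shorter. If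
  \<open>i\<close> is a descent of \<open>v\<close>, the braid relation makes \<open>i w\<close> too
  short; if not, \<open>v\<close> is a smaller counterexample with \<open>i\<close> and
  \<open>j\<close> exchanged.\<close>

lemma not_des_rank2:
  assumes "i \<in> S" "j \<in> S" "i \<noteq> j" "w \<in> carrier W" "\<not> des i w" "\<not> des j w"
  shows "\<not> des i (j \<otimes> w)"
  using assms
proof (induction "len w" arbitrary: w i j rule: less_induct)
  case less
  show ?case
  proof
    assume D: "des i (j \<otimes> w)"
    define v where "v = j \<otimes> (i \<otimes> (j \<otimes> w))"
    have v: "v \<in> carrier W" "w = j \<otimes> (i \<otimes> (j \<otimes> v))"
      using less.prems by (auto simp: v_def)
    have "len v < len w"
      using D inversion_len[of w "j \<otimes> i \<otimes> j"] less.prems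
      by (simp add: des_iff_inversion v_def m_assoc)
    moreover have "len (j \<otimes> w) = Suc (len w)" "len (i \<otimes> w) = Suc (len w)"
      using less.prems not_des_len by auto
    moreover have "len (j \<otimes> w) = Suc (len (i \<otimes> (j \<otimes> w)))"
      using less.prems D des_len by auto
    moreover have "len (i \<otimes> (j \<otimes> w)) \<le> Suc (len v)"
      using len_gen_mult_le[of j v] less.prems v(1) by (simp add: v_def)
    ultimately have l: "len w = Suc (len v)" "len (i \<otimes> w) = Suc (Suc (len v))"
      "len (i \<otimes> (j \<otimes> w)) = Suc (len v)" by auto
    have nj: "\<not> des j v"
    proof
      assume "des j v"
      then have "len v = Suc (len (j \<otimes> v))" using less.prems v(1) des_len by blast
      moreover have "j \<otimes> v = i \<otimes> (j \<otimes> w)" using less.prems by (simp add: v_def)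
      ultimately show False using l by simp
    qed
    have "des j (i \<otimes> (j \<otimes> v))"
      using less.prems by (simp add: v_def)
    then have dj: "des j (i \<otimes> v)"
      using less.prems v(1) des_aba[of j i v] by simp
    show False
    proof (cases "des i v")
      case True
      then have "len v = Suc (len (i \<otimes> v))" "len (i \<otimes> v) = Suc (len (j \<otimes> (i \<otimes> v)))"
        using des_len[of i v] des_len[of j "i \<otimes> v"] dj less.prems v(1) by auto
      moreover have "i \<otimes> w = j \<otimes> (i \<otimes> (j \<otimes> (i \<otimes> v)))"
        using braid[of i j v] v(1) less.prems by (subst v(2)) simp
      moreover have "len (j \<otimes> (i \<otimes> (j \<otimes> (i \<otimes> v)))) \<le> Suc (Suc (len (j \<otimes> (i \<otimes> v))))"
        using len_gen_mult_le[of j "i \<otimes> (j \<otimes> (i \<otimes> v))"] len_gen_mult_le[of i "j \<otimes> (i \<otimes> v)"]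
          less.prems v(1) by simp
      ultimately show False using l by simp
    next
      case False
      then show False using less.hyps[of v j i] less.prems v(1) nj dj l by auto
    qed
  qed
qed

text \<open>Left multiplication by the longest element \<open>i j i j\<close> of the rank 2 group
  exchanges tops and bottoms of residues, which reduces the claim to
  \<open>not_des_rank2\<close>.\<close>

lemma des_rank2:
  assumes "i \<in> S" "j \<in> S" "i \<noteq> j" "w \<in> carrier W" "des i w" "des j w"
  shows "des i (j \<otimes> w)"
proof -
  let ?v = "i \<otimes> (j \<otimes> (i \<otimes> (j \<otimes> w)))"
  have dist: "j \<noteq> i" using assms by simp
  have v: "?v \<in> carrier W" using assms by simp
  have "\<not> des i ?v" using assms by simp
  moreover have "\<not> des j ?v" using assms dist unfolding braid[OF assms(1-4)] by simp
  ultimately have "\<not> des i (j \<otimes> ?v)"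
    using v by (intro not_des_rank2[OF assms(1-3)])
  moreover have "j \<otimes> ?v = i \<otimes> (j \<otimes> (i \<otimes> w))"
    using assms unfolding braid[OF assms(1-4)] by simp
  ultimately show ?thesis using assms by simp
qed

text \<open>Since no rank 3 parabolic subgroup is finite, an element with left descent \<open>i\<close> has
  no reduced word starting with \<open>j k\<close>: otherwise it could be shortened forever.\<close>

lemma not_des_triple:
  assumes "i \<in> S" "j \<in> S" "k \<in> S" "i \<noteq> j" "i \<noteq> k" "j \<noteq> k" "w \<in> carrier W" "des i w"
  shows "\<not> des k (j \<otimes> w)"
  using assms
proof (induction "len w" arbitrary: w i j k rule: less_induct)
  case less
  \<comment> \<open>If \<open>i\<close> and \<open>j\<close> are both descents of \<open>w\<close>,
    then \<open>j w\<close> is a shorter counterexample: \<open>k\<close> is its descent, and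
    \<open>j\<close> is a descent of \<open>i j w\<close>.\<close>
  have both: "\<not> des k (j \<otimes> w)"
    if "i \<in> S" "j \<in> S" "k \<in> S" "i \<noteq> j" "i \<noteq> k" "j \<noteq> k" "des i w" "des j w" for i j k
  proof
    assume D: "des k (j \<otimes> w)"
    have "des j (i \<otimes> (j \<otimes> w))"
      using that less.prems(7) des_rank2[of j i w] by simp
    moreover have "len (j \<otimes> w) < len w"
      using that des_len[of j w] less.prems(7) by simp
    ultimately show False
      using less.hyps[of "j \<otimes> w" k i j] that less.prems(7) D by auto
  qed
  show ?case
  proof
    assume D: "des k (j \<otimes> w)"
    show False
    proof (cases "des j w")
      case True
      then show False using both[of i j k] less.prems D by blast
    next
      case False
      \<comment> \<open>Now \<open>j\<close> and \<open>k\<close> are both descents of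
        \<open>j w\<close>. Going down by \<open>j\<close> leaves \<open>k\<close> as a descent of
        \<open>w\<close>, so \<open>both\<close> applies with \<open>j\<close> and \<open>k\<close>
        exchanged.\<close>
      then have "des j (j \<otimes> w)"
        using less.prems by simp
      then have "des k (j \<otimes> (j \<otimes> w))" "des j (k \<otimes> (j \<otimes> w))"
        using less.prems D des_rank2[of k j "j \<otimes> w"] des_rank2[of j k "j \<otimes> w"]
        by (simp_all del: gen_cancel des_aba)
      then have "des k w" "des j (k \<otimes> w)"
        using less.prems by simp_all
      then show False using both[of i k j] less.prems by blast
    qed
  qed
qed

lemma not_des_mult [simp]:
  assumes "i \<in> S" "j \<in> S" "k \<in> S" "i \<noteq> j" "i \<noteq> k" "j \<noteq> k" "w \<in> carrier W" "\<not> des i w"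
  shows "\<not> des k (j \<otimes> (i \<otimes> w))"
  using not_des_triple[of i j k "i \<otimes> w"] assms by simp

end

section \<open>The Bruhat decomposition\<close>

lemma (in group) conj_generate:
  assumes n: "n \<in> carrier G" and X: "X \<subseteq> carrier G" and K: "subgroup K G"
    and conj: "\<And>g. g \<in> X \<Longrightarrow> n \<otimes> g \<otimes> inv n \<in> K" and g: "g \<in> generate G X"
  shows "n \<otimes> g \<otimes> inv n \<in> K"
  using g
proof (induction rule: generate.induct)
  case one
  then show ?case using n subgroup.one_closed[OF K] by simp
next
  case (incl h)
  then show ?case by (rule conj)
next
  case (inv h)
  then have "inv (n \<otimes> h \<otimes> inv n) \<in> K"
    using conj subgroup.m_inv_closed[OF K] by blast
  then show ?case using n X inv by (auto simp: inv_mult_group m_assoc)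
next
  case (eng h k)
  then have "h \<in> carrier G" "k \<in> carrier G"
    using generate_in_carrier[OF X] by auto
  then have "n \<otimes> (h \<otimes> k) \<otimes> inv n = (n \<otimes> h \<otimes> inv n) \<otimes> (n \<otimes> k \<otimes> inv n)"
    using n by (simp add: m_assoc inv_solve_left)
  then show ?case using eng subgroup.m_closed[OF K] by metis
qed

text \<open>Since \<open>e\<close> normalises \<open>K\<close>, the union of \<open>K\<close> and
  \<open>e K\<close> is closed under products.\<close>

lemma (in group) generate_insert_involution:
  assumes K: "subgroup K G" and e: "e \<in> carrier G" "e \<otimes> e = \<one>" and X: "X \<subseteq> K"
    and conj: "\<And>k. k \<in> K \<Longrightarrow> e \<otimes> k \<otimes> e \<in> K" and g: "g \<in> generate G (insert e X)"
  shows "\<exists>k\<in>K. g = k \<or> g = e \<otimes> k"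
proof -
  have car: "K \<subseteq> carrier G" using subgroup.subset[OF K] .
  have ee: "e \<otimes> (e \<otimes> y) = y" if "y \<in> carrier G" for y
    using e that by (simp flip: m_assoc)
  have ke: "\<exists>k'\<in>K. k \<otimes> e = e \<otimes> k'" if "k \<in> K" for k
  proof -
    have "k \<otimes> e = e \<otimes> (e \<otimes> k \<otimes> e)"
      using that car e ee by (simp add: m_assoc subset_iff)
    then show ?thesis using conj[OF that] by blast
  qed
  show ?thesis
    using g
  proof (induction rule: generate.induct)
    case one
    then show ?case using subgroup.one_closed[OF K] by blast
  next
    case (incl h)
    then show ?case
    proof
      assume "h = e"
      then show ?case using e subgroup.one_closed[OF K] by (intro bexI[of _ \<one>]) auto
    qed (use X in auto)
  next
    case (inv h)
    have "inv e = e" using e by (intro inv_equality)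
    then have "inv h = e \<otimes> \<one>" if "h = e" using that e by simp
    with inv show ?case
      using X subgroup.one_closed[OF K] subgroup.m_inv_closed[OF K] by blast
  next
    case (eng h1 h2)
    then obtain a b where ab: "a \<in> K" "b \<in> K" "h1 = a \<or> h1 = e \<otimes> a" "h2 = b \<or> h2 = e \<otimes> b"
      by blast
    obtain a' where a': "a' \<in> K" "a \<otimes> e = e \<otimes> a'" using ke ab by blast
    have c: "a \<in> carrier G" "b \<in> carrier G" "a' \<in> carrier G" using ab a' car by auto
    have "a \<otimes> (e \<otimes> b) = e \<otimes> (a' \<otimes> b)"
      using c e a'(2) by (metis m_assoc)
    then have "h1 \<otimes> h2 \<in> {a \<otimes> b, e \<otimes> (a \<otimes> b), e \<otimes> (a' \<otimes> b), a' \<otimes> b}"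
      using ab c e ee by (auto simp: m_assoc)
    moreover have "a \<otimes> b \<in> K" "a' \<otimes> b \<in> K"
      using ab a' subgroup.m_closed[OF K] by auto
    ultimately show ?case by auto
  qed
qed

text \<open>The root groups are replaced by their nontrivial elements. The shape of
  \<open>x_reflect\<close> comes from RGD2, where both outer factors are forced. The assumptions
  before \<open>x_opp_notin\<close> are symmetric in the signs of the roots, so in
  \<open>opposite\<close> the real work concerns that last one.\<close>

locale rgd_F2 = coxeter_444 W S + G: group G
  for W :: "('w, 'm) monoid_scheme" (structure) and S :: "'w set"
    and G :: "('g, 'n) monoid_scheme" +
  fixes x :: "'w set \<Rightarrow> 'g"
  assumes x_closed [simp]: "\<alpha> \<in> roots W S \<Longrightarrow> x \<alpha> \<in> carrier G"
    and x_sq [simp]: "\<alpha> \<in> roots W S \<Longrightarrow> x \<alpha> \<otimes>\<^bsub>G\<^esub> x \<alpha> = \<one>\<^bsub>G\<^esub>"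
    and x_comm: "\<lbrakk>\<alpha> \<in> roots W S; \<beta> \<in> roots W S; \<alpha> \<noteq> \<beta>; prenilpotent W \<alpha> \<beta>\<rbrakk> \<Longrightarrow>
      x \<alpha> \<otimes>\<^bsub>G\<^esub> x \<beta> \<otimes>\<^bsub>G\<^esub> x \<alpha> \<otimes>\<^bsub>G\<^esub> x \<beta> \<in> generate G (x ` open_root_interval W S \<alpha> \<beta>)"
    and x_reflect: "\<lbrakk>u \<in> S; \<beta> \<in> roots W S\<rbrakk> \<Longrightarrow>
      (x (opp W (simple_root W S u)) \<otimes>\<^bsub>G\<^esub> x (simple_root W S u) \<otimes>\<^bsub>G\<^esub> x (opp W (simple_root W S u)))
      \<otimes>\<^bsub>G\<^esub> x \<beta> \<otimes>\<^bsub>G\<^esub>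
      (x (opp W (simple_root W S u)) \<otimes>\<^bsub>G\<^esub> x (simple_root W S u) \<otimes>\<^bsub>G\<^esub> x (opp W (simple_root W S u)))
      = x (u <#\<^bsub>W\<^esub> \<beta>)"
    and x_opp_notin: "u \<in> S \<Longrightarrow> x (opp W (simple_root W S u)) \<notin> generate G (x ` pos_roots W S)"
begin

abbreviation gmult :: "'g \<Rightarrow> 'g \<Rightarrow> 'g" (infixl "\<bullet>" 70) where "a \<bullet> b \<equiv> a \<otimes>\<^bsub>G\<^esub> b"
abbreviation gone :: 'g ("\<one>g") where "\<one>g \<equiv> \<one>\<^bsub>G\<^esub>"
abbreviation ginv :: "'g \<Rightarrow> 'g" where "ginv a \<equiv> inv\<^bsub>G\<^esub> a"
abbreviation e :: "'w \<Rightarrow> 'g" where "e u \<equiv> x (sr u)"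
abbreviation f :: "'w \<Rightarrow> 'g" where "f u \<equiv> x (opp W (sr u))"
definition n :: "'w \<Rightarrow> 'g" where "n u = f u \<bullet> e u \<bullet> f u"
abbreviation gen :: "'w set set \<Rightarrow> 'g set" where "gen A \<equiv> generate G (x ` A)"
abbreviation U :: "'g set" where "U \<equiv> gen prts"

lemma x_cancel [simp]: "\<alpha> \<in> rts \<Longrightarrow> g \<in> carrier G \<Longrightarrow> x \<alpha> \<bullet> (x \<alpha> \<bullet> g) = g"
  by (simp flip: G.m_assoc)

lemma x_inv [simp]: "\<alpha> \<in> rts \<Longrightarrow> ginv (x \<alpha>) = x \<alpha>"
  by (intro G.inv_equality) auto

lemma ginv_cancel [simp]:
  "a \<in> carrier G \<Longrightarrow> b \<in> carrier G \<Longrightarrow> ginv a \<bullet> (a \<bullet> b) = b"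
  "a \<in> carrier G \<Longrightarrow> b \<in> carrier G \<Longrightarrow> a \<bullet> (ginv a \<bullet> b) = b"
  by (simp_all flip: G.m_assoc)

lemma e_closed [simp]: "u \<in> S \<Longrightarrow> e u \<in> carrier G" and f_closed [simp]: "u \<in> S \<Longrightarrow> f u \<in> carrier G"
  by (simp_all add: sr_root opp_root)

lemma n_closed [simp]: "u \<in> S \<Longrightarrow> n u \<in> carrier G"
  by (simp add: n_def)

lemma n_sq [simp]: "u \<in> S \<Longrightarrow> n u \<bullet> n u = \<one>g"
  by (simp add: n_def G.m_assoc sr_root opp_root)

lemma n_cancel [simp]: "u \<in> S \<Longrightarrow> g \<in> carrier G \<Longrightarrow> n u \<bullet> (n u \<bullet> g) = g"
  by (simp flip: G.m_assoc)

lemma n_inv [simp]: "u \<in> S \<Longrightarrow> ginv (n u) = n u"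
  by (intro G.inv_equality) auto

lemma n_conj: "u \<in> S \<Longrightarrow> \<beta> \<in> rts \<Longrightarrow> n u \<bullet> (x \<beta> \<bullet> n u) = x (u \<cdot> \<beta>)"
  using x_reflect[of u \<beta>] unfolding n_def[symmetric] by (simp add: G.m_assoc)

lemma n_x: "u \<in> S \<Longrightarrow> \<beta> \<in> rts \<Longrightarrow> n u \<bullet> x \<beta> = x (u \<cdot> \<beta>) \<bullet> n u"
  using arg_cong[OF n_conj[of u \<beta>], of "\<lambda>a. a \<bullet> n u"] by (simp add: G.m_assoc)

lemma n_e: "u \<in> S \<Longrightarrow> n u \<bullet> e u = f u \<bullet> n u"
  by (simp add: n_x sr_root opp_sr)

lemma n_f: "u \<in> S \<Longrightarrow> n u \<bullet> f u = e u \<bullet> n u"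
  by (simp add: n_x sr_root opp_sr act_root act_cancel)

lemma n_conj_e: "u \<in> S \<Longrightarrow> n u \<bullet> e u \<bullet> n u = f u"
  by (simp add: n_e G.m_assoc)

text \<open>Equivalently \<open>(e u f u)^3 = 1\<close>: the two involutions generate a quotient of
  the symmetric group on three letters.\<close>

lemma n_eq: "u \<in> S \<Longrightarrow> n u = e u \<bullet> f u \<bullet> e u"
proof -
  assume u: "u \<in> S"
  have "f u \<bullet> (n u \<bullet> e u) = f u \<bullet> (f u \<bullet> n u)"
    using u by (simp add: n_e)
  then have "e u \<bullet> f u \<bullet> e u = n u"
    using u by (simp add: sr_root opp_root) (simp add: n_def G.m_assoc sr_root opp_root)
  then show ?thesis by simp
qed

lemma f_eq: "u \<in> S \<Longrightarrow> f u = e u \<bullet> n u \<bullet> e u"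
  by (simp add: n_eq G.m_assoc sr_root opp_root)

lemma x_subset: "A \<subseteq> rts \<Longrightarrow> x ` A \<subseteq> carrier G"
  by auto

lemma prts_subset: "prts \<subseteq> rts"
  by (auto simp: prts_rts)

lemma gen_subgroup: "A \<subseteq> rts \<Longrightarrow> subgroup (gen A) G"
  by (intro G.generate_is_subgroup x_subset)

lemma gen_carrier: "A \<subseteq> rts \<Longrightarrow> k \<in> gen A \<Longrightarrow> k \<in> carrier G"
  by (metis G.generate_in_carrier x_subset)

lemma gen_mono: "A \<subseteq> B \<Longrightarrow> k \<in> gen A \<Longrightarrow> k \<in> gen B"
  using G.mono_generate[of "x ` A" "x ` B"] by (meson image_mono subsetD)

lemma gen_incl: "\<alpha> \<in> A \<Longrightarrow> x \<alpha> \<in> gen A"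
  by (simp add: generate.incl)

lemma U_subgroup: "subgroup U G"
  by (intro gen_subgroup prts_subset)

lemma U_closed [simp]: "a \<in> U \<Longrightarrow> a \<in> carrier G"
  using subgroup.mem_carrier[OF U_subgroup] .

lemma U_mult: "a \<in> U \<Longrightarrow> b \<in> U \<Longrightarrow> a \<bullet> b \<in> U"
  using subgroup.m_closed[OF U_subgroup] .

lemma U_inv: "a \<in> U \<Longrightarrow> ginv a \<in> U"
  using subgroup.m_inv_closed[OF U_subgroup] .

lemma U_one: "\<one>g \<in> U"
  using subgroup.one_closed[OF U_subgroup] .

lemma e_U: "u \<in> S \<Longrightarrow> e u \<in> U"
  by (intro gen_incl sr_pos)

section \<open>Splitting off a simple root from \<open>U\<close>\<close>

lemma comm_conj:
  assumes "\<alpha> \<in> rts" "\<beta> \<in> A" "\<alpha> \<noteq> \<beta>" "prenilpotent W \<alpha> \<beta>" "open_root_interval W S \<alpha> \<beta> \<subseteq> A" "A \<subseteq> rts"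
  shows "x \<alpha> \<bullet> x \<beta> \<bullet> x \<alpha> \<in> gen A"
proof -
  have "x \<alpha> \<bullet> x \<beta> \<bullet> x \<alpha> \<bullet> x \<beta> \<in> gen A"
    using x_comm[of \<alpha> \<beta>] assms by (intro gen_mono[OF assms(5)]) auto
  from subgroup.m_closed[OF gen_subgroup[OF assms(6)] this gen_incl[OF assms(2)]]
  have "x \<alpha> \<bullet> x \<beta> \<bullet> x \<alpha> \<bullet> x \<beta> \<bullet> x \<beta> \<in> gen A" .
  then show ?thesis using assms by (simp add: G.m_assoc subset_iff)
qed

lemma gen_in_pos:
  "\<gamma> \<in> rts \<Longrightarrow> u \<in> S \<Longrightarrow> u \<in> \<gamma> \<Longrightarrow> \<gamma> \<noteq> opp W (sr u) \<Longrightarrow> \<gamma> \<in> prts \<and> \<gamma> \<noteq> sr u"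
proof -
  assume a: "\<gamma> \<in> rts" "u \<in> S" "u \<in> \<gamma>" "\<gamma> \<noteq> opp W (sr u)"
  have "\<one> \<in> \<gamma>"
  proof (rule ccontr)
    assume "\<one> \<notin> \<gamma>"
    then have "opp W \<gamma> = sr u"
      using a by (intro root_separation) (auto simp: opp_root root_int_opp)
    then show False using a opp_opp by metis
  qed
  then show ?thesis using a by (auto simp: pos_roots_def in_sr inversion_gen)
qed

lemma opp_nonempty: "\<gamma> \<in> rts \<Longrightarrow> opp W \<gamma> \<noteq> {}"
  using root_nonempty opp_root by blast

text \<open>If \<open>opp W (sr s)\<close> and \<open>\<gamma>\<close> are not prenilpotent, then
  \<open>sr s\<close> is contained in \<open>\<gamma>\<close>. In this case \<open>sr s\<close> and
  \<open>\<gamma>\<close> are prenilpotent, and writing \<open>f s = e s n s e s\<close> transports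
  the commutator relation of that pair.\<close>

lemma conj_f_U:
  assumes s: "s \<in> S" and g: "\<gamma> \<in> prts" "\<gamma> \<noteq> sr s"
  shows "f s \<bullet> x \<gamma> \<bullet> f s \<in> U"
proof -
  have sg: "s \<in> \<gamma>" using gen_in_pos_root g s by blast
  have sopp: "s \<in> opp W (sr s)" using s by (simp add: opp_def in_sr inversion_gen)
  show ?thesis
  proof (cases "prenilpotent W (opp W (sr s)) \<gamma>")
    case True
    show ?thesis
    proof (rule comm_conj)
      show "open_root_interval W S (opp W (sr s)) \<gamma> \<subseteq> prts"
        using sg sopp s gen_in_pos by (auto simp: open_root_interval_def root_interval_def)
      show "opp W (sr s) \<noteq> \<gamma>"
        using g s by (auto simp: pos_roots_def opp_def in_sr)
    qed (use True g s in \<open>auto simp: prts_subset opp_root sr_root\<close>)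
  next
    case False
    then have "sr s \<inter> opp W \<gamma> = {}"
      using sg sopp s by (auto simp: prenilpotent_def opp_opp sr_root)
    then have sub: "sr s \<subseteq> \<gamma>"
      using sr_subset[OF s] by (auto simp: opp_def)
    have pre: "prenilpotent W (sr s) \<gamma>"
    proof -
      have "opp W \<gamma> \<subseteq> opp W (sr s)" using sub by (auto simp: opp_def)
      moreover have "\<one> \<in> sr s \<inter> \<gamma>" using g s by (simp add: pos_roots_def in_sr)
      ultimately show ?thesis
        using opp_nonempty[OF prts_rts[OF g(1)]] by (auto simp: prenilpotent_def)
    qed
    let ?A = "prts - {sr s}"
    have A: "?A \<subseteq> rts" using prts_subset by auto
    have "open_root_interval W S (sr s) \<gamma> \<subseteq> ?A"
      using g s by (auto simp: open_root_interval_def root_interval_def pos_roots_def in_sr)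
    then have k: "e s \<bullet> x \<gamma> \<bullet> e s \<in> gen ?A"
      using s g pre A by (intro comm_conj) (auto simp: sr_root)
    then have "n s \<bullet> (e s \<bullet> x \<gamma> \<bullet> e s) \<bullet> ginv (n s) \<in> U"
    proof (rule G.conj_generate[OF n_closed[OF s] x_subset[OF A] U_subgroup, rotated])
      fix h assume "h \<in> x ` ?A"
      then obtain \<beta> where "\<beta> \<in> prts" "\<beta> \<noteq> sr s" "h = x \<beta>" by blast
      then show "n s \<bullet> h \<bullet> ginv (n s) \<in> U"
        using s act_pos[of \<beta> s] n_conj[of s \<beta>] by (simp add: G.m_assoc prts_rts gen_incl)
    qed
    then have "e s \<bullet> (n s \<bullet> (e s \<bullet> x \<gamma> \<bullet> e s) \<bullet> n s) \<bullet> e s \<in> U"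
      using U_mult[OF U_mult[OF e_U[OF s]] e_U[OF s]] s by simp
    then show ?thesis
      using s g by (simp add: f_eq G.m_assoc prts_rts)
  qed
qed

text \<open>The pair \<open>\<alpha>\<^sub>s\<close>, \<open>\<beta>\<close> need not be prenilpotent, so the subgroup generated by the \<open>x \<beta>\<close> alone need
  not be normalised by \<open>e s\<close>; its conjugates have to be added.\<close>

lemma U_split:
  assumes s: "s \<in> S" and u: "u \<in> U"
  shows "\<exists>q\<in>U. n s \<bullet> q \<bullet> n s \<in> U \<and> (u = q \<or> u = e s \<bullet> q)"
proof -
  let ?A = "prts - {sr s}"
  define X where "X = x ` ?A \<union> (\<lambda>\<beta>. e s \<bullet> x \<beta> \<bullet> e s) ` ?A"
  have X: "X \<subseteq> carrier G" using s by (auto simp: X_def prts_rts)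
  define K where "K = generate G X"
  have K: "subgroup K G" unfolding K_def by (rule G.generate_is_subgroup[OF X])
  have KU: "k \<in> U" if "k \<in> K" for k
  proof -
    have "X \<subseteq> U"
      unfolding X_def using U_mult[OF U_mult[OF e_U[OF s] gen_incl] e_U[OF s]] gen_incl by auto
    then show ?thesis using that G.generate_subgroup_incl[OF _ U_subgroup] unfolding K_def by blast
  qed
  have "n s \<bullet> k \<bullet> ginv (n s) \<in> U" if "k \<in> K" for k
    using that unfolding K_def
  proof (rule G.conj_generate[OF n_closed[OF s] X U_subgroup, rotated])
    fix g assume "g \<in> X"
    then consider \<beta> where "\<beta> \<in> prts" "\<beta> \<noteq> sr s" "g = x \<beta>"
      | \<beta> where "\<beta> \<in> prts" "\<beta> \<noteq> sr s" "g = e s \<bullet> x \<beta> \<bullet> e s"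
      unfolding X_def by blast
    then show "n s \<bullet> g \<bullet> ginv (n s) \<in> U"
    proof cases
      case 1
      then show ?thesis
        using s act_pos[of \<beta> s] n_conj[of s \<beta>] by (simp add: G.m_assoc prts_rts gen_incl)
    next
      case 2
      \<comment> \<open>Conjugation by \<open>n s\<close> turns the outer factors \<open>e s\<close>
        into \<open>f s\<close>; this is the purpose of \<open>conj_f_U\<close>.\<close>
      have "n s \<bullet> (e s \<bullet> x \<beta> \<bullet> e s) \<bullet> n s
          = (n s \<bullet> e s \<bullet> n s) \<bullet> (n s \<bullet> x \<beta> \<bullet> n s) \<bullet> (n s \<bullet> e s \<bullet> n s)"
        using s 2 by (simp add: G.m_assoc prts_rts)
      also have "\<dots> = f s \<bullet> x (s \<cdot> \<beta>) \<bullet> f s"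
        using s 2 n_conj[of s \<beta>] by (simp only: n_conj_e) (simp add: G.m_assoc prts_rts)
      also have "\<dots> \<in> U"
        using s 2 act_pos act_neq_sr by (intro conj_f_U) auto
      finally show ?thesis using s 2 by simp
    qed
  qed
  then have nK: "n s \<bullet> k \<bullet> n s \<in> U" if "k \<in> K" for k using that s by simp
  have eK: "e s \<bullet> k \<bullet> e s \<in> K" if "k \<in> K" for k
  proof -
    have "e s \<bullet> k \<bullet> ginv (e s) \<in> K"
      using that unfolding K_def
    proof (rule G.conj_generate[OF e_closed[OF s] X K[unfolded K_def], rotated])
      fix g assume "g \<in> X"
      then have "e s \<bullet> g \<bullet> e s \<in> X"
        using s unfolding X_def by (auto simp: G.m_assoc prts_rts sr_root)
      then show "e s \<bullet> g \<bullet> ginv (e s) \<in> generate G X" using s by (simp add: sr_root generate.incl)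
    qed
    then show ?thesis using s by (simp add: sr_root)
  qed
  have "u \<in> generate G (insert (e s) X)"
  proof -
    have "x ` prts \<subseteq> insert (e s) X" unfolding X_def by auto
    then show ?thesis using u G.mono_generate by blast
  qed
  then have "\<exists>k\<in>K. u = k \<or> u = e s \<bullet> k"
    using s eK by (intro G.generate_insert_involution[OF K]) (auto simp: K_def sr_root generate.incl)
  then show ?thesis using KU nK by blast
qed

lemma U_split_right:
  assumes s: "s \<in> S" and u: "u \<in> U"
  shows "\<exists>q\<in>U. n s \<bullet> q \<bullet> n s \<in> U \<and> (u = q \<or> u = q \<bullet> e s)"
proof -
  obtain q where q: "q \<in> U" "n s \<bullet> q \<bullet> n s \<in> U" "ginv u = q \<or> ginv u = e s \<bullet> q"
    using U_split[OF s U_inv[OF u]] by blast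
  have "n s \<bullet> ginv q \<bullet> n s \<in> U"
    using U_inv[OF q(2)] q s by (simp add: G.inv_mult_group G.m_assoc)
  moreover have "u = ginv (ginv u)"
    using u by simp
  then have "u = ginv q \<or> u = ginv q \<bullet> e s"
    using q(1,3) s by (auto simp: G.inv_mult_group sr_root)
  ultimately show ?thesis using U_inv q by blast
qed

text \<open>The fibre over \<open>w\<close> of the monomial group. \<open>N \<one>\<close> plays the
  part of the group \<open>H\<close> of the RGD-system, because normalising a group of order two
  means centralising it.\<close>

definition N :: "'w \<Rightarrow> 'g set" where
  "N w = {g \<in> carrier G. \<forall>\<beta>\<in>rts. g \<bullet> x \<beta> = x (w \<cdot> \<beta>) \<bullet> g}"

lemma N_closed: "g \<in> N w \<Longrightarrow> g \<in> carrier G"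
  by (simp add: N_def)

lemma N_x: "g \<in> N w \<Longrightarrow> \<beta> \<in> rts \<Longrightarrow> g \<bullet> x \<beta> = x (w \<cdot> \<beta>) \<bullet> g"
  by (simp add: N_def)

lemma N_one: "\<one>g \<in> N \<one>"
  by (simp add: N_def act_one)

lemma N_n: "s \<in> S \<Longrightarrow> n s \<in> N s"
  by (simp add: N_def n_x)

lemma N_mult:
  assumes "g \<in> N v" "h \<in> N w" "v \<in> carrier W" "w \<in> carrier W"
  shows "g \<bullet> h \<in> N (v \<otimes> w)"
proof -
  have "g \<bullet> h \<bullet> x \<beta> = x ((v \<otimes> w) \<cdot> \<beta>) \<bullet> (g \<bullet> h)" if "\<beta> \<in> rts" for \<beta>
  proof -
    have "g \<bullet> h \<bullet> x \<beta> = g \<bullet> (x (w \<cdot> \<beta>) \<bullet> h)"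
      using assms that by (simp add: N_closed N_x G.m_assoc)
    also have "\<dots> = (g \<bullet> x (w \<cdot> \<beta>)) \<bullet> h"
      using assms that by (simp add: N_closed G.m_assoc act_root)
    finally show ?thesis
      using assms that by (simp add: N_closed N_x act_root act_act G.m_assoc)
  qed
  then show ?thesis using assms by (simp add: N_def)
qed

lemma N_conj:
  assumes "g \<in> N w" "\<beta> \<in> rts" "w \<in> carrier W"
  shows "g \<bullet> x \<beta> \<bullet> ginv g = x (w \<cdot> \<beta>)"
  using assms by (simp add: N_x N_closed act_root G.m_assoc)

lemma N_inv:
  assumes "g \<in> N w" "w \<in> carrier W"
  shows "ginv g \<in> N (inv w)"
proof -
  have "ginv g \<bullet> x \<beta> = x (inv w \<cdot> \<beta>) \<bullet> ginv g" if "\<beta> \<in> rts" for \<beta>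
  proof -
    have "g \<bullet> x (inv w \<cdot> \<beta>) = x \<beta> \<bullet> g"
      using assms that by (simp add: N_x act_root act_act act_one)
    then have "ginv g \<bullet> (g \<bullet> x (inv w \<cdot> \<beta>)) \<bullet> ginv g = ginv g \<bullet> (x \<beta> \<bullet> g) \<bullet> ginv g"
      by simp
    then show ?thesis
      using assms that by (simp add: G.m_assoc N_closed act_root)
  qed
  then show ?thesis using assms by (simp add: N_def)
qed

lemma ex_N: "w \<in> carrier W \<Longrightarrow> \<exists>g. g \<in> N w"
proof -
  assume "w \<in> carrier W"
  then obtain ws where "ws \<in> lists S" "wprod ws = w" by (rule reduced_word)
  moreover have "ws \<in> lists S \<Longrightarrow> \<exists>g. g \<in> N (wprod ws)" for ws
  proof (induction ws)
    case Nil
    then show ?case using N_one by auto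
  next
    case (Cons u ws)
    then obtain g where "g \<in> N (wprod ws)" by auto
    then have "n u \<bullet> g \<in> N (u \<otimes> wprod ws)" using Cons by (intro N_mult N_n) auto
    then show ?case by auto
  qed
  ultimately show ?thesis by blast
qed

lemma N_gen:
  assumes "g \<in> N w" "w \<in> carrier W" "A \<subseteq> rts" "B \<subseteq> rts" "\<And>\<beta>. \<beta> \<in> A \<Longrightarrow> w \<cdot> \<beta> \<in> B" "k \<in> gen A"
  shows "g \<bullet> k \<bullet> ginv g \<in> gen B"
  using assms(6)
proof (rule G.conj_generate[OF N_closed[OF assms(1)] x_subset[OF assms(3)] gen_subgroup[OF assms(4)], rotated])
  fix h assume "h \<in> x ` A"
  then show "g \<bullet> h \<bullet> ginv g \<in> gen B"
    using assms(1-5) N_conj[OF assms(1) _ assms(2)] gen_incl[of _ B] by auto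
qed

lemma N1_U: "h \<in> N \<one> \<Longrightarrow> u \<in> U \<Longrightarrow> h \<bullet> u \<bullet> ginv h \<in> U"
  by (rule N_gen[of _ \<one> prts]) (auto simp: act_one prts_rts)

lemma N1_inv: "h \<in> N \<one> \<Longrightarrow> ginv h \<in> N \<one>"
  using N_inv[of h \<one>] by simp

lemma N1_swap:
  assumes "h \<in> N \<one>" "u \<in> U"
  shows "\<exists>u'\<in>U. h \<bullet> u = u' \<bullet> h" and "\<exists>u'\<in>U. u \<bullet> h = h \<bullet> u'"
proof -
  have "h \<bullet> u = (h \<bullet> u \<bullet> ginv h) \<bullet> h"
    using assms by (simp add: N_closed G.m_assoc)
  then show "\<exists>u'\<in>U. h \<bullet> u = u' \<bullet> h" using N1_U[OF assms] by blast
  have "u \<bullet> h = h \<bullet> (ginv h \<bullet> u \<bullet> ginv (ginv h))"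
    using assms by (simp add: N_closed G.m_assoc)
  then show "\<exists>u'\<in>U. u \<bullet> h = h \<bullet> u'" using N1_U[OF N1_inv[OF assms(1)] assms(2)] by blast
qed

text \<open>\<open>C \<one>\<close> is the Borel subgroup \<open>B\<close>, and \<open>C w\<close>
  is the double coset \<open>B w B\<close>; the factors from \<open>N \<one>\<close> are absorbed in
  \<open>N w\<close>.\<close>

definition C :: "'w \<Rightarrow> 'g set" where
  "C w = {a \<bullet> g \<bullet> b | a g b. a \<in> U \<and> g \<in> N w \<and> b \<in> U}"

lemma CI: "a \<in> U \<Longrightarrow> g \<in> N w \<Longrightarrow> b \<in> U \<Longrightarrow> a \<bullet> g \<bullet> b \<in> C w"
  unfolding C_def by blast

lemma CE:
  assumes "c \<in> C w"
  obtains a g b where "a \<in> U" "g \<in> N w" "b \<in> U" "c = a \<bullet> g \<bullet> b"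
  using assms unfolding C_def by blast

lemma C_closed: "g \<in> C w \<Longrightarrow> g \<in> carrier G"
  by (auto elim!: CE simp: N_closed)

lemma N_C: "g \<in> N w \<Longrightarrow> g \<in> C w"
  using CI[OF U_one _ U_one, of g w] by (simp add: N_closed)

lemma U_C: "a \<in> U \<Longrightarrow> g \<in> C w \<Longrightarrow> a \<bullet> g \<in> C w"
  by (erule CE) (auto simp: N_closed U_mult intro!: CI simp flip: G.m_assoc)

lemma C_U: "g \<in> C w \<Longrightarrow> a \<in> U \<Longrightarrow> g \<bullet> a \<in> C w"
  by (erule CE) (auto simp: N_closed U_mult G.m_assoc[of _ _ a] intro!: CI)

lemma n_C: "s \<in> S \<Longrightarrow> n s \<in> C s"
  by (intro N_C N_n)

lemma f_C: "s \<in> S \<Longrightarrow> f s \<in> C s"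
  unfolding f_eq by (intro C_U U_C e_U n_C)

lemma C_inv:
  assumes "g \<in> C w" "w \<in> carrier W"
  shows "ginv g \<in> C (inv w)"
proof -
  obtain a m b where "a \<in> U" "m \<in> N w" "b \<in> U" "g = a \<bullet> m \<bullet> b" using assms by (auto elim: CE)
  moreover from this have "ginv g = ginv b \<bullet> ginv m \<bullet> ginv a"
    by (simp add: G.inv_mult_group N_closed G.m_assoc)
  ultimately show ?thesis using assms by (auto intro!: CI U_inv N_inv)
qed

lemma C_one_iff: "g \<in> C \<one> \<longleftrightarrow> (\<exists>u\<in>U. \<exists>h\<in>N \<one>. g = u \<bullet> h)"
proof
  assume "g \<in> C \<one>"
  then obtain a m b where 1: "a \<in> U" "m \<in> N \<one>" "b \<in> U" "g = a \<bullet> m \<bullet> b" by (auto elim: CE)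
  obtain b' where "b' \<in> U" "m \<bullet> b = b' \<bullet> m" using N1_swap(1)[OF 1(2,3)] by blast
  then have "g = (a \<bullet> b') \<bullet> m" "a \<bullet> b' \<in> U" using 1 by (auto simp: G.m_assoc N_closed U_mult)
  then show "\<exists>u\<in>U. \<exists>h\<in>N \<one>. g = u \<bullet> h" using 1 by blast
next
  assume "\<exists>u\<in>U. \<exists>h\<in>N \<one>. g = u \<bullet> h"
  then show "g \<in> C \<one>" using U_C N_C by blast
qed

lemma U_C_one: "u \<in> U \<Longrightarrow> u \<in> C \<one>"
  using C_one_iff N_one by (metis G.r_one U_closed)

lemma one_C: "\<one>g \<in> C \<one>"
  by (intro N_C N_one)

lemma N1_C: "h \<in> N \<one> \<Longrightarrow> g \<in> C w \<Longrightarrow> w \<in> carrier W \<Longrightarrow> h \<bullet> g \<in> C w"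
proof -
  assume h: "h \<in> N \<one>" and g: "g \<in> C w" and w: "w \<in> carrier W"
  obtain a m b where 1: "a \<in> U" "m \<in> N w" "b \<in> U" "g = a \<bullet> m \<bullet> b" using g by (auto elim: CE)
  obtain a' where a': "a' \<in> U" "h \<bullet> a = a' \<bullet> h" using N1_swap(1)[OF h 1(1)] by blast
  have "h \<bullet> g = (h \<bullet> a) \<bullet> m \<bullet> b"
    using 1 h by (simp add: G.m_assoc N_closed)
  then have "h \<bullet> g = a' \<bullet> (h \<bullet> m) \<bullet> b"
    using a' 1 h by (simp add: G.m_assoc N_closed)
  moreover have "h \<bullet> m \<in> N w" using N_mult[OF h 1(2)] w by simp
  ultimately show ?thesis using a' 1 CI by metis
qed

lemma C1_C: "b \<in> C \<one> \<Longrightarrow> g \<in> C w \<Longrightarrow> w \<in> carrier W \<Longrightarrow> b \<bullet> g \<in> C w"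
proof -
  assume b: "b \<in> C \<one>" and g: "g \<in> C w" "w \<in> carrier W"
  obtain u h where u: "u \<in> U" "h \<in> N \<one>" "b = u \<bullet> h" using b C_one_iff by blast
  then have "b \<bullet> g = u \<bullet> (h \<bullet> g)" using g by (simp add: G.m_assoc N_closed C_closed)
  then show ?thesis using U_C[OF u(1) N1_C[OF u(2) g]] by simp
qed

lemma C1_inv: "b \<in> C \<one> \<Longrightarrow> ginv b \<in> C \<one>"
  using C_inv[of b \<one>] by simp

lemma C_C1: "g \<in> C w \<Longrightarrow> b \<in> C \<one> \<Longrightarrow> w \<in> carrier W \<Longrightarrow> g \<bullet> b \<in> C w"
proof -
  assume a: "g \<in> C w" "b \<in> C \<one>" "w \<in> carrier W"
  then have "ginv b \<bullet> ginv g \<in> C (inv w)"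
    by (intro C1_C C1_inv C_inv) auto
  then have "ginv (ginv b \<bullet> ginv g) \<in> C (inv (inv w))"
    using a by (intro C_inv) auto
  then show ?thesis using a by (simp add: G.inv_mult_group C_closed)
qed

text \<open>The inner factors combine to \<open>q\<close> or \<open>q e s\<close>. Here
  \<open>q\<close> moves to the left across \<open>m\<close>, while \<open>e s\<close> moves to the
  right across \<open>k\<close>, as \<open>inv w \<cdot> sr s\<close> is positive when
  \<open>s\<close> is no descent of \<open>w\<close>.\<close>

lemma C_mult:
  assumes s: "s \<in> S" "w \<in> carrier W" "\<not> des s w" and g: "g \<in> C s" "h \<in> C w"
  shows "g \<bullet> h \<in> C (s \<otimes> w)"
proof -
  obtain a m b where 1: "a \<in> U" "m \<in> N s" "b \<in> U" "g = a \<bullet> m \<bullet> b" using g by (auto elim: CE)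
  obtain c k d where 2: "c \<in> U" "k \<in> N w" "d \<in> U" "h = c \<bullet> k \<bullet> d" using g by (auto elim: CE)
  note cl = 1(1-3) 2(1-3) N_closed
  obtain q where q: "q \<in> U" "n s \<bullet> q \<bullet> n s \<in> U" "b \<bullet> c = q \<or> b \<bullet> c = q \<bullet> e s"
    using U_split_right[OF s(1) U_mult[OF 1(3) 2(1)]] by blast
  have gh: "g \<bullet> h = a \<bullet> (m \<bullet> (b \<bullet> c) \<bullet> k) \<bullet> d"
    using 1 2 by (simp add: G.m_assoc N_closed)
  have "m \<bullet> n s \<in> N \<one>"
    using N_mult[OF 1(2) N_n[OF s(1)]] s by (simp add: generator_involutive)
  then have hq: "(m \<bullet> n s) \<bullet> (n s \<bullet> q \<bullet> n s) \<bullet> ginv (m \<bullet> n s) \<in> U"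
    using q by (intro N1_U)
  have m: "m \<bullet> q = (m \<bullet> n s \<bullet> (n s \<bullet> q \<bullet> n s) \<bullet> ginv (m \<bullet> n s)) \<bullet> m"
    using q s cl by (simp add: G.m_assoc G.inv_mult_group)
  have mk: "m \<bullet> k \<in> N (s \<otimes> w)" using N_mult[OF 1(2) 2(2)] s by simp
  have "m \<bullet> q \<bullet> k \<in> C (s \<otimes> w)"
  proof -
    have "m \<bullet> q \<bullet> k = (m \<bullet> n s \<bullet> (n s \<bullet> q \<bullet> n s) \<bullet> ginv (m \<bullet> n s)) \<bullet> (m \<bullet> k)"
      using cl q s by (subst m) (simp add: G.m_assoc)
    then show ?thesis using hq mk U_C N_C by metis
  qed
  moreover have "m \<bullet> (q \<bullet> e s) \<bullet> k \<in> C (s \<otimes> w)"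
  proof -
    have "k \<bullet> x (inv w \<cdot> sr s) = e s \<bullet> k"
      using 2(2) s by (simp add: N_x act_root sr_root act_act act_one)
    then have "m \<bullet> (q \<bullet> e s) \<bullet> k = m \<bullet> q \<bullet> k \<bullet> x (inv w \<cdot> sr s)"
      using cl q s by (simp add: G.m_assoc act_root sr_root)
    moreover have "inv w \<cdot> sr s \<in> prts"
      using s by (simp add: pos_roots_def act_root sr_root in_act_iff in_sr)
    ultimately show ?thesis
      using C_U \<open>m \<bullet> q \<bullet> k \<in> C (s \<otimes> w)\<close> gen_incl by metis
  qed
  ultimately have "m \<bullet> (b \<bullet> c) \<bullet> k \<in> C (s \<otimes> w)" using q(3) by metis
  then show ?thesis unfolding gh by (rule C_U[OF U_C[OF 1(1)] 2(3)])
qed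

lemma C_factor:
  assumes "g \<in> C (v \<otimes> w)" "v \<in> carrier W" "w \<in> carrier W"
  shows "\<exists>a\<in>C v. \<exists>b\<in>C w. g = a \<bullet> b"
proof -
  obtain a m b where 1: "a \<in> U" "m \<in> N (v \<otimes> w)" "b \<in> U" "g = a \<bullet> m \<bullet> b" using assms by (auto elim: CE)
  obtain k where k: "k \<in> N v" using ex_N assms by blast
  have "ginv k \<bullet> m \<in> N (inv v \<otimes> (v \<otimes> w))"
    using k 1 assms by (intro N_mult N_inv) auto
  then have "ginv k \<bullet> m \<in> N w" using assms by (simp flip: m_assoc)
  moreover have "g = (a \<bullet> k) \<bullet> (ginv k \<bullet> m \<bullet> b)"
    using 1 k by (simp add: G.m_assoc N_closed)
  ultimately show ?thesis
    using 1 k by (metis C_U N_C U_C)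
qed

text \<open>Between two copies of \<open>n s\<close> stands \<open>q\<close> or
  \<open>q e s\<close>. The first gives an element of \<open>U\<close>, the second contributes
  \<open>n s e s n s = f s\<close>, which lies in \<open>C s\<close>.\<close>

lemma C_square:
  assumes s: "s \<in> S" and g: "g \<in> C s" "h \<in> C s"
  shows "g \<bullet> h \<in> C \<one> \<union> C s"
proof -
  obtain a m b where 1: "a \<in> U" "m \<in> N s" "b \<in> U" "g = a \<bullet> m \<bullet> b" using g by (auto elim: CE)
  obtain c k d where 2: "c \<in> U" "k \<in> N s" "d \<in> U" "h = c \<bullet> k \<bullet> d" using g by (auto elim: CE)
  obtain q where q: "q \<in> U" "n s \<bullet> q \<bullet> n s \<in> U" "b \<bullet> c = q \<or> b \<bullet> c = q \<bullet> e s"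
    using U_split_right[OF s(1) U_mult[OF 1(3) 2(1)]] by blast
  let ?y = "n s \<bullet> (b \<bullet> c) \<bullet> n s"
  have "?y \<in> C \<one> \<union> C s"
  proof (cases "b \<bullet> c = q")
    case True
    then show ?thesis using q U_C_one by simp
  next
    case False
    then have "?y = (n s \<bullet> q \<bullet> n s) \<bullet> (n s \<bullet> e s \<bullet> n s)"
      using q s by (simp add: G.m_assoc)
    also have "\<dots> \<in> C s"
      using q s by (simp only: n_conj_e) (intro U_C f_C)
    finally show ?thesis by simp
  qed
  moreover have "g \<bullet> h = a \<bullet> ((m \<bullet> n s) \<bullet> ?y \<bullet> (n s \<bullet> k)) \<bullet> d"
    using 1 2 s by (simp add: G.m_assoc N_closed)
  moreover have "m \<bullet> n s \<in> C \<one>" "n s \<bullet> k \<in> C \<one>"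
    using N_mult[OF 1(2) N_n[OF s]] N_mult[OF N_n[OF s] 2(2)] s
    by (auto simp: generator_involutive intro!: N_C)
  ultimately show ?thesis
    using C_U[OF U_C[OF 1(1) C_C1[OF C1_C]] 2(3)] s by auto
qed

lemma C_mult_cases:
  assumes s: "s \<in> S" "w \<in> carrier W" and g: "g \<in> C s" "h \<in> C w"
  shows "g \<bullet> h \<in> C (s \<otimes> w) \<union> C w"
proof (cases "des s w")
  case False
  then show ?thesis using C_mult assms by blast
next
  case True
  have "h \<in> C (s \<otimes> (s \<otimes> w))" using s g by simp
  then obtain a b where ab: "a \<in> C s" "b \<in> C (s \<otimes> w)" "h = a \<bullet> b"
    using C_factor s by (metis S_closed m_closed)
  have gh: "g \<bullet> h = (g \<bullet> a) \<bullet> b" using ab g by (simp add: C_closed G.m_assoc)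
  have "g \<bullet> a \<in> C \<one> \<union> C s" using C_square s g ab by blast
  then show ?thesis
  proof
    assume "g \<bullet> a \<in> C \<one>"
    then show ?thesis using gh ab s by (auto intro!: C1_C)
  next
    assume "g \<bullet> a \<in> C s"
    then have "(g \<bullet> a) \<bullet> b \<in> C (s \<otimes> (s \<otimes> w))" using True ab s by (intro C_mult) auto
    then show ?thesis using gh s by simp
  qed
qed

text \<open>For a descent \<open>s\<close> of \<open>w\<close>, conjugation by \<open>m\<close>
  carries the element of the positive root \<open>inv w \<cdot> opp W (sr s)\<close> to
  \<open>f s\<close>, whereas elements of \<open>C \<one>\<close> preserve \<open>U\<close>. This is
  where \<open>x_opp_notin\<close> enters.\<close>

lemma N_C1:
  assumes "w \<in> carrier W" "m \<in> N w" "m \<in> C \<one>"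
  shows "w = \<one>"
proof (rule ccontr)
  assume "w \<noteq> \<one>"
  then obtain s where s: "s \<in> S" "des s w" using ex_des assms by blast
  let ?\<gamma> = "inv w \<cdot> opp W (sr s)"
  have "?\<gamma> \<in> prts"
    using s assms by (simp add: pos_roots_def act_root opp_root sr_root in_act_iff) (simp add: opp_def in_sr)
  then have "x ?\<gamma> \<in> U" by (rule gen_incl)
  obtain u h where u: "u \<in> U" "h \<in> N \<one>" "m = u \<bullet> h" using assms C_one_iff by blast
  have "m \<bullet> x ?\<gamma> \<bullet> ginv m = u \<bullet> (h \<bullet> x ?\<gamma> \<bullet> ginv h) \<bullet> ginv u"
    using u s assms by (simp add: G.m_assoc N_closed G.inv_mult_group act_root opp_root sr_root)
  also have "\<dots> \<in> U"
    by (rule U_mult[OF U_mult[OF u(1) N1_U[OF u(2) \<open>x ?\<gamma> \<in> U\<close>]] U_inv[OF u(1)]])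
  finally have "m \<bullet> x ?\<gamma> \<bullet> ginv m \<in> U" .
  moreover have "m \<bullet> x ?\<gamma> \<bullet> ginv m = f s"
    using N_conj[OF assms(2), of ?\<gamma>] assms s by (simp add: act_root opp_root sr_root act_act act_one)
  ultimately show False using x_opp_notin s by simp
qed

text \<open>The argument of Tits: induct on the shorter label and multiply a representative of
  \<open>v\<close> by \<open>n s\<close> for a descent \<open>s\<close> of \<open>v\<close>. The
  product lies in \<open>C (s \<otimes> w)\<close> or in \<open>C w\<close>, and the latter
  contradicts the lengths.\<close>

lemma C_disjoint_aux:
  assumes "v \<in> carrier W" "w \<in> carrier W" "len v \<le> len w" "g \<in> C v" "g \<in> C w"
  shows "v = w"
  using assms
proof (induction "len v" arbitrary: v w g rule: less_induct)
  case less
  obtain a m b where 1: "a \<in> U" "m \<in> N v" "b \<in> U" "g = a \<bullet> m \<bullet> b" using less.prems by (auto elim: CE)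
  have "m = ginv a \<bullet> g \<bullet> ginv b"
    using 1 by (simp add: G.m_assoc N_closed)
  then have mw: "m \<in> C w"
    using 1 less.prems by (metis C_U U_C U_inv)
  show ?case
  proof (cases "v = \<one>")
    case True
    obtain c k d where 2: "c \<in> U" "k \<in> N w" "d \<in> U" "g = c \<bullet> k \<bullet> d" using less.prems by (auto elim: CE)
    have "k = ginv c \<bullet> g \<bullet> ginv d"
      using 2 by (simp add: G.m_assoc N_closed)
    then have "k \<in> C v"
      using 2 less.prems by (metis C_U U_C U_inv)
    then show ?thesis using N_C1 2 True less.prems by blast
  next
    case False
    then obtain s where s: "s \<in> S" "des s v" using ex_des less.prems by blast
    have "n s \<bullet> m \<in> N (s \<otimes> v)" using s 1 less.prems by (intro N_mult N_n) auto
    then have sv: "n s \<bullet> m \<in> C (s \<otimes> v)" by (rule N_C)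
    have l: "len v = Suc (len (s \<otimes> v))" using des_len s less.prems by blast
    have "n s \<bullet> m \<in> C (s \<otimes> w) \<union> C w"
      using s less.prems mw n_C by (intro C_mult_cases) auto
    then show ?thesis
    proof
      assume "n s \<bullet> m \<in> C w"
      then have "s \<otimes> v = w" using less.hyps[of "s \<otimes> v" w] sv l s less.prems by auto
      then show ?thesis using l less.prems by simp
    next
      assume sw: "n s \<bullet> m \<in> C (s \<otimes> w)"
      have "len w \<le> Suc (len (s \<otimes> w))" using len_gen_mult_le[of s "s \<otimes> w"] s less.prems by simp
      then have "s \<otimes> v = s \<otimes> w" using less.hyps[of "s \<otimes> v" "s \<otimes> w"] sv sw l s less.prems by auto
      then have "s \<otimes> (s \<otimes> v) = s \<otimes> (s \<otimes> w)" by simp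
      then show ?thesis using s less.prems by simp
    qed
  qed
qed

lemma C_disjoint: "v \<in> carrier W \<Longrightarrow> w \<in> carrier W \<Longrightarrow> g \<in> C v \<Longrightarrow> g \<in> C w \<Longrightarrow> v = w"
  using C_disjoint_aux[of v w g] C_disjoint_aux[of w v g] nat_le_linear[of "len v" "len w"] by blast

lemma C_mult_right:
  assumes s: "s \<in> S" "w \<in> carrier W" "\<not> des s (inv w)" and g: "g \<in> C w" "h \<in> C s"
  shows "g \<bullet> h \<in> C (w \<otimes> s)"
proof -
  have "ginv h \<in> C s" using C_inv[OF g(2)] s by simp
  then have "ginv h \<bullet> ginv g \<in> C (s \<otimes> inv w)"
    using s g by (intro C_mult C_inv) auto
  then have "ginv (ginv h \<bullet> ginv g) \<in> C (inv (s \<otimes> inv w))"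
    using s by (intro C_inv) auto
  then show ?thesis using s g by (simp add: G.inv_mult_group C_closed inv_mult_group)
qed

end

section \<open>Root subgroups of the opposite sign\<close>

context rgd_F2
begin

lemma wprod_closed_set [simp]: "\<forall>u\<in>set ws. u \<in> S \<Longrightarrow> wprod ws \<in> carrier W"
  by (simp add: in_lists_conv_set)

lemma C_same_chamber:
  assumes "a \<in> C v" "v \<in> carrier W" "g \<in> carrier G" "ginv g \<bullet> a \<in> C \<one>"
  shows "g \<in> C v"
  using C_C1[OF assms(1) C1_inv[OF assms(4)] assms(2)] assms(3) C_closed[OF assms(1)]
  by (simp add: G.inv_mult_group)

text \<open>The intersection of the Borel subgroup \<open>C \<one>\<close> with the conjugate of the opposite Borel subgroup
  by an element of \<open>N p\<close>.\<close>

definition K :: "'w \<Rightarrow> 'g set" where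
  "K p = {k \<bullet> h | k h. k \<in> gen {\<gamma> \<in> prts. p \<notin> \<gamma>} \<and> h \<in> N \<one>}"

lemma K_rts: "{\<gamma> \<in> prts. p \<notin> \<gamma>} \<subseteq> rts"
  using prts_rts by auto

lemma K_gen_closed [simp]: "k \<in> gen {\<gamma> \<in> prts. p \<notin> \<gamma>} \<Longrightarrow> k \<in> carrier G"
  by (rule gen_carrier[OF K_rts])

lemma gen_K: "k \<in> gen {\<gamma> \<in> prts. p \<notin> \<gamma>} \<Longrightarrow> k \<in> K p"
  unfolding K_def using N_one by (intro CollectI exI[of _ k] exI[of _ "\<one>g"]) auto

lemma N1_K: "h \<in> N \<one> \<Longrightarrow> h \<in> K p"
  unfolding K_def using subgroup.one_closed[OF gen_subgroup[OF K_rts], of p]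
  by (intro CollectI exI[of _ "\<one>g"] exI[of _ h]) (auto simp: N_closed)

lemma K_C1: "k \<in> K p \<Longrightarrow> k \<in> C \<one>"
  unfolding K_def using C_one_iff gen_mono[of "{\<gamma> \<in> prts. p \<notin> \<gamma>}" prts] by blast

lemma K_closed: "k \<in> K p \<Longrightarrow> k \<in> carrier G"
  using K_C1 C_closed by blast

lemma K_one: "\<one>g \<in> K p"
  by (intro N1_K N_one)

lemma N1_conj_gen:
  assumes "h \<in> N \<one>" "k \<in> gen {\<gamma> \<in> prts. p \<notin> \<gamma>}"
  shows "h \<bullet> k \<bullet> ginv h \<in> gen {\<gamma> \<in> prts. p \<notin> \<gamma>}"
  using assms(2) by (rule N_gen[OF assms(1) one_closed K_rts K_rts, rotated]) (auto simp: act_one prts_rts)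

lemma K_mult:
  assumes "a \<in> K p" "b \<in> K p"
  shows "a \<bullet> b \<in> K p"
proof -
  obtain k h where 1: "k \<in> gen {\<gamma> \<in> prts. p \<notin> \<gamma>}" "h \<in> N \<one>" "a = k \<bullet> h"
    using assms unfolding K_def by blast
  obtain l i where 2: "l \<in> gen {\<gamma> \<in> prts. p \<notin> \<gamma>}" "i \<in> N \<one>" "b = l \<bullet> i"
    using assms unfolding K_def by blast
  have "a \<bullet> b = (k \<bullet> (h \<bullet> l \<bullet> ginv h)) \<bullet> (h \<bullet> i)"
    using 1 2 by (simp add: G.m_assoc N_closed)
  moreover have "h \<bullet> i \<in> N \<one>" using N_mult[OF 1(2) 2(2)] by simp
  moreover have "k \<bullet> (h \<bullet> l \<bullet> ginv h) \<in> gen {\<gamma> \<in> prts. p \<notin> \<gamma>}"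
    using subgroup.m_closed[OF gen_subgroup[OF K_rts] 1(1) N1_conj_gen[OF 1(2) 2(1)]] .
  ultimately show ?thesis unfolding K_def by blast
qed

lemma K_inv:
  assumes "a \<in> K p"
  shows "ginv a \<in> K p"
proof -
  obtain k h where 1: "k \<in> gen {\<gamma> \<in> prts. p \<notin> \<gamma>}" "h \<in> N \<one>" "a = k \<bullet> h"
    using assms unfolding K_def by blast
  have "ginv a = ginv h \<bullet> ginv k" using 1 by (simp add: G.inv_mult_group N_closed)
  moreover have "ginv k \<in> K p"
    using subgroup.m_inv_closed[OF gen_subgroup[OF K_rts] 1(1)] by (rule gen_K)
  ultimately show ?thesis using K_mult[OF N1_K[OF N1_inv[OF 1(2)]]] 1(3) by simp
qed

lemma N1_conj_n: "s \<in> S \<Longrightarrow> h \<in> N \<one> \<Longrightarrow> n s \<bullet> h \<bullet> n s \<in> N \<one>"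
  using N_mult[OF N_mult[OF N_n, of s h \<one>] N_n, of s] by (simp add: generator_involutive)

lemma K_conj_up:
  assumes "s \<in> S" "p \<in> carrier W" "\<not> des s p" "k \<in> K p"
  shows "n s \<bullet> k \<bullet> n s \<in> K (s \<otimes> p)"
proof -
  obtain l h where 1: "l \<in> gen {\<gamma> \<in> prts. p \<notin> \<gamma>}" "h \<in> N \<one>" "k = l \<bullet> h"
    using assms unfolding K_def by blast
  have "n s \<bullet> l \<bullet> ginv (n s) \<in> gen {\<gamma> \<in> prts. s \<otimes> p \<notin> \<gamma>}"
  proof (rule N_gen[OF N_n[OF assms(1)] _ K_rts K_rts _ 1(1)])
    fix \<beta> assume "\<beta> \<in> {\<gamma> \<in> prts. p \<notin> \<gamma>}"
    moreover from this have "\<beta> \<noteq> sr s" using assms in_sr by blast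
    ultimately show "s \<cdot> \<beta> \<in> {\<gamma> \<in> prts. s \<otimes> p \<notin> \<gamma>}"
      using assms act_pos by (auto simp: in_act_iff prts_rts)
  qed (use assms in simp)
  moreover have "n s \<bullet> k \<bullet> n s = (n s \<bullet> l \<bullet> n s) \<bullet> (n s \<bullet> h \<bullet> n s)"
    using 1 assms by (simp add: G.m_assoc N_closed)
  ultimately show ?thesis
    using K_mult[OF gen_K N1_K[OF N1_conj_n[OF assms(1) 1(2)]]] assms(1) by simp
qed

lemma e_K: "s \<in> S \<Longrightarrow> p \<in> carrier W \<Longrightarrow> des s p \<Longrightarrow> e s \<in> K p"
  by (intro gen_K gen_incl) (simp add: sr_pos in_sr)

text \<open>In contrast to the situation in \<open>U_split\<close>, all pairs are prenilpotent here:
  \<open>\<one>\<close> lies inside and \<open>p\<close> outside both roots.\<close>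

lemma e_conj_gen:
  assumes "s \<in> S" "p \<in> carrier W" "des s p" "k \<in> gen {\<gamma> \<in> prts. \<gamma> \<noteq> sr s \<and> p \<notin> \<gamma>}"
  shows "e s \<bullet> k \<bullet> e s \<in> gen {\<gamma> \<in> prts. \<gamma> \<noteq> sr s \<and> p \<notin> \<gamma>}" (is "_ \<in> gen ?B")
proof -
  have B: "?B \<subseteq> rts" using prts_rts by auto
  have "e s \<bullet> k \<bullet> ginv (e s) \<in> gen ?B"
    using assms(4)
  proof (rule G.conj_generate[OF e_closed[OF assms(1)] x_subset[OF B] gen_subgroup[OF B], rotated])
    fix g assume "g \<in> x ` ?B"
    then obtain \<gamma> where \<gamma>: "\<gamma> \<in> ?B" "g = x \<gamma>" by blast
    have "p \<in> opp W (sr s) \<inter> opp W \<gamma>" "\<one> \<in> sr s \<inter> \<gamma>"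
      using assms \<gamma> by (auto simp: opp_def in_sr pos_roots_def)
    then have "prenilpotent W (sr s) \<gamma>" "open_root_interval W S (sr s) \<gamma> \<subseteq> ?B"
      by (auto simp: prenilpotent_def open_root_interval_def root_interval_def pos_roots_def opp_def)
    then have "e s \<bullet> x \<gamma> \<bullet> e s \<in> gen ?B"
      using \<gamma> B assms by (intro comm_conj) (auto simp: sr_root)
    then show "e s \<bullet> g \<bullet> ginv (e s) \<in> gen ?B" using \<gamma> assms by (simp add: sr_root)
  qed
  then show ?thesis using assms by (simp add: sr_root)
qed

lemma n_conj_gen_down:
  assumes "s \<in> S" "p \<in> carrier W" "k \<in> gen {\<gamma> \<in> prts. \<gamma> \<noteq> sr s \<and> p \<notin> \<gamma>}"
  shows "n s \<bullet> k \<bullet> n s \<in> gen {\<gamma> \<in> prts. s \<otimes> p \<notin> \<gamma>}"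
proof -
  have "n s \<bullet> k \<bullet> ginv (n s) \<in> gen {\<gamma> \<in> prts. s \<otimes> p \<notin> \<gamma>}"
  proof (rule N_gen[OF N_n[OF assms(1)] _ _ K_rts _ assms(3)])
    fix \<beta> assume "\<beta> \<in> {\<gamma> \<in> prts. \<gamma> \<noteq> sr s \<and> p \<notin> \<gamma>}"
    then show "s \<cdot> \<beta> \<in> {\<gamma> \<in> prts. s \<otimes> p \<notin> \<gamma>}"
      using assms act_pos by (auto simp: in_act_iff prts_rts)
  qed (use assms prts_rts in auto)
  then show ?thesis using assms by simp
qed

text \<open>\<open>sr s\<close> is the only root lost in passing from \<open>p\<close> to
  \<open>s p\<close>, so the conjugate of \<open>K (s \<otimes> p)\<close> by \<open>n s\<close> and
  its translate by \<open>e s\<close> exhaust \<open>K p\<close>.\<close>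

lemma K_split:
  assumes "s \<in> S" "p \<in> carrier W" "des s p" "k \<in> K p"
  shows "\<exists>k'\<in>K (s \<otimes> p). k = n s \<bullet> k' \<bullet> n s \<or> k = e s \<bullet> (n s \<bullet> k' \<bullet> n s)"
proof -
  let ?B = "{\<gamma> \<in> prts. \<gamma> \<noteq> sr s \<and> p \<notin> \<gamma>}"
  have B: "?B \<subseteq> rts" using prts_rts by auto
  obtain l h where 1: "l \<in> gen {\<gamma> \<in> prts. p \<notin> \<gamma>}" "h \<in> N \<one>" "k = l \<bullet> h"
    using assms unfolding K_def by blast
  have "x ` {\<gamma> \<in> prts. p \<notin> \<gamma>} \<subseteq> insert (e s) (x ` ?B)" by auto
  then have "l \<in> generate G (insert (e s) (x ` ?B))"
    using 1 G.mono_generate by blast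
  moreover have "e s \<bullet> e s = \<one>g" "x ` ?B \<subseteq> gen ?B"
    using assms(1) gen_incl[of _ ?B] by (simp_all add: sr_root image_subset_iff)
  ultimately obtain m where m: "m \<in> gen ?B" "l = m \<or> l = e s \<bullet> m"
    using G.generate_insert_involution[OF gen_subgroup[OF B] e_closed[OF assms(1)] _ _ e_conj_gen[OF assms(1-3)]]
    by blast
  let ?k = "n s \<bullet> (m \<bullet> h) \<bullet> n s"
  have mc: "m \<in> carrier G" using m gen_carrier[OF B] by blast
  have "?k = (n s \<bullet> m \<bullet> n s) \<bullet> (n s \<bullet> h \<bullet> n s)"
    using mc 1 assms by (simp add: G.m_assoc N_closed)
  also have "\<dots> \<in> K (s \<otimes> p)"
    using assms m 1 by (intro K_mult gen_K n_conj_gen_down N1_K N1_conj_n)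
  finally have "?k \<in> K (s \<otimes> p)" .
  moreover have "n s \<bullet> ?k \<bullet> n s = m \<bullet> h" using mc 1 assms by (simp add: G.m_assoc N_closed)
  moreover have "k = m \<bullet> h \<or> k = e s \<bullet> (m \<bullet> h)" using m(2) 1 mc assms by (auto simp: G.m_assoc N_closed)
  ultimately show ?thesis by metis
qed

section \<open>Galleries, and codistances inside a residue of rank 2\<close>

primrec nword :: "'w list \<Rightarrow> 'g" where
  "nword [] = \<one>g"
| "nword (s # ws) = n s \<bullet> nword ws"

primrec strip :: "'w list \<Rightarrow> 'w \<Rightarrow> 'w" where
  "strip [] p = p"
| "strip (s # ws) p = strip ws (s \<otimes> p)"

primrec initial :: "'w list \<Rightarrow> 'w \<Rightarrow> bool" where
  "initial [] p = True"
| "initial (s # ws) p = (des s p \<and> initial ws (s \<otimes> p))"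

primrec ascending :: "'w list \<Rightarrow> 'w \<Rightarrow> bool" where
  "ascending [] p = True"
| "ascending (s # ws) p = (\<not> des s p \<and> ascending ws (s \<otimes> p))"

lemma nword_closed [simp]: "ws \<in> lists S \<Longrightarrow> nword ws \<in> carrier G"
  by (induction ws) auto

lemma nword_N: "ws \<in> lists S \<Longrightarrow> nword ws \<in> N (wprod ws)"
proof (induction ws)
  case (Cons s ws)
  then have "wprod ws \<in> carrier W" by auto
  with Cons show ?case by (auto intro!: N_mult N_n)
qed (simp add: N_one)

lemma nword_append: "us \<in> lists S \<Longrightarrow> vs \<in> lists S \<Longrightarrow> nword (us @ vs) = nword us \<bullet> nword vs"
  by (induction us) (auto simp: G.m_assoc)

lemma nword_rev: "ws \<in> lists S \<Longrightarrow> nword (rev ws) = ginv (nword ws)"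
proof (induction ws)
  case (Cons s ws)
  then have "nword (rev ws @ [s]) = nword (rev ws) \<bullet> nword [s]"
    by (intro nword_append) (auto simp: in_lists_conv_set)
  then show ?case using Cons by (simp add: G.inv_mult_group)
qed simp

lemma strip_eq: "ws \<in> lists S \<Longrightarrow> p \<in> carrier W \<Longrightarrow> strip ws p = inv (wprod ws) \<otimes> p"
  by (induction ws arbitrary: p) (auto simp: inv_mult_group m_assoc)

lemma strip_closed [simp]: "ws \<in> lists S \<Longrightarrow> p \<in> carrier W \<Longrightarrow> strip ws p \<in> carrier W"
  by (simp add: strip_eq)

lemma initial_len: "ws \<in> lists S \<Longrightarrow> p \<in> carrier W \<Longrightarrow> initial ws p \<Longrightarrow> len p = length ws + len (strip ws p)"
proof (induction ws arbitrary: p)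
  case (Cons s ws)
  then have "len p = Suc (len (s \<otimes> p))" using des_len[of s p] by simp
  then show ?case using Cons by auto
qed simp

lemma initial_reduced:
  assumes "s \<in> S" "ws \<in> lists S" "p \<in> carrier W" "initial (s # ws) p"
  shows "\<not> des s (wprod ws)"
proof
  assume d: "des s (wprod ws)"
  have "p = wprod (s # ws) \<otimes> strip (s # ws) p"
  proof -
    have "wprod (s # ws) \<in> carrier W" using assms by simp
    then show ?thesis
      using assms(1-3) strip_eq[of "s # ws" p] by (simp del: strip.simps wprod_Cons flip: m_assoc)
  qed
  then have "len p \<le> len (wprod (s # ws)) + len (strip (s # ws) p)"
    using assms len_mult_le[of "wprod (s # ws)" "strip (s # ws) p"] by (simp del: strip.simps)
  moreover have "len p = length (s # ws) + len (strip (s # ws) p)"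
    using assms by (intro initial_len) auto
  moreover have "len (wprod ws) = Suc (len (wprod (s # ws)))"
    using d assms des_len by simp
  ultimately show False using len_le[OF assms(2)] by simp
qed

text \<open>The hypothesis says that \<open>k\<close> fixes the chamber of \<open>nword ws\<close>.
  The first letter is peeled off with \<open>K_split\<close>; a factor \<open>e s\<close> would put
  one element into the double cosets of both \<open>wprod ws\<close> and
  \<open>s \<otimes> wprod ws\<close>.\<close>

lemma K_inj:
  assumes "ws \<in> lists S" "p \<in> carrier W" "initial ws p" "k \<in> K p"
    and "ginv (nword ws) \<bullet> k \<bullet> nword ws \<in> C \<one>"
  shows "ginv (nword ws) \<bullet> k \<bullet> nword ws \<in> K (strip ws p)"
  using assms
proof (induction ws arbitrary: p k)
  case Nil
  then show ?case by (simp add: K_closed)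
next
  case (Cons s ws)
  then have s: "s \<in> S" "ws \<in> lists S" "des s p" by auto
  obtain k' where k': "k' \<in> K (s \<otimes> p)" "k = n s \<bullet> k' \<bullet> n s \<or> k = e s \<bullet> (n s \<bullet> k' \<bullet> n s)"
    using K_split[OF s(1) _ s(3), of k] Cons.prems by blast
  have kc: "k' \<in> carrier G" using k' K_closed by blast
  from k'(2) show ?case
  proof
    assume "k = n s \<bullet> k' \<bullet> n s"
    then have "ginv (nword (s # ws)) \<bullet> k \<bullet> nword (s # ws) = ginv (nword ws) \<bullet> k' \<bullet> nword ws"
      using s kc by (simp add: G.inv_mult_group G.m_assoc)
    then show ?thesis using Cons.IH[of "s \<otimes> p" k'] Cons.prems s k' by auto
  next
    assume "k = e s \<bullet> (n s \<bullet> k' \<bullet> n s)"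
    then have "ginv (nword (s # ws)) \<bullet> k \<bullet> nword (s # ws)
        = ginv (nword ws) \<bullet> ((n s \<bullet> e s \<bullet> n s) \<bullet> (k' \<bullet> nword ws))"
      using s kc by (simp add: G.inv_mult_group G.m_assoc)
    then have "ginv (nword ws) \<bullet> (f s \<bullet> (k' \<bullet> nword ws)) \<in> C \<one>"
      using Cons.prems s by (simp add: n_conj_e)
    then have "nword ws \<bullet> (ginv (nword ws) \<bullet> (f s \<bullet> (k' \<bullet> nword ws))) \<in> C (wprod ws)"
      using C_C1[OF N_C[OF nword_N[OF s(2)]] _ wprod_closed[OF s(2)]] by blast
    then have "f s \<bullet> (k' \<bullet> nword ws) \<in> C (wprod ws)"
      using s kc by simp
    moreover have "f s \<bullet> (k' \<bullet> nword ws) \<in> C (s \<otimes> wprod ws)"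
      using s Cons.prems initial_reduced[of s ws p] k' by (intro C_mult f_C C1_C K_C1 N_C nword_N) auto
    ultimately have "wprod ws = s \<otimes> wprod ws"
      using s by (intro C_disjoint) auto
    then show ?thesis
      using not_des_len[of s "wprod ws"] initial_reduced[of s ws p] s Cons.prems by auto
  qed
qed

lemma K_down:
  assumes "ws \<in> lists S" "p \<in> carrier W" "initial ws p" "k \<in> K (strip ws p)"
  shows "nword ws \<bullet> k \<bullet> ginv (nword ws) \<in> K p"
  using assms
proof (induction ws arbitrary: p)
  case Nil
  then show ?case by (simp add: K_closed)
next
  case (Cons s ws)
  then have "nword ws \<bullet> k \<bullet> ginv (nword ws) \<in> K (s \<otimes> p)" by auto
  then have "n s \<bullet> (nword ws \<bullet> k \<bullet> ginv (nword ws)) \<bullet> n s \<in> K (s \<otimes> (s \<otimes> p))"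
    using Cons by (intro K_conj_up) auto
  then show ?case using Cons K_closed by (simp add: G.inv_mult_group G.m_assoc)
qed

text \<open>A pair \<open>(g, p)\<close> is a chamber with a codistance attached. The representative
  \<open>g\<close> matters only modulo \<open>K p\<close>, hence \<open>shift\<close>; a shift by
  \<open>e s\<close> before a move reaches another chamber of the panel.\<close>

inductive res :: "'w set \<Rightarrow> 'g \<Rightarrow> 'w \<Rightarrow> 'g \<Rightarrow> 'w \<Rightarrow> bool" for J g0 p0 where
  start: "res J g0 p0 g0 p0"
| shift: "res J g0 p0 g p \<Longrightarrow> k \<in> K p \<Longrightarrow> res J g0 p0 (g \<bullet> k) p"
| move: "res J g0 p0 g p \<Longrightarrow> s \<in> J \<Longrightarrow> res J g0 p0 (g \<bullet> n s) (s \<otimes> p)"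

lemma res_trans: "res J g p g' p' \<Longrightarrow> res J g0 p0 g p \<Longrightarrow> res J g0 p0 g' p'"
  by (induction rule: res.induct) (auto intro: res.intros)

text \<open>Reduced words for the eight elements of the dihedral group. Both words for the longest
  element are kept so that the set is closed under reversal.\<close>

definition alts :: "'w \<Rightarrow> 'w \<Rightarrow> 'w list set" where
  "alts i j = {[], [i], [i, j], [i, j, i], [i, j, i, j], [j], [j, i], [j, i, j], [j, i, j, i]}"

lemma alts_lists: "i \<in> S \<Longrightarrow> j \<in> S \<Longrightarrow> ws \<in> alts i j \<Longrightarrow> ws \<in> lists S"
  by (auto simp: alts_def)

lemma alts_snoc:
  assumes "i \<in> S" "j \<in> S" "i \<noteq> j" "ws \<in> alts i j" "u \<in> {i, j}"
  shows "\<exists>vs\<in>alts i j. wprod vs = wprod ws \<otimes> u"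
proof -
  note b = braid[OF assms(1-3) one_closed] braid[OF assms(1-3), of i] braid[OF assms(1-3), of j]
  show ?thesis
    using assms b by (auto simp: alts_def m_assoc generator_involutive)
qed

lemma alts_Cons:
  assumes "i \<in> S" "j \<in> S" "i \<noteq> j" "ws \<in> alts i j" "u \<in> {i, j}"
  shows "\<exists>vs\<in>alts i j. wprod vs = u \<otimes> wprod ws"
proof -
  note b = braid[OF assms(1-3) one_closed] braid[OF assms(1-3), of i] braid[OF assms(1-3), of j]
  show ?thesis
    using assms b by (auto simp: alts_def m_assoc generator_involutive)
qed

lemma alts_initial:
  assumes "i \<in> S" "j \<in> S" "i \<noteq> j" "p \<in> carrier W" "des i p" "des j p" "ws \<in> alts i j"
  shows "initial ws p"
  using assms des_rank2[of i j p] des_rank2[of j i p] by (auto simp: alts_def)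

lemma alts_ascending:
  assumes "i \<in> S" "j \<in> S" "i \<noteq> j" "p \<in> carrier W" "\<not> des i p" "\<not> des j p" "ws \<in> alts i j"
  shows "ascending ws p"
  using assms not_des_rank2[of i j p] not_des_rank2[of j i p] by (auto simp: alts_def)

text \<open>An element of maximal length among the finitely many that can be reached has both
  descents. It serves as reference point of the residue, since every word in \<open>alts i j\<close>
  is \<open>initial\<close> there.\<close>

lemma ex_residue_max:
  assumes "i \<in> S" "j \<in> S" "i \<noteq> j" "p \<in> carrier W"
  shows "\<exists>q\<in>carrier W. \<exists>ws\<in>alts i j. des i q \<and> des j q \<and> p = strip ws q"
proof -
  define T where "T = (\<lambda>ws. strip ws p) ` alts i j"
  have "finite T" "T \<noteq> {}" unfolding T_def alts_def by auto
  then obtain q where q: "q \<in> T" "\<And>y. y \<in> T \<Longrightarrow> len y \<le> len q"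
    using finite_imageI[of T len] Max_in[of "len ` T"] Max_ge[of "len ` T"]
    by (smt (verit) imageE image_eqI image_is_empty)
  obtain ws where ws: "ws \<in> alts i j" "q = strip ws p" using q T_def by auto
  have qW: "q \<in> carrier W" using ws assms alts_lists by auto
  have "des u q" if "u \<in> {i, j}" for u
  proof (rule ccontr)
    assume "\<not> des u q"
    then have "len q < len (u \<otimes> q)" using not_des_len[of u q] that assms qW by auto
    moreover have "u \<otimes> q \<in> T"
    proof -
      obtain vs where vs: "vs \<in> alts i j" "wprod vs = wprod ws \<otimes> u"
        using alts_snoc[OF assms(1-3) ws(1) \<open>u \<in> {i, j}\<close>] by blast
      have "strip vs p = u \<otimes> q"
        using vs ws assms alts_lists that
        by (auto simp: strip_eq inv_mult_group m_assoc)
      then show ?thesis using vs(1) unfolding T_def by (metis image_eqI)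
    qed
    ultimately show False using q(2) by force
  qed
  moreover have "rev ws \<in> alts i j" using ws by (auto simp: alts_def)
  moreover have "p = strip (rev ws) q"
    using ws assms by (auto simp: alts_def)
  ultimately show ?thesis using qW by blast
qed

text \<open>Seen from the top \<open>q\<close> of the residue all words are \<open>initial\<close>,
  so \<open>K_down\<close> pushes every shift into \<open>K q\<close>, and a move changes only the
  word \<open>ws\<close>.\<close>

lemma res_param:
  assumes ij: "i \<in> S" "j \<in> S" "i \<noteq> j" and q: "q \<in> carrier W" "des i q" "des j q"
    and ws0: "ws0 \<in> alts i j" and g0: "g0 \<in> carrier G"
    and res: "res {i, j} g0 (strip ws0 q) g p"
  shows "\<exists>k\<in>K q. \<exists>ws\<in>alts i j. g = g0 \<bullet> ginv (nword ws0) \<bullet> k \<bullet> nword ws \<and> p = strip ws q"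
  using res
proof (induction rule: res.induct)
  case start
  have "g0 = g0 \<bullet> ginv (nword ws0) \<bullet> \<one>g \<bullet> nword ws0"
    using g0 alts_lists[OF ij(1,2) ws0] by (simp add: G.m_assoc)
  then show ?case using ws0 K_one by blast
next
  case (shift g p l)
  then obtain k ws where k: "k \<in> K q" "ws \<in> alts i j"
    "g = g0 \<bullet> ginv (nword ws0) \<bullet> k \<bullet> nword ws" "p = strip ws q" by blast
  have ws: "ws \<in> lists S" using k alts_lists ij by blast
  have l: "nword ws \<bullet> l \<bullet> ginv (nword ws) \<in> K q"
    using K_down[OF ws q(1) alts_initial[OF ij q k(2)]] shift(2) k(4) by simp
  have "g \<bullet> l = g0 \<bullet> ginv (nword ws0) \<bullet> (k \<bullet> (nword ws \<bullet> l \<bullet> ginv (nword ws))) \<bullet> nword ws"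
    using g0 alts_lists[OF ij(1,2) ws0] k(1,3) K_closed[OF k(1)] K_closed[OF shift.hyps(2)] ws
    by (simp add: G.m_assoc)
  then show ?case using k l K_mult by blast
next
  case (move g p u)
  then obtain k ws where k: "k \<in> K q" "ws \<in> alts i j"
    "g = g0 \<bullet> ginv (nword ws0) \<bullet> k \<bullet> nword ws" "p = strip ws q" by blast
  have ws: "ws \<in> lists S" using k alts_lists ij by blast
  obtain vs where vs: "vs \<in> alts i j" "wprod vs = wprod ws \<otimes> u"
    using alts_snoc[OF ij k(2), of u] move(2) by blast
  have vl: "vs \<in> lists S" using vs alts_lists ij by blast
  have u: "u \<in> S" using move ij by auto
  let ?h = "nword ws \<bullet> n u \<bullet> ginv (nword vs)"
  have "?h \<in> N (wprod ws \<otimes> u \<otimes> inv (wprod vs))"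
    using ws vl u by (intro N_mult N_inv nword_N N_n) auto
  then have h: "?h \<in> K q" using vs vl ws u by (intro N1_K) auto
  have "g \<bullet> n u = g0 \<bullet> ginv (nword ws0) \<bullet> (k \<bullet> ?h) \<bullet> nword vs"
    using g0 alts_lists[OF ij(1,2) ws0] k(1,3) K_closed[OF k(1)] ws vl u
    by (simp add: G.m_assoc)
  moreover have "u \<otimes> p = strip vs q"
    using k ws vl vs u q by (simp add: strip_eq inv_mult_group m_assoc)
  ultimately show ?case using vs k h K_mult by blast
qed

text \<open>Inside a rank 2 residue the codistance depends on the chamber only: in the
  parametrisation from the top, equal chambers have words with equal product by
  \<open>C_disjoint\<close>, and the rest is \<open>K_inj\<close>.\<close>

lemma res_inj:
  assumes ij: "i \<in> S" "j \<in> S" "i \<noteq> j" and g0: "g0 \<in> carrier G" "p0 \<in> carrier W"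
    and r: "res {i, j} g0 p0 g p" "res {i, j} g0 p0 g' p'"
    and C: "ginv g \<bullet> g' \<in> C \<one>"
  shows "p' = p \<and> ginv g \<bullet> g' \<in> K p"
proof -
  obtain q ws0 where q: "q \<in> carrier W" "des i q" "des j q" and ws0: "ws0 \<in> alts i j" "p0 = strip ws0 q"
    using ex_residue_max[OF ij g0(2)] by blast
  obtain k ws where k: "k \<in> K q" "ws \<in> alts i j"
    "g = g0 \<bullet> ginv (nword ws0) \<bullet> k \<bullet> nword ws" "p = strip ws q"
    using res_param[OF ij q ws0(1) g0(1)] r(1) ws0 by blast
  obtain k' ws' where k': "k' \<in> K q" "ws' \<in> alts i j"
    "g' = g0 \<bullet> ginv (nword ws0) \<bullet> k' \<bullet> nword ws'" "p' = strip ws' q"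
    using res_param[OF ij q ws0(1) g0(1)] r(2) ws0 by blast
  note l = alts_lists[OF ij(1,2) k(2)] alts_lists[OF ij(1,2) k'(2)] alts_lists[OF ij(1,2) ws0(1)]
  let ?n = "nword ws" and ?n' = "nword ws'"
  define c where "c = ginv k \<bullet> k'"
  have cK: "c \<in> K q" unfolding c_def using k k' by (intro K_mult K_inv)
  have cc: "c \<in> carrier G" using cK K_closed by blast
  have gg: "ginv g \<bullet> g' = ginv ?n \<bullet> c \<bullet> ?n'"
    using g0 l K_closed[OF k(1)] K_closed[OF k'(1)] k(3) k'(3)
    by (simp add: c_def G.inv_mult_group G.m_assoc)
  have "?n \<bullet> (ginv ?n \<bullet> c \<bullet> ?n') \<in> C (wprod ws)"
    using C_C1[OF N_C[OF nword_N[OF l(1)]] _ wprod_closed[OF l(1)]] C unfolding gg by blast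
  then have "c \<bullet> ?n' \<in> C (wprod ws)" using cc l by (simp add: G.m_assoc)
  moreover have "c \<bullet> ?n' \<in> C (wprod ws')"
    using cK l by (intro C1_C K_C1 N_C nword_N) auto
  ultimately have w: "wprod ws = wprod ws'" using l by (intro C_disjoint) auto
  let ?h = "ginv ?n \<bullet> ?n'"
  have "?h \<in> N (inv (wprod ws) \<otimes> wprod ws')"
    using l by (intro N_mult N_inv nword_N) auto
  then have h: "?h \<in> N \<one>" using w l by simp
  have split: "ginv g \<bullet> g' = (ginv ?n \<bullet> c \<bullet> ?n) \<bullet> ?h"
    using gg cc l by (simp add: G.m_assoc)
  then have "(ginv ?n \<bullet> c \<bullet> ?n) \<bullet> ?h \<bullet> ginv ?h \<in> C \<one>"
    using C_C1[OF _ C1_inv[OF N_C[OF h]] one_closed] C by simp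
  then have "ginv ?n \<bullet> c \<bullet> ?n \<in> C \<one>"
    using cc l by (simp add: G.m_assoc G.inv_mult_group)
  then have "ginv ?n \<bullet> c \<bullet> ?n \<in> K (strip ws q)"
    using K_inj[OF l(1) q(1) alts_initial[OF ij q k(2)] cK] by blast
  then have "ginv g \<bullet> g' \<in> K p"
    unfolding split k(4) using K_mult[OF _ N1_K[OF h]] by blast
  moreover have "p' = p" using k k' w l q by (simp add: strip_eq)
  ultimately show ?thesis by blast
qed

text \<open>Here \<open>g\<close> stands for the chamber \<open>g C \<one>\<close> of the building, and \<open>p\<close> for the inverse of its codistance
  from the opposite fundamental chamber. The codistance is propagated outwards from the
  fundamental chamber along minimal galleries (this is what \<open>lam\<close> does). As the building is simply
  connected, that is, as two minimal galleries differ by moves inside rank 2 residues, the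
  result only depends on the chamber (lemma \<open>lam_unique\<close>).\<close>

inductive lam :: "'g \<Rightarrow> 'w \<Rightarrow> bool" where
  base: "lam \<one>g \<one>"
| shift: "lam g p \<Longrightarrow> k \<in> K p \<Longrightarrow> lam (g \<bullet> k) p"
| step: "lam g p \<Longrightarrow> s \<in> S \<Longrightarrow> v \<in> carrier W \<Longrightarrow> g \<in> C v \<Longrightarrow> \<not> des s (inv v) \<Longrightarrow> lam (g \<bullet> n s) (s \<otimes> p)"
| level: "lam g p \<Longrightarrow> s \<in> S \<Longrightarrow> v \<in> carrier W \<Longrightarrow> g \<in> C v \<Longrightarrow> \<not> des s (inv v) \<Longrightarrow> \<not> des s p \<Longrightarrow>
    lam (g \<bullet> f s) p"

lemma lam_closed: "lam g p \<Longrightarrow> g \<in> carrier G \<and> p \<in> carrier W"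
  by (induction rule: lam.induct) (auto simp: K_closed)

lemma lam_C: "lam g p \<Longrightarrow> \<exists>v\<in>carrier W. g \<in> C v"
proof (induction rule: lam.induct)
  case base
  then show ?case using one_C by blast
next
  case (shift g p k)
  then show ?case using C_C1 K_C1 by blast
next
  case (step g p s v)
  then show ?case using C_mult_right[of s v g "n s"] n_C by (intro bexI[of _ "v \<otimes> s"]) auto
next
  case (level g p s v)
  then show ?case using C_mult_right[of s v g "f s"] f_C by (intro bexI[of _ "v \<otimes> s"]) auto
qed

lemma len_mult_right:
  assumes "s \<in> S" "v \<in> carrier W" "\<not> des s (inv v)"
  shows "len (v \<otimes> s) = Suc (len v)"
proof -
  have "len (inv (v \<otimes> s)) = Suc (len (inv v))"
    using assms not_des_len[of s "inv v"] by (simp add: inv_mult_group del: len_inv)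
  then show ?thesis using assms by simp
qed

text \<open>If \<open>s\<close> is no descent of \<open>p\<close>, the chamber of
  \<open>g n s\<close> is the exceptional one of the panel. Crossing to it, shifting by
  \<open>e s\<close> and crossing back yields the third chamber, as
  \<open>n s e s n s = f s\<close>.\<close>

lemma res_level:
  assumes "s \<in> S" "p \<in> carrier W" "g \<in> carrier G" "s \<in> J" "\<not> des s p"
  shows "res J g p (g \<bullet> f s) p"
proof -
  have "res J g p (g \<bullet> n s \<bullet> e s \<bullet> n s) (s \<otimes> (s \<otimes> p))"
    using assms by (intro res.intros e_K) auto
  then show ?thesis
    using assms n_conj_e[of s] by (simp add: G.m_assoc)
qed

text \<open>The last step of the gallery. The second letter \<open>t\<close> stays arbitrary,
  because the step takes place in an \<open>s\<close>-panel and is later placed into a residue of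
  rank 2 that is not known yet.\<close>

lemma lam_cases:
  assumes "lam g p" "v \<in> carrier W" "g \<in> C v"
  shows "(v = \<one> \<and> p = \<one> \<and> g \<in> K \<one>) \<or>
    (\<exists>g0 p0 v0 s. lam g0 p0 \<and> v0 \<in> carrier W \<and> g0 \<in> C v0 \<and> s \<in> S \<and> \<not> des s (inv v0) \<and> v = v0 \<otimes> s
      \<and> ginv g0 \<bullet> g \<in> C s \<and> (\<forall>t. res {s, t} g0 p0 g p))"
  using assms
proof (induction arbitrary: v rule: lam.induct)
  case base
  then have "v = \<one>" using C_disjoint[OF _ one_closed _ one_C] by blast
  then show ?case using K_one by simp
next
  case (shift g p k)
  have cl: "g \<in> carrier G" "k \<in> carrier G" using shift.hyps lam_closed K_closed by auto
  have "g \<in> C v"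
    using C_C1[OF shift.prems(2) C1_inv[OF K_C1[OF shift.hyps(2)]] shift.prems(1)] cl by (simp add: G.m_assoc)
  from shift.IH[OF shift.prems(1) this] show ?case
  proof (elim disjE exE conjE)
    assume "v = \<one>" "p = \<one>" "g \<in> K \<one>"
    then show ?case using K_mult shift.hyps(2) by simp
  next
    fix g0 p0 v0 s
    assume *: "lam g0 p0" "v0 \<in> carrier W" "g0 \<in> C v0" "s \<in> S" "\<not> des s (inv v0)" "v = v0 \<otimes> s"
      "ginv g0 \<bullet> g \<in> C s" "\<forall>t. res {s, t} g0 p0 g p"
    have "ginv g0 \<bullet> (g \<bullet> k) = ginv g0 \<bullet> g \<bullet> k" using cl lam_closed[OF *(1)] by (simp add: G.m_assoc)
    also have "\<dots> \<in> C s" using C_C1[OF *(7) K_C1[OF shift.hyps(2)]] * by simp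
    finally have gk: "ginv g0 \<bullet> (g \<bullet> k) \<in> C s" .
    have "\<forall>t. res {s, t} g0 p0 (g \<bullet> k) p" using *(8) shift.hyps(2) res.shift by blast
    with * gk show ?case
      by (intro disjI2 exI[of _ g0] exI[of _ p0] exI[of _ v0] exI[of _ s] conjI)
  qed
next
  case (step g p s v0)
  have cl: "g \<in> carrier G" "p \<in> carrier W" using step.hyps lam_closed by auto
  have "g \<bullet> n s \<in> C (v0 \<otimes> s)" using step by (intro C_mult_right n_C)
  then have "v = v0 \<otimes> s" using C_disjoint step by auto
  moreover have "ginv g \<bullet> (g \<bullet> n s) \<in> C s" using cl step n_C by simp
  moreover have "res {s, t} g p (g \<bullet> n s) (s \<otimes> p)" for t
    by (intro res.intros) auto
  ultimately show ?case using step.hyps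
    by (intro disjI2 exI[of _ g] exI[of _ p] exI[of _ v0] exI[of _ s] conjI allI)
next
  case (level g p s v0)
  have cl: "g \<in> carrier G" "p \<in> carrier W" using level.hyps lam_closed by auto
  have "g \<bullet> f s \<in> C (v0 \<otimes> s)" using level by (intro C_mult_right f_C)
  then have "v = v0 \<otimes> s" using C_disjoint level by auto
  moreover have "ginv g \<bullet> (g \<bullet> f s) \<in> C s" using cl level f_C by simp
  moreover have "res {s, t} g p (g \<bullet> f s) p" for t
    using level cl by (intro res_level) auto
  ultimately show ?case using level.hyps
    by (intro disjI2 exI[of _ g] exI[of _ p] exI[of _ v0] exI[of _ s] conjI allI)
qed

text \<open>Crossing a panel back. By \<open>K_split\<close> a shift made on the far side either
  becomes a shift of \<open>g\<close> or leads to the third chamber \<open>g f s\<close>.\<close>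

lemma lam_back_step:
  assumes "lam g p" "s \<in> S" "v \<in> carrier W" "g \<in> C v" "\<not> des s (inv v)" "k \<in> K (s \<otimes> p)"
  shows "lam (g \<bullet> n s \<bullet> k \<bullet> n s) p"
proof -
  have cl: "g \<in> carrier G" "p \<in> carrier W" "k \<in> carrier G"
    using assms lam_closed K_closed by auto
  show ?thesis
  proof (cases "des s p")
    case True
    then have "n s \<bullet> k \<bullet> n s \<in> K (s \<otimes> (s \<otimes> p))"
      using assms cl by (intro K_conj_up) auto
    then have "lam (g \<bullet> (n s \<bullet> k \<bullet> n s)) p"
      using assms cl by (intro lam.shift) auto
    then show ?thesis using assms cl by (simp add: G.m_assoc)
  next
    case False
    then have "des s (s \<otimes> p)" using assms cl by simp
    then obtain k' where k': "k' \<in> K (s \<otimes> (s \<otimes> p))" "k = n s \<bullet> k' \<bullet> n s \<or> k = e s \<bullet> (n s \<bullet> k' \<bullet> n s)"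
      using K_split[OF assms(2) _ _ assms(6)] assms cl by auto
    have k'K: "k' \<in> K p" "k' \<in> carrier G" using k' assms cl K_closed by auto
    have "g \<bullet> n s \<bullet> (n s \<bullet> k' \<bullet> n s) \<bullet> n s = g \<bullet> k'"
      using assms cl k'K by (simp add: G.m_assoc)
    moreover have "g \<bullet> n s \<bullet> (e s \<bullet> (n s \<bullet> k' \<bullet> n s)) \<bullet> n s = g \<bullet> (n s \<bullet> e s \<bullet> n s) \<bullet> k'"
      using assms cl k'K by (simp add: G.m_assoc)
    moreover have "lam (g \<bullet> k') p" using assms k'K lam.shift by blast
    moreover have "lam (g \<bullet> f s \<bullet> k') p" using assms k'K False lam.shift lam.level by blast
    ultimately show ?thesis using k'(2) n_conj_e[OF assms(2)] by metis
  qed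
qed

lemma lam_back_level:
  assumes "lam g p" "s \<in> S" "v \<in> carrier W" "g \<in> C v" "\<not> des s (inv v)" "\<not> des s p" "k \<in> K p"
  shows "lam (g \<bullet> f s \<bullet> k \<bullet> n s) (s \<otimes> p)"
proof -
  have cl: "g \<in> carrier G" "p \<in> carrier W" "k \<in> carrier G"
    using assms lam_closed K_closed by auto
  have "n s \<bullet> k \<bullet> n s \<in> K (s \<otimes> p)" "e s \<in> K (s \<otimes> p)"
    using assms cl by (auto intro!: K_conj_up e_K)
  then have "lam (g \<bullet> n s \<bullet> e s \<bullet> (n s \<bullet> k \<bullet> n s)) (s \<otimes> p)"
    using assms by (intro lam.shift lam.step) auto
  moreover have "g \<bullet> n s \<bullet> e s \<bullet> (n s \<bullet> k \<bullet> n s) = g \<bullet> (n s \<bullet> e s \<bullet> n s) \<bullet> k \<bullet> n s"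
    using assms cl by (simp add: G.m_assoc)
  ultimately show ?thesis using n_conj_e[OF assms(2)] by simp
qed

text \<open>A codistance at \<open>g\<close> reaches every farther chamber of the panel. The last
  conjunct, crossing the panel back from an arbitrary representative, is kept for the descending
  case of \<open>lam_move\<close>.\<close>

lemma lam_extend:
  assumes "lam g p" "s \<in> S" "v \<in> carrier W" "g \<in> C v" "\<not> des s (inv v)" "a \<in> C s" "s \<in> J"
  shows "\<exists>g' p'. lam g' p' \<and> res J g p g' p' \<and> ginv g' \<bullet> g \<bullet> a \<in> C \<one> \<and>
    (\<forall>k\<in>K p'. lam (g' \<bullet> k \<bullet> n s) (s \<otimes> p'))"
proof -
  have cl: "g \<in> carrier G" "p \<in> carrier W" using assms lam_closed by auto
  obtain u m w where 1: "u \<in> U" "m \<in> N s" "w \<in> U" "a = u \<bullet> m \<bullet> w" using assms by (auto elim: CE)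
  obtain q where q: "q \<in> U" "n s \<bullet> q \<bullet> n s \<in> U" "u = q \<or> u = e s \<bullet> q"
    using U_split[OF assms(2) 1(1)] by blast
  \<comment> \<open>Modulo \<open>C \<one>\<close> on the right, \<open>a\<close> is
    \<open>n s\<close> or \<open>e s n s\<close>: these are the two chambers of the panel other than
    that of \<open>g\<close>.\<close>
  define c where "c = (n s \<bullet> q \<bullet> n s) \<bullet> (n s \<bullet> m) \<bullet> w"
  have "n s \<bullet> m \<in> N \<one>" using N_mult[OF N_n[OF assms(2)] 1(2)] assms(2) by (simp add: generator_involutive)
  then have c: "c \<in> C \<one>" unfolding c_def using q 1 CI by blast
  have cc: "c \<in> carrier G" using c C_closed by blast
  have qa: "q \<bullet> m \<bullet> w = n s \<bullet> c" unfolding c_def using q 1 assms by (simp add: G.m_assoc N_closed)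
  have a: "a = n s \<bullet> c \<or> a = e s \<bullet> (n s \<bullet> c)"
  proof (cases "u = q")
    case True
    then show ?thesis using 1 qa by simp
  next
    case False
    then have "a = e s \<bullet> (q \<bullet> m \<bullet> w)" using 1 q assms by (simp add: G.m_assoc N_closed)
    then show ?thesis using qa by simp
  qed
  have straight: ?thesis if g1: "lam g1 p" "res J g p g1 p" "g1 \<in> C v" "ginv (g1 \<bullet> n s) \<bullet> g \<bullet> a = c" for g1
  proof (intro exI conjI ballI)
    show "lam (g1 \<bullet> n s) (s \<otimes> p)" using g1 assms lam.step by blast
    show "res J g p (g1 \<bullet> n s) (s \<otimes> p)" using g1 assms res.move by blast
    show "ginv (g1 \<bullet> n s) \<bullet> g \<bullet> a \<in> C \<one>" using g1 c by simp
    show "lam (g1 \<bullet> n s \<bullet> k \<bullet> n s) (s \<otimes> (s \<otimes> p))" if "k \<in> K (s \<otimes> p)" for k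
      using lam_back_step[OF g1(1) assms(2,3) g1(3) assms(5) that] assms cl by simp
  qed
  from a show ?thesis
  proof
    assume "a = n s \<bullet> c"
    then show ?thesis using assms cl cc
      by (intro straight[of g]) (auto intro: res.start simp: G.inv_mult_group G.m_assoc)
  next
    assume ae: "a = e s \<bullet> (n s \<bullet> c)"
    show ?thesis
    proof (cases "des s p")
      case True
      then have eK: "e s \<in> K p" using assms cl by (intro e_K)
      show ?thesis
      proof (rule straight[of "g \<bullet> e s"])
        show "lam (g \<bullet> e s) p" "res J g p (g \<bullet> e s) p"
          using assms eK by (auto intro: lam.shift res.intros)
        show "g \<bullet> e s \<in> C v" using assms eK by (intro C_C1 K_C1)
        show "ginv (g \<bullet> e s \<bullet> n s) \<bullet> g \<bullet> a = c"
          using ae assms cl cc by (simp add: G.inv_mult_group G.m_assoc sr_root)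
      qed
    next
      case False
      have "ginv (g \<bullet> f s) \<bullet> g \<bullet> a = f s \<bullet> (e s \<bullet> (n s \<bullet> c))"
        using ae assms cl cc by (simp add: G.inv_mult_group G.m_assoc sr_root opp_root)
      also have "\<dots> = e s \<bullet> c"
        using assms cc by (simp add: f_eq G.m_assoc sr_root)
      also have "\<dots> \<in> C \<one>" using c e_U assms by (intro U_C)
      finally have "ginv (g \<bullet> f s) \<bullet> g \<bullet> a \<in> C \<one>" .
      then show ?thesis
        using assms cl False lam_back_level[OF assms(1-5) False]
        by (intro exI[of _ "g \<bullet> f s"] exI[of _ p]) (auto intro: lam.level res_level)
    qed
  qed
qed

lemma lam_path:
  assumes "lam g p" "v \<in> carrier W" "g \<in> C v" "ws \<in> lists J" "J \<subseteq> S" "ascending ws (inv v)" "d \<in> C (wprod ws)"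
  shows "\<exists>g' p'. lam g' p' \<and> res J g p g' p' \<and> ginv g' \<bullet> g \<bullet> d \<in> C \<one>"
  using assms
proof (induction ws arbitrary: g p v d)
  case Nil
  have "ginv g \<bullet> g \<bullet> d \<in> C \<one>" using Nil lam_closed C_closed by simp
  then show ?case using Nil res.start by blast
next
  case (Cons s ws)
  have s: "s \<in> S" "s \<in> J" "ws \<in> lists J" "ws \<in> lists S" using Cons.prems lists_mono by auto
  obtain a b where ab: "a \<in> C s" "b \<in> C (wprod ws)" "d = a \<bullet> b"
    using C_factor[of d s "wprod ws"] Cons.prems s by auto
  obtain g1 p1 where 1: "lam g1 p1" "res J g p g1 p1" "ginv g1 \<bullet> g \<bullet> a \<in> C \<one>"
    using lam_extend[OF Cons.prems(1) s(1) Cons.prems(2,3) _ ab(1) s(2)] Cons.prems by auto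
  have cl: "g \<in> carrier G" "g1 \<in> carrier G" "a \<in> carrier G" "b \<in> carrier G"
    using Cons.prems 1 lam_closed ab C_closed by auto
  have "g \<bullet> a \<in> C (v \<otimes> s)" using Cons.prems s ab by (intro C_mult_right) auto
  then have g1C: "g1 \<in> C (v \<otimes> s)"
    using C_same_chamber[of "g \<bullet> a" "v \<otimes> s" g1] 1(3) cl Cons.prems s by (simp add: G.m_assoc)
  have "ginv g1 \<bullet> g \<bullet> a \<bullet> b \<in> C (wprod ws)" using C1_C[OF 1(3) ab(2)] s by simp
  then obtain g2 p2 where 2: "lam g2 p2" "res J g1 p1 g2 p2" "ginv g2 \<bullet> g1 \<bullet> (ginv g1 \<bullet> g \<bullet> a \<bullet> b) \<in> C \<one>"
    using Cons.IH[OF 1(1) _ g1C s(3) Cons.prems(5), of "ginv g1 \<bullet> g \<bullet> a \<bullet> b"] Cons.prems(2,6) s(1)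
    by (simp add: inv_mult_group) blast
  have "ginv g2 \<bullet> g1 \<bullet> (ginv g1 \<bullet> g \<bullet> a \<bullet> b) = ginv g2 \<bullet> g \<bullet> d"
    using cl lam_closed[OF 2(1)] ab by (simp add: G.m_assoc)
  then show ?case using 2 res_trans[OF 2(2) 1(2)] by auto
qed

lemma lam_surj:
  assumes "v \<in> carrier W" "c \<in> C v"
  shows "\<exists>g p. lam g p \<and> ginv g \<bullet> c \<in> C \<one>"
  using assms
proof (induction "len v" arbitrary: v c rule: less_induct)
  case less
  show ?case
  proof (cases "v = \<one>")
    case True
    then show ?thesis using less.prems C_closed by (intro exI[of _ "\<one>g"] exI[of _ \<one>]) (auto intro: lam.base)
  next
    case False
    then obtain s where s: "s \<in> S" "des s (inv v)"
      using ex_des[of "inv v"] less.prems by auto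
    let ?v = "v \<otimes> s"
    have asc: "\<not> des s (inv ?v)" using s less.prems by (simp add: inv_mult_group)
    have vv: "v = ?v \<otimes> s" using s less.prems by (simp add: m_assoc generator_involutive)
    then have "len ?v < len v" using len_mult_right[OF s(1) _ asc] s less.prems by simp
    obtain a b where ab: "a \<in> C ?v" "b \<in> C s" "c = a \<bullet> b"
      using C_factor[of c ?v s] vv s less.prems by auto
    obtain g p where g: "lam g p" "ginv g \<bullet> a \<in> C \<one>"
      using less.hyps[OF \<open>len ?v < len v\<close> _ ab(1)] s less.prems by auto
    have cl: "g \<in> carrier G" "a \<in> carrier G" "b \<in> carrier G" using g ab lam_closed C_closed by auto
    have gC: "g \<in> C ?v" using C_same_chamber[OF ab(1) _ cl(1) g(2)] s less.prems by simp
    have "ginv g \<bullet> a \<bullet> b \<in> C s" using C1_C[OF g(2) ab(2)] s by simp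
    then obtain g' p' where "lam g' p'" "ginv g' \<bullet> g \<bullet> (ginv g \<bullet> a \<bullet> b) \<in> C \<one>"
      using lam_extend[OF g(1) s(1) _ gC asc, of _ "{s}"] s less.prems by (meson S_closed insertI1 m_closed)
    then show ?thesis using cl ab lam_closed by (auto simp: G.m_assoc)
  qed
qed

text \<open>The standard parabolic subgroup of type \<open>{i, j}\<close>, written as a union of
  double cosets.\<close>

definition PJ :: "'w \<Rightarrow> 'w \<Rightarrow> 'g set" where
  "PJ i j = (\<Union>ws\<in>alts i j. C (wprod ws))"

lemma PJ_left:
  assumes "i \<in> S" "j \<in> S" "i \<noteq> j" "u \<in> {i, j}" "a \<in> C u" "b \<in> PJ i j"
  shows "a \<bullet> b \<in> PJ i j"
proof -
  obtain ws where ws: "ws \<in> alts i j" "b \<in> C (wprod ws)" using assms PJ_def by auto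
  obtain vs where vs: "vs \<in> alts i j" "wprod vs = u \<otimes> wprod ws" using alts_Cons[OF assms(1-3) ws(1) assms(4)] by blast
  have "a \<bullet> b \<in> C (u \<otimes> wprod ws) \<union> C (wprod ws)"
    using assms ws alts_lists[OF assms(1,2) ws(1)] by (intro C_mult_cases) auto
  then show ?thesis
  proof
    assume "a \<bullet> b \<in> C (u \<otimes> wprod ws)"
    then have "a \<bullet> b \<in> C (wprod vs)" using vs by simp
    then show ?thesis using vs unfolding PJ_def by blast
  qed (use ws PJ_def in blast)
qed

lemma PJ_left_C1:
  assumes "i \<in> S" "j \<in> S" "a \<in> C \<one>" "b \<in> PJ i j"
  shows "a \<bullet> b \<in> PJ i j"
proof -
  obtain ws where ws: "ws \<in> alts i j" "b \<in> C (wprod ws)" using assms PJ_def by auto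
  then have "a \<bullet> b \<in> C (wprod ws)" using alts_lists[OF assms(1,2)] assms by (intro C1_C) auto
  then show ?thesis using ws unfolding PJ_def by blast
qed

lemma PJ_left_word:
  assumes "i \<in> S" "j \<in> S" "i \<noteq> j" "ws \<in> lists {i, j}" "a \<in> C (wprod ws)" "b \<in> PJ i j"
  shows "a \<bullet> b \<in> PJ i j"
  using assms(4,5)
proof (induction ws arbitrary: a)
  case Nil
  then show ?case using PJ_left_C1 assms by simp
next
  case (Cons u ws)
  have u: "u \<in> S" "u \<in> {i, j}" "ws \<in> lists S" using Cons assms lists_mono[of "{i, j}" S] by auto
  then obtain c d where cd: "c \<in> C u" "d \<in> C (wprod ws)" "a = c \<bullet> d"
    using C_factor[of a u "wprod ws"] Cons by auto
  have "b \<in> carrier G" using assms(6) C_closed unfolding PJ_def by auto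
  then have "a \<bullet> b = c \<bullet> (d \<bullet> b)" using cd C_closed by (simp add: G.m_assoc)
  then show ?case using PJ_left[OF assms(1-3) u(2) cd(1)] Cons cd by simp
qed

lemma C_mult_right_word:
  assumes "v \<in> carrier W" "ws \<in> lists S" "ascending ws (inv v)" "a \<in> C v" "b \<in> C (wprod ws)"
  shows "a \<bullet> b \<in> C (v \<otimes> wprod ws)"
  using assms
proof (induction ws arbitrary: v a b)
  case Nil
  then show ?case using C_C1 by simp
next
  case (Cons s ws)
  then have s: "s \<in> S" "ws \<in> lists S" by auto
  then obtain c d where cd: "c \<in> C s" "d \<in> C (wprod ws)" "b = c \<bullet> d"
    using C_factor[of b s "wprod ws"] Cons by auto
  have "a \<bullet> c \<in> C (v \<otimes> s)" using C_mult_right[OF s(1) Cons.prems(1) _ Cons.prems(4) cd(1)] Cons.prems by auto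
  then have "a \<bullet> c \<bullet> d \<in> C (v \<otimes> s \<otimes> wprod ws)"
    using Cons cd s by (intro Cons.IH) (auto simp: inv_mult_group)
  then show ?case using Cons cd s C_closed by (simp add: G.m_assoc m_assoc)
qed

lemma ex_other: "s \<in> S \<Longrightarrow> \<exists>t\<in>S. t \<noteq> s"
proof (rule ccontr)
  assume "s \<in> S" "\<not> (\<exists>t\<in>S. t \<noteq> s)"
  then have "S = {s}" by blast
  then have "card S = 1" by simp
  then show False using type_444 by (simp add: type_444_def)
qed

text \<open>Simple connectedness of the building, by induction on the distance \<open>v\<close>. If
  the two galleries end in panels of the same type, their last chambers but one agree. Otherwise
  both run through one rank 2 residue; there they are compared with galleries through the projection
  of the fundamental chamber, which is possible by induction, and \<open>res_inj\<close>
  finishes.\<close>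

lemma lam_unique:
  assumes "lam g p" "lam g' p'" "v \<in> carrier W" "g \<in> C v" "ginv g \<bullet> g' \<in> C \<one>"
  shows "p' = p \<and> ginv g \<bullet> g' \<in> K p"
  using assms
proof (induction "len v" arbitrary: v g p g' p' rule: less_induct)
  case less
  have cl: "g \<in> carrier G" "g' \<in> carrier G" using less.prems lam_closed by auto
  have g': "g' \<in> C v" using C_C1[OF less.prems(4,5,3)] cl by simp
  show ?case
  proof (cases "v = \<one>")
    case True
    have no: "\<one> \<noteq> v0 \<otimes> s" if "v0 \<in> carrier W" "s \<in> S" "\<not> des s (inv v0)" for v0 s
    proof
      assume "\<one> = v0 \<otimes> s"
      then have "len (v0 \<otimes> s) = 0" by (metis len_one)
      then show False using len_mult_right[OF that(2,1,3)] by simp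
    qed
    have *: "pp = \<one> \<and> gg \<in> K \<one>" if gg: "lam gg pp" "gg \<in> C v" for gg pp
      using lam_cases[OF gg(1) less.prems(3) gg(2)]
    proof (elim disjE exE conjE)
      fix g0 p0 v0 s
      assume "v0 \<in> carrier W" "s \<in> S" "\<not> des s (inv v0)" "v = v0 \<otimes> s"
      then show ?thesis using no[of v0 s] True by simp
    qed simp
    have "p = \<one>" "p' = \<one>" "ginv g \<in> K \<one>" "g' \<in> K \<one>"
      using *[OF less.prems(1,4)] *[OF less.prems(2) g'] K_inv by auto
    then show ?thesis using K_mult by simp
  next
    case False
    obtain g0 p0 v0 s where 1: "lam g0 p0" "v0 \<in> carrier W" "g0 \<in> C v0" "s \<in> S" "\<not> des s (inv v0)"
      "v = v0 \<otimes> s" "ginv g0 \<bullet> g \<in> C s" "\<And>t. res {s, t} g0 p0 g p"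
      using lam_cases[OF less.prems(1,3,4)] False by (elim disjE exE conjE) (simp, rule that, assumption+, blast)
    obtain g1 p1 v1 t where 2: "lam g1 p1" "v1 \<in> carrier W" "g1 \<in> C v1" "t \<in> S" "\<not> des t (inv v1)"
      "v = v1 \<otimes> t" "ginv g1 \<bullet> g' \<in> C t" "\<And>s. res {t, s} g1 p1 g' p'"
      using lam_cases[OF less.prems(2,3) g'] False by (elim disjE exE conjE) (simp, rule that, assumption+, blast)
    have cl0: "g0 \<in> carrier G" "g1 \<in> carrier G" "p0 \<in> carrier W" "p1 \<in> carrier W"
      using 1 2 lam_closed by auto
    have l: "len v0 < len v" "len v1 < len v"
      using len_mult_right[OF 1(4,2,5)] len_mult_right[OF 2(4,2,5)] 1(6) 2(6) by auto
    have "ginv (ginv g1 \<bullet> g') \<in> C (inv t)" using 2 by (intro C_inv) auto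
    then have g'1: "ginv g' \<bullet> g1 \<in> C t" using cl cl0 2 by (simp add: G.inv_mult_group)
    have g01: "ginv g0 \<bullet> g1 = (ginv g0 \<bullet> g) \<bullet> ((ginv g \<bullet> g') \<bullet> (ginv g' \<bullet> g1))"
      using cl cl0 by (simp add: G.m_assoc)
    have r: "(ginv g \<bullet> g') \<bullet> (ginv g' \<bullet> g1) \<in> C t"
      using C1_C[OF less.prems(5) g'1] 2 by simp
    show ?thesis
    proof (cases "s = t")
      case True
      then have v01: "v0 = v1" using 1 2 by auto
      have "ginv g0 \<bullet> g1 \<in> C \<one> \<union> C s"
        unfolding g01 using 1 r True by (intro C_square) auto
      \<comment> \<open>If it were in \<open>C s\<close>, the ascent at \<open>v0\<close> would put
        \<open>g1\<close> at distance \<open>v\<close> instead of \<open>v1\<close>.\<close>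
      moreover have "ginv g0 \<bullet> g1 \<notin> C s"
      proof
        assume "ginv g0 \<bullet> g1 \<in> C s"
        then have "g0 \<bullet> (ginv g0 \<bullet> g1) \<in> C (v0 \<otimes> s)" using 1 by (intro C_mult_right) auto
        then have "g1 \<in> C v" using cl0 1 by simp
        then have "v1 = v" using 2 less.prems C_disjoint by blast
        then show False using l by simp
      qed
      ultimately have "ginv g0 \<bullet> g1 \<in> C \<one>" by blast
      then have p01: "p1 = p0" "ginv g0 \<bullet> g1 \<in> K p0"
        using less.hyps[OF l(1) 1(1) 2(1) 1(2,3)] by auto
      \<comment> \<open>Any second letter will do; it only provides a rank 2 residue for
        \<open>res_inj\<close>.\<close>
      obtain t' where t': "t' \<in> S" "t' \<noteq> s" using ex_other 1 by blast
      have "res {s, t'} g0 p0 (g0 \<bullet> (ginv g0 \<bullet> g1)) p0" using p01 by (intro res.intros)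
      then have "res {s, t'} g0 p0 g1 p1" using p01 cl0 by simp
      then have "res {s, t'} g0 p0 g' p'" using res_trans 2(8) True by blast
      then show ?thesis
        using res_inj[OF 1(4) t'(1) _ cl0(1,3) 1(8)[of t']] t' less.prems by auto
    next
      case False
      let ?q = "inv v"
      have q: "?q \<in> carrier W" "des s ?q" "des t ?q"
        using less.prems 1(2,4,5) 2(2,4,5) by (simp_all only: inv_closed) (simp add: 1(6) inv_mult_group 1, simp add: 2(6) inv_mult_group 2)
      \<comment> \<open>Both \<open>s\<close> and \<open>t\<close> are descents of
        \<open>inv v\<close>, so the longest element of the rank 2 group can be split off. The
        inverse \<open>v2\<close> of \<open>q4\<close> is the distance of the projection of the
        fundamental chamber to the residue; \<open>v0\<close> and \<open>v1\<close> lie three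
        letters above it.\<close>
      define q4 where "q4 = t \<otimes> (s \<otimes> (t \<otimes> (s \<otimes> ?q)))"
      have q4': "q4 = s \<otimes> (t \<otimes> (s \<otimes> (t \<otimes> ?q)))"
        unfolding q4_def using braid[of t s ?q] 1 2 False q by auto
      have q4W: "q4 \<in> carrier W" unfolding q4_def using 1 2 q by simp
      have asc: "\<not> des s q4" "\<not> des t q4"
        unfolding q4_def using 1(4) 2(4) False q des_rank2[of s t ?q] des_rank2[of t s ?q]
        by (simp_all add: q4'[unfolded q4_def, symmetric])
      define v2 where "v2 = inv q4"
      have v2: "v2 \<in> carrier W" "inv v2 = q4" unfolding v2_def using q4W by auto
      have "v0 = inv (s \<otimes> ?q)" using 1 by (simp add: inv_mult_group m_assoc generator_involutive)
      also have "s \<otimes> ?q = t \<otimes> (s \<otimes> (t \<otimes> q4))" unfolding q4_def using 1 2 q by simp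
      finally have v0: "v0 = v2 \<otimes> wprod [t, s, t]"
        unfolding v2_def using 1(4) 2(4) q4W by (simp add: inv_mult_group m_assoc)
      have "v1 = inv (t \<otimes> ?q)" using 2 by (simp add: inv_mult_group m_assoc generator_involutive)
      also have "t \<otimes> ?q = s \<otimes> (t \<otimes> (s \<otimes> q4))" unfolding q4' using 1 2 q by simp
      finally have v1: "v1 = v2 \<otimes> wprod [s, t, s]"
        unfolding v2_def using 1(4) 2(4) q4W by (simp add: inv_mult_group m_assoc)
      have ws: "[t, s, t] \<in> lists {s, t}" "[s, t, s] \<in> lists {s, t}" "[t, s, t] \<in> lists S" "[s, t, s] \<in> lists S"
        "[t, s, t] \<in> alts s t" "[s, t, s] \<in> alts s t"
        using 1 2 by (auto simp: alts_def)
      have J: "{s, t} \<subseteq> S" using 1 2 by auto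
      note asc8 = alts_ascending[OF 1(4) 2(4) False q4W asc]
      obtain c d where cd: "c \<in> C v2" "d \<in> C (wprod [t, s, t])" "g0 = c \<bullet> d"
        using C_factor[of g0 v2 "wprod [t, s, t]"] 1(3) v0 v2 ws(3) by auto
      obtain c' d' where cd': "c' \<in> C v2" "d' \<in> C (wprod [s, t, s])" "g1 = c' \<bullet> d'"
        using C_factor[of g1 v2 "wprod [s, t, s]"] 2(3) v1 v2 ws(4) by auto
      obtain h \<pi> where h: "lam h \<pi>" "ginv h \<bullet> c \<in> C \<one>" using lam_surj[OF v2(1) cd(1)] by blast
      have clh: "h \<in> carrier G" "\<pi> \<in> carrier W" "c \<in> carrier G" "d \<in> carrier G" "c' \<in> carrier G" "d' \<in> carrier G"
        using h lam_closed cd cd' C_closed by auto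
      have hC: "h \<in> C v2" using C_same_chamber[OF cd(1) v2(1) clh(1) h(2)] .
      \<comment> \<open>The gallery from \<open>h\<close> arrives at the chamber of
        \<open>gg\<close> with some codistance; by the induction hypothesis it is the given one, up
        to a shift.\<close>
      have reach: "res {s, t} h \<pi> gg pp"
        if gg: "lam gg pp" "vv \<in> carrier W" "gg \<in> C vv" "len vv < len v" "ws \<in> alts s t" "ws \<in> lists {s, t}"
          "ginv h \<bullet> gg \<in> C (wprod ws)" for gg pp vv ws
      proof -
        obtain h1 \<pi>1 where h1: "lam h1 \<pi>1" "res {s, t} h \<pi> h1 \<pi>1" "ginv h1 \<bullet> h \<bullet> (ginv h \<bullet> gg) \<in> C \<one>"
          using lam_path[OF h(1) v2(1) hC gg(6) J _ gg(7)] asc8[OF gg(5)] v2 by auto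
        have clg: "gg \<in> carrier G" "h1 \<in> carrier G" using gg h1 lam_closed by auto
        have hg: "ginv h1 \<bullet> gg \<in> C \<one>" using h1 clg clh by (simp add: G.m_assoc)
        have "h1 \<in> C vv" using C_same_chamber[OF gg(3,2) clg(2) hg] .
        then have "pp = \<pi>1" "ginv h1 \<bullet> gg \<in> K \<pi>1"
          using less.hyps[OF gg(4) h1(1) gg(1) gg(2) _ hg] by auto
        then have "res {s, t} h \<pi> (h1 \<bullet> (ginv h1 \<bullet> gg)) pp" using h1 res.shift by blast
        then show ?thesis using clg by simp
      qed
      have hg0: "ginv h \<bullet> g0 \<in> C (wprod [t, s, t])"
      proof -
        have "ginv h \<bullet> c \<bullet> d \<in> C (wprod [t, s, t])" using C1_C[OF h(2) cd(2) wprod_closed[OF ws(3)]] .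
        then show ?thesis using cd(3) clh by (simp add: G.m_assoc)
      qed
      \<comment> \<open>The projection is unique: \<open>h\<close> and \<open>c'\<close> lie in the
        same residue and both have distance \<open>v2\<close>, while every nontrivial element of the
        rank 2 group would raise the distance.\<close>
      have hc': "ginv h \<bullet> c' \<in> C \<one>"
      proof -
        have "ginv d' \<in> C (inv (wprod [s, t, s]))" using cd'(2) ws(4) by (intro C_inv wprod_closed)
        moreover have "inv (wprod [s, t, s]) = wprod [s, t, s]"
          using 1(4) 2(4) by (simp add: inv_mult_group m_assoc)
        ultimately have "ginv d' \<in> C (wprod [s, t, s])" by (simp only:)
        then have "ginv d' \<in> PJ s t" using ws(6) unfolding PJ_def by blast
        then have "((ginv g \<bullet> g') \<bullet> (ginv g' \<bullet> g1)) \<bullet> ginv d' \<in> PJ s t"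
          using PJ_left[OF 1(4) 2(4) False _ r] by blast
        then have "(ginv g0 \<bullet> g) \<bullet> (((ginv g \<bullet> g') \<bullet> (ginv g' \<bullet> g1)) \<bullet> ginv d') \<in> PJ s t"
          using PJ_left[OF 1(4) 2(4) False _ 1(7)] by blast
        then have "(ginv h \<bullet> g0) \<bullet> ((ginv g0 \<bullet> g) \<bullet> (((ginv g \<bullet> g') \<bullet> (ginv g' \<bullet> g1)) \<bullet> ginv d')) \<in> PJ s t"
          using PJ_left_word[OF 1(4) 2(4) False ws(1) hg0] by blast
        moreover have "(ginv h \<bullet> g0) \<bullet> ((ginv g0 \<bullet> g) \<bullet> (((ginv g \<bullet> g') \<bullet> (ginv g' \<bullet> g1)) \<bullet> ginv d')) = ginv h \<bullet> c'"
          using cl cl0 clh cd'(3) by (simp add: G.m_assoc)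
        ultimately obtain us where us: "us \<in> alts s t" "ginv h \<bullet> c' \<in> C (wprod us)"
          unfolding PJ_def by auto
        have usl: "us \<in> lists S" using us alts_lists 1(4) 2(4) by blast
        have "h \<bullet> (ginv h \<bullet> c') \<in> C (v2 \<otimes> wprod us)"
          using C_mult_right_word[OF v2(1) usl _ hC us(2)] asc8[OF us(1)] v2 by simp
        then have "c' \<in> C (v2 \<otimes> wprod us)" using clh by simp
        then have "v2 = v2 \<otimes> wprod us" using cd'(1) v2 usl by (intro C_disjoint) auto
        then have "wprod us = \<one>" using v2 usl by simp
        then show ?thesis using us by simp
      qed
      have hg1: "ginv h \<bullet> g1 \<in> C (wprod [s, t, s])"
      proof -
        have "ginv h \<bullet> c' \<bullet> d' \<in> C (wprod [s, t, s])" using C1_C[OF hc' cd'(2) wprod_closed[OF ws(4)]] .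
        then show ?thesis using cd'(3) clh by (simp add: G.m_assoc)
      qed
      have "res {s, t} h \<pi> g0 p0" using reach[OF 1(1,2,3) l(1) ws(5,1) hg0] .
      then have rg: "res {s, t} h \<pi> g p" using res_trans[OF 1(8)] by blast
      have "res {s, t} h \<pi> g1 p1" using reach[OF 2(1,2,3) l(2) ws(6,2) hg1] .
      then have rg': "res {s, t} h \<pi> g' p'" using res_trans[OF 2(8)[of s]] by (simp add: insert_commute)
      show ?thesis
        using res_inj[OF 1(4) 2(4) False clh(1,2) rg rg' less.prems(5)] .
    qed
  qed
qed

text \<open>For a descending step, the chamber is reached anew from its neighbour by an ascending
  one. By \<open>lam_unique\<close> the two representatives differ by an element of
  \<open>K p\<close>, and \<open>lam_extend\<close> allows crossing back from any of these.\<close>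

lemma lam_move:
  assumes "lam g p" "s \<in> S"
  shows "lam (g \<bullet> n s) (s \<otimes> p)"
proof -
  obtain v where v: "v \<in> carrier W" "g \<in> C v" using lam_C[OF assms(1)] by blast
  have cl: "g \<in> carrier G" "p \<in> carrier W" using lam_closed assms by auto
  show ?thesis
  proof (cases "des s (inv v)")
    case False
    then show ?thesis using lam.step v assms by blast
  next
    case True
    let ?v = "v \<otimes> s"
    have asc: "\<not> des s (inv ?v)" using assms v True by (simp add: inv_mult_group)
    have vv: "v = ?v \<otimes> s" using assms v by (simp add: m_assoc generator_involutive)
    obtain a b where ab: "a \<in> C ?v" "b \<in> C s" "g = a \<bullet> b"
      using C_factor[of g ?v s] vv v assms by auto
    obtain h q where h: "lam h q" "ginv h \<bullet> a \<in> C \<one>"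
      using lam_surj[of ?v a] v assms ab by auto
    have clh: "h \<in> carrier G" "a \<in> carrier G" "b \<in> carrier G" using h ab lam_closed C_closed by auto
    have hC: "h \<in> C ?v" using C_same_chamber[OF ab(1) _ clh(1) h(2)] v assms by simp
    have "ginv h \<bullet> a \<bullet> b \<in> C s" using C1_C[OF h(2) ab(2)] assms by simp
    then obtain g' p' where g': "lam g' p'" "ginv g' \<bullet> h \<bullet> (ginv h \<bullet> a \<bullet> b) \<in> C \<one>"
      "\<forall>k\<in>K p'. lam (g' \<bullet> k \<bullet> n s) (s \<otimes> p')"
      using lam_extend[OF h(1) assms(2) _ hC asc, of _ "{s}"] v assms by (meson S_closed insertI1 m_closed)
    have clg: "g' \<in> carrier G" using g' lam_closed by auto
    have gg: "ginv g' \<bullet> g \<in> C \<one>" using g'(2) clh clg ab(3) by (simp add: G.m_assoc)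
    have "g' \<in> C v" using C_same_chamber[OF v(2,1) clg gg] .
    then have "p = p'" "ginv g' \<bullet> g \<in> K p'" using lam_unique[OF g'(1) assms(1) v(1) _ gg] by auto
    then have "lam (g' \<bullet> (ginv g' \<bullet> g) \<bullet> n s) (s \<otimes> p)" using g'(3) by auto
    then show ?thesis using cl clg by simp
  qed
qed

lemma lam_moves: "lam g p \<Longrightarrow> ws \<in> lists S \<Longrightarrow> lam (g \<bullet> nword ws) (strip ws p)"
proof (induction ws arbitrary: g p)
  case Nil
  then show ?case using lam_closed by simp
next
  case (Cons s ws)
  then have "lam (g \<bullet> n s \<bullet> nword ws) (strip ws (s \<otimes> p))" using lam_move by auto
  then show ?case using Cons lam_closed by (simp add: G.m_assoc)
qed

text \<open>Walking along a word for some \<open>w \<in> \<beta>\<close> turns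
  \<open>x \<beta>\<close> into an element of \<open>K (inv w)\<close>, where it acts as a shift;
  then one walks back.\<close>

lemma lam_negative:
  assumes "lam g \<one>" "\<beta> \<in> rts" "\<one> \<notin> \<beta>"
  shows "lam (g \<bullet> x \<beta>) \<one>"
proof -
  obtain w where w: "w \<in> carrier W" "w \<in> \<beta>" using root_nonempty assms by blast
  then obtain ws where ws: "ws \<in> lists S" "wprod ws = w" using reduced_word by metis
  let ?\<gamma> = "inv w \<cdot> \<beta>"
  have g: "g \<in> carrier G" using assms lam_closed by blast
  have 1: "lam (g \<bullet> nword ws) (inv w)" using lam_moves[OF assms(1) ws(1)] ws w by (simp add: strip_eq)
  have "?\<gamma> \<in> {\<gamma> \<in> prts. inv w \<notin> \<gamma>}"
    using assms w by (simp add: pos_roots_def act_root in_act_iff)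
  then have "x ?\<gamma> \<in> K (inv w)" by (intro gen_K gen_incl)
  then have "lam (g \<bullet> nword ws \<bullet> x ?\<gamma>) (inv w)" using 1 lam.shift by blast
  then have "lam (g \<bullet> nword ws \<bullet> x ?\<gamma> \<bullet> nword (rev ws)) (strip (rev ws) (inv w))"
    using ws by (intro lam_moves) (auto simp: in_lists_conv_set)
  moreover have "strip (rev ws) (inv w) = \<one>"
  proof -
    have "wprod (rev ws) = inv w"
      using ws(1) unfolding ws(2)[symmetric]
      by (induction ws) (auto simp: wprod_append inv_mult_group in_lists_conv_set)
    then show ?thesis using ws w strip_eq[of "rev ws" "inv w"] by (simp add: in_lists_conv_set)
  qed
  moreover have "g \<bullet> nword ws \<bullet> x ?\<gamma> \<bullet> nword (rev ws) = g \<bullet> (nword ws \<bullet> x ?\<gamma> \<bullet> ginv (nword ws))"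
    using ws g assms w by (simp add: nword_rev G.m_assoc act_root)
  moreover have "nword ws \<bullet> x ?\<gamma> \<bullet> ginv (nword ws) = x \<beta>"
    using N_conj[OF nword_N[OF ws(1)], of ?\<gamma>] ws w assms by (simp add: act_root act_act act_one)
  ultimately show ?thesis by simp
qed

lemma lam_gen_negative:
  assumes "u \<in> gen {\<beta> \<in> rts. \<one> \<notin> \<beta>}"
  shows "lam g \<one> \<Longrightarrow> lam (g \<bullet> u) \<one>"
  using assms
proof (induction arbitrary: g rule: generate.induct)
  case one
  then show ?case using lam_closed by simp
next
  case (incl h)
  then show ?case using lam_negative by auto
next
  case (inv h)
  then show ?case using lam_negative by auto
next
  case (eng h1 h2)
  have "{\<beta> \<in> rts. \<one> \<notin> \<beta>} \<subseteq> rts" by blast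
  then have "h1 \<in> carrier G" "h2 \<in> carrier G" using gen_carrier eng.hyps by blast+
  moreover have "lam (g \<bullet> h1 \<bullet> h2) \<one>" using eng by blast
  ultimately show ?case using lam_closed[OF eng.prems] by (simp add: G.m_assoc)
qed

text \<open>If \<open>e s\<close> were a product of negative root elements, so would be
  \<open>n s = f s e s f s\<close>. Then \<open>n s\<close> would keep the codistance
  \<open>\<one>\<close>, while crossing the panel gives it the codistance \<open>s\<close>.\<close>

theorem e_notin_negative:
  assumes s: "s \<in> S"
  shows "e s \<notin> gen {\<beta> \<in> rts. \<one> \<notin> \<beta>}"
proof
  let ?B = "{\<beta> \<in> rts. \<one> \<notin> \<beta>}"
  assume e: "e s \<in> gen ?B"
  have "f s \<in> gen ?B" using s by (intro gen_incl) (simp add: opp_root sr_root root_int_opp in_sr)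
  then have "n s \<in> gen ?B"
    unfolding n_def using e subgroup.m_closed[OF gen_subgroup[of ?B]] by auto
  then have 1: "lam (n s) \<one>" using lam_gen_negative[OF _ lam.base, of "n s"] s by simp
  have 2: "lam (n s) s" using lam_move[OF lam.base s] s by simp
  have "s = \<one>" using lam_unique[OF 1 2 _ n_C[OF s]] s one_C by simp
  then show False using s inversion_gen[OF s, of s] inversion_one[of s] by simp
qed

text \<open>The change of signs exchanges \<open>e u\<close> and \<open>f u\<close> and keeps
  \<open>n u\<close> by \<open>n_eq\<close>; the missing axiom is
  \<open>e_notin_negative\<close>.\<close>

theorem opposite: "rgd_F2 W S G (\<lambda>\<alpha>. x (opp W \<alpha>))"
proof unfold_locales
  fix \<alpha> \<beta>
  assume ab: "\<alpha> \<in> rts" "\<beta> \<in> rts" "\<alpha> \<noteq> \<beta>" "prenilpotent W \<alpha> \<beta>"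
  then have "prenilpotent W (opp W \<alpha>) (opp W \<beta>)" "opp W \<alpha> \<noteq> opp W \<beta>"
    using opp_opp by (auto simp: prenilpotent_def) metis+
  then have "x (opp W \<alpha>) \<bullet> x (opp W \<beta>) \<bullet> x (opp W \<alpha>) \<bullet> x (opp W \<beta>)
      \<in> generate G (x ` open_root_interval W S (opp W \<alpha>) (opp W \<beta>))"
    using ab by (intro x_comm opp_root)
  then show "x (opp W \<alpha>) \<bullet> x (opp W \<beta>) \<bullet> x (opp W \<alpha>) \<bullet> x (opp W \<beta>)
      \<in> generate G ((\<lambda>\<alpha>. x (opp W \<alpha>)) ` open_root_interval W S \<alpha> \<beta>)"
    using ab by (simp add: open_interval_opp image_image)
next
  fix u \<beta> assume ub: "u \<in> S" "\<beta> \<in> rts"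
  then have "n u \<bullet> (x (opp W \<beta>) \<bullet> n u) = x (u \<cdot> opp W \<beta>)"
    by (intro n_conj opp_root)
  then show "x (opp W (opp W (sr u))) \<bullet> x (opp W (sr u)) \<bullet> x (opp W (opp W (sr u))) \<bullet> x (opp W \<beta>) \<bullet>
      (x (opp W (opp W (sr u))) \<bullet> x (opp W (sr u)) \<bullet> x (opp W (opp W (sr u)))) = x (opp W (u \<cdot> \<beta>))"
    using ub n_eq[OF ub(1)] by (simp add: opp_opp sr_root opp_act G.m_assoc opp_root)
next
  fix u assume "u \<in> S"
  moreover have "(\<lambda>\<alpha>. x (opp W \<alpha>)) ` prts \<subseteq> x ` {\<beta> \<in> rts. \<one> \<notin> \<beta>}"
    by (auto simp: pos_roots_def opp_root root_int_opp intro!: imageI)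
  then have "generate G ((\<lambda>\<alpha>. x (opp W \<alpha>)) ` prts) \<subseteq> gen {\<beta> \<in> rts. \<one> \<notin> \<beta>}"
    by (rule G.mono_generate)
  ultimately show "x (opp W (opp W (sr u))) \<notin> generate G ((\<lambda>\<alpha>. x (opp W \<alpha>)) ` prts)"
    using e_notin_negative by (auto simp: opp_opp sr_root)
qed (auto simp: opp_root)

end

section \<open>Rank 2 relations\<close>

lemma (in group) generate_commuting_involutions:
  assumes ab: "a \<in> carrier G" "b \<in> carrier G" "a \<otimes> a = \<one>" "b \<otimes> b = \<one>" "a \<otimes> b = b \<otimes> a"
    and g: "g \<in> generate G {a, b}"
  shows "g \<in> {\<one>, a, b, a \<otimes> b}"
proof -
  have aa: "a \<otimes> (a \<otimes> c) = c" and bb: "b \<otimes> (b \<otimes> c) = c" and ba: "b \<otimes> (a \<otimes> c) = a \<otimes> (b \<otimes> c)"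
    if "c \<in> carrier G" for c
  proof -
    show "a \<otimes> (a \<otimes> c) = c" "b \<otimes> (b \<otimes> c) = c"
      using that ab(1-4) by (simp_all flip: m_assoc)
    have "b \<otimes> a \<otimes> c = a \<otimes> b \<otimes> c" using ab(5) by simp
    then show "b \<otimes> (a \<otimes> c) = a \<otimes> (b \<otimes> c)" using that ab(1,2) by (simp add: m_assoc)
  qed
  have i: "inv a = a" "inv b = b" using ab by (auto intro: inv_equality)
  from g show ?thesis
  proof (induction rule: generate.induct)
    case (eng h1 h2)
    then show ?case
      using ab(1-4) by (elim insertE emptyE) (simp_all add: m_assoc aa bb ba ab(5)[symmetric])
  qed (auto simp: i)
qed

context coxeter_444
begin

declare generator_involutive [simp]

lemma not_des_gen [simp]: "i \<in> S \<Longrightarrow> j \<in> S \<Longrightarrow> i \<noteq> j \<Longrightarrow> \<not> des i j"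
  by (simp add: inversion_gen)

lemma des_gen [simp]: "i \<in> S \<Longrightarrow> des i i"
  by (simp add: inversion_gen)

lemma not_des_ab [simp]: "i \<in> S \<Longrightarrow> j \<in> S \<Longrightarrow> i \<noteq> j \<Longrightarrow> \<not> des i (j \<otimes> i)"
  using des_aba[of i j \<one>] by simp

lemma not_des_abc [simp]:
  "i \<in> S \<Longrightarrow> j \<in> S \<Longrightarrow> k \<in> S \<Longrightarrow> i \<noteq> j \<Longrightarrow> i \<noteq> k \<Longrightarrow> j \<noteq> k \<Longrightarrow> \<not> des k (j \<otimes> i)"
  using not_des_mult[of i j k \<one>] by simp

lemma braid4:
  assumes "i \<in> S" "j \<in> S" "i \<noteq> j"
  shows "i \<otimes> (j \<otimes> (i \<otimes> j)) = j \<otimes> (i \<otimes> (j \<otimes> i))"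
  using braid[of i j \<one>] assms by simp

lemma rank2_top:
  assumes "i \<in> S" "j \<in> S" "i \<noteq> j"
  shows "(i \<otimes> (j \<otimes> i)) \<cdot> sr j = sr j"
proof (rule root_separation)
  have dist: "j \<noteq> i" using assms by simp
  show "\<one> \<in> (i \<otimes> (j \<otimes> i)) \<cdot> sr j"
    using assms dist by (simp add: in_act_iff sr_root in_sr inv_mult_group m_assoc generator_involutive)
  show "j \<notin> (i \<otimes> (j \<otimes> i)) \<cdot> sr j"
    using assms dist braid4[OF assms] by (simp add: in_act_iff sr_root in_sr inv_mult_group m_assoc)
qed (use assms in \<open>auto simp: act_root sr_root\<close>)

text \<open>The reflection of this root is \<open>j i j\<close>, which commutes with
  \<open>i\<close> as \<open>(i j)^4 = 1\<close>.\<close>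

lemma rank2_act:
  assumes "i \<in> S" "j \<in> S" "i \<noteq> j"
  shows "i \<cdot> (j \<cdot> sr i) = j \<cdot> sr i"
proof -
  have "j \<cdot> (i \<cdot> (j \<cdot> sr i)) = sr i"
    using rank2_top[of j i] assms by (simp add: act_act sr_root act_root)
  then have "j \<cdot> (j \<cdot> (i \<cdot> (j \<cdot> sr i))) = j \<cdot> sr i" by simp
  then show ?thesis using assms by (simp add: act_cancel sr_root act_root)
qed

text \<open>The gallery \<open>\<one>\<close>, \<open>i\<close>, \<open>i j\<close> leaves
  \<open>\<gamma>\<close> at one of its two steps, and that step determines
  \<open>\<gamma>\<close>.\<close>

lemma pos_root_notin_2:
  assumes "\<gamma> \<in> prts" "i \<in> S" "j \<in> S" "i \<otimes> j \<notin> \<gamma>"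
  shows "\<gamma> = sr i \<or> \<gamma> = i \<cdot> sr j"
proof (cases "i \<in> \<gamma>")
  case True
  then show ?thesis using root_separation_at[of \<gamma> j i] assms prts_rts by auto
next
  case False
  then show ?thesis using root_separation[of \<gamma> i] assms by (auto simp: pos_roots_def)
qed

lemma pos_root_notin_3:
  assumes "\<gamma> \<in> prts" "i \<in> S" "j \<in> S" "k \<in> S" "i \<otimes> j \<otimes> k \<notin> \<gamma>"
  shows "\<gamma> = sr i \<or> \<gamma> = i \<cdot> sr j \<or> \<gamma> = i \<cdot> (j \<cdot> sr k)"
proof (cases "i \<otimes> j \<in> \<gamma>")
  case True
  then show ?thesis using root_separation_at[of \<gamma> k "i \<otimes> j"] assms prts_rts by (auto simp: act_act sr_root)
next
  case False
  then show ?thesis using pos_root_notin_2 assms by blast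
qed

lemma pos_root_notin_4:
  assumes "\<gamma> \<in> prts" "i \<in> S" "j \<in> S" "i \<noteq> j" "i \<otimes> (j \<otimes> (i \<otimes> j)) \<notin> \<gamma>"
  shows "\<gamma> \<in> {sr i, i \<cdot> sr j, j \<cdot> sr i, sr j}"
proof (cases "i \<otimes> j \<otimes> i \<in> \<gamma>")
  case True
  then have "\<gamma> = (i \<otimes> j \<otimes> i) \<cdot> sr j"
    using assms prts_rts by (intro root_separation_at) (auto simp: m_assoc)
  then show ?thesis using rank2_top[OF assms(2-4)] assms by (simp add: m_assoc)
next
  case False
  then show ?thesis using pos_root_notin_3[of \<gamma> i j i] assms rank2_act[of i j] by auto
qed

end

context rgd_F2
begin

lemma f_n_conj:
  assumes "i \<in> S" "j \<in> S"
  shows "n i \<bullet> f j \<bullet> n i = x (opp W (i \<cdot> sr j))"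
  using assms n_conj[of i "opp W (sr j)"] by (simp add: opp_act sr_root opp_root G.m_assoc)

text \<open>The element \<open>w\<close> lies outside both roots, which gives prenilpotency, and
  every root of the interval is positive and omits \<open>w\<close>. For short \<open>w\<close>
  these roots are listed by \<open>pos_root_notin_2\<close> and its analogues.\<close>

lemma opp_comm:
  assumes "\<alpha> \<in> prts" "\<beta> \<in> prts" "\<alpha> \<noteq> \<beta>" "w \<in> carrier W" "w \<notin> \<alpha>" "w \<notin> \<beta>"
    and "\<And>\<gamma>. \<gamma> \<in> prts \<Longrightarrow> w \<notin> \<gamma> \<Longrightarrow> \<gamma> \<in> insert \<alpha> (insert \<beta> A)"
  shows "x (opp W \<alpha>) \<bullet> x (opp W \<beta>) \<bullet> x (opp W \<alpha>) \<bullet> x (opp W \<beta>) \<in> generate G ((\<lambda>\<gamma>. x (opp W \<gamma>)) ` A)"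
proof -
  have r: "\<alpha> \<in> rts" "\<beta> \<in> rts" using assms prts_rts by auto
  have one: "\<one> \<in> \<alpha> \<inter> \<beta>" "w \<in> opp W \<alpha> \<inter> opp W \<beta>"
    using assms by (auto simp: pos_roots_def opp_def)
  then have "prenilpotent W (opp W \<alpha>) (opp W \<beta>)"
    using r by (auto simp: prenilpotent_def opp_opp)
  moreover have "opp W \<alpha> \<noteq> opp W \<beta>" using opp_opp r assms(3) by metis
  ultimately have "x (opp W \<alpha>) \<bullet> x (opp W \<beta>) \<bullet> x (opp W \<alpha>) \<bullet> x (opp W \<beta>)
      \<in> generate G (x ` opp W ` open_root_interval W S \<alpha> \<beta>)"
    using x_comm[of "opp W \<alpha>" "opp W \<beta>"] r by (simp add: opp_root open_interval_opp)
  moreover have "open_root_interval W S \<alpha> \<beta> \<subseteq> A"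
  proof
    fix \<gamma> assume "\<gamma> \<in> open_root_interval W S \<alpha> \<beta>"
    then have \<gamma>: "\<gamma> \<in> rts" "\<alpha> \<inter> \<beta> \<subseteq> \<gamma>" "opp W \<alpha> \<inter> opp W \<beta> \<subseteq> opp W \<gamma>" "\<gamma> \<noteq> \<alpha>" "\<gamma> \<noteq> \<beta>"
      by (auto simp: open_root_interval_def root_interval_def)
    then have "\<gamma> \<in> prts" "w \<notin> \<gamma>" using one by (auto simp: pos_roots_def opp_def)
    then show "\<gamma> \<in> A" using assms(7) \<gamma> by blast
  qed
  then have "generate G (x ` opp W ` open_root_interval W S \<alpha> \<beta>) \<subseteq> generate G ((\<lambda>\<gamma>. x (opp W \<gamma>)) ` A)"
    by (intro G.mono_generate) auto
  ultimately show ?thesis by blast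
qed

lemma commute_of_comm:
  assumes "a \<in> carrier G" "b \<in> carrier G" "a \<bullet> a = \<one>g" "b \<bullet> b = \<one>g" "a \<bullet> b \<bullet> a \<bullet> b = \<one>g"
  shows "a \<bullet> b = b \<bullet> a"
proof -
  have "a \<bullet> (a \<bullet> b \<bullet> a \<bullet> b) \<bullet> b = a \<bullet> b" using assms by simp
  moreover have "a \<bullet> (a \<bullet> b \<bullet> a \<bullet> b) \<bullet> b = (a \<bullet> a) \<bullet> (b \<bullet> a) \<bullet> (b \<bullet> b)"
    using assms(1,2) by (simp add: G.m_assoc)
  ultimately show ?thesis using assms by simp
qed

text \<open>The gallery \<open>\<one>\<close>, \<open>i\<close>, \<open>i j\<close> crosses only
  these two walls, so the open interval is empty.\<close>

lemma f_commute_adjacent: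
  assumes "i \<in> S" "j \<in> S" "i \<noteq> j"
  shows "f i \<bullet> (n i \<bullet> f j \<bullet> n i) = n i \<bullet> f j \<bullet> n i \<bullet> f i"
proof -
  have pos: "i \<cdot> sr j \<in> prts" "sr i \<in> prts"
    using assms act_pos[of "sr j" i] sr_pos[of j] sr_pos[of i]
    by (auto simp: in_sr pos_roots_def in_act_iff act_root sr_root)
  have ne: "sr i \<noteq> i \<cdot> sr j"
    using act_neq_sr[OF sr_pos[OF assms(2)] assms(1)] by simp
  have "f i \<bullet> x (opp W (i \<cdot> sr j)) \<bullet> f i \<bullet> x (opp W (i \<cdot> sr j)) \<in> generate G ((\<lambda>\<gamma>. x (opp W \<gamma>)) ` {})"
    using assms pos ne pos_root_notin_2[of _ i j]
    by (intro opp_comm[of _ _ "i \<otimes> j"]) (auto simp: in_sr in_act_iff sr_root)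
  then have "f i \<bullet> x (opp W (i \<cdot> sr j)) \<bullet> f i \<bullet> x (opp W (i \<cdot> sr j)) = \<one>g"
    by (simp add: G.generate_empty)
  then show ?thesis
    unfolding f_n_conj[OF assms(1,2)] using assms
    by (intro commute_of_comm) (auto simp: opp_root act_root sr_root)
qed

lemma C_f: "i \<in> S \<Longrightarrow> w \<in> carrier W \<Longrightarrow> \<not> des i w \<Longrightarrow> g \<in> C w \<Longrightarrow> f i \<bullet> g \<in> C (i \<otimes> w)"
  by (intro C_mult f_C)

lemma C_n: "i \<in> S \<Longrightarrow> w \<in> carrier W \<Longrightarrow> \<not> des i w \<Longrightarrow> g \<in> C w \<Longrightarrow> n i \<bullet> g \<in> C (i \<otimes> w)"
  by (intro C_mult n_C)

lemma C_e: "i \<in> S \<Longrightarrow> g \<in> C w \<Longrightarrow> e i \<bullet> g \<in> C w"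
  by (intro U_C e_U)

lemma n_f_left: "i \<in> S \<Longrightarrow> g \<in> carrier G \<Longrightarrow> n i \<bullet> (f i \<bullet> g) = e i \<bullet> (n i \<bullet> g)"
  using n_f[of i] by (simp add: n_closed flip: G.m_assoc)

lemma f_n_left: "i \<in> S \<Longrightarrow> g \<in> carrier G \<Longrightarrow> f i \<bullet> (n i \<bullet> g) = n i \<bullet> (e i \<bullet> g)"
  using n_e[of i] by (simp add: n_closed flip: G.m_assoc)

lemma f_cancel [simp]: "i \<in> S \<Longrightarrow> g \<in> carrier G \<Longrightarrow> f i \<bullet> (f i \<bullet> g) = g"
  by (simp add: opp_root sr_root)

lemma e_cancel [simp]: "i \<in> S \<Longrightarrow> g \<in> carrier G \<Longrightarrow> e i \<bullet> (e i \<bullet> g) = g"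
  by (simp add: sr_root)

lemma f_sq [simp]: "i \<in> S \<Longrightarrow> f i \<bullet> f i = \<one>g"
  by (simp add: opp_root sr_root)

lemma n_conj_adjacent:
  assumes "i \<in> S" "j \<in> S" "i \<noteq> j"
  shows "n i \<bullet> (n j \<bullet> f i \<bullet> n j) \<bullet> n i = n j \<bullet> f i \<bullet> n j"
proof -
  have "n i \<bullet> (x (opp W (j \<cdot> sr i)) \<bullet> n i) = x (opp W (j \<cdot> sr i))"
    using n_conj[OF assms(1), of "opp W (j \<cdot> sr i)"] rank2_act[OF assms] assms
    by (simp add: opp_root act_root sr_root flip: opp_act)
  then show ?thesis
    unfolding f_n_conj[OF assms(2,1)] using assms by (simp add: G.m_assoc opp_root act_root sr_root)
qed

lemma adjacent_commute:
  assumes "i \<in> S" "j \<in> S" "i \<noteq> j"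
  shows "(n i \<bullet> f j \<bullet> n i) \<bullet> (n j \<bullet> f i \<bullet> n j) = (n j \<bullet> f i \<bullet> n j) \<bullet> (n i \<bullet> f j \<bullet> n i)"
proof -
  define h where "h = n j \<bullet> f i \<bullet> n j"
  have h: "h \<in> carrier G" using assms by (simp add: h_def)
  have "n i \<bullet> h = (n i \<bullet> h \<bullet> n i) \<bullet> n i" using assms h by (simp add: G.m_assoc)
  then have nh: "n i \<bullet> h = h \<bullet> n i" using n_conj_adjacent[OF assms] unfolding h_def by simp
  have fh: "f j \<bullet> h = h \<bullet> f j" using f_commute_adjacent[of j i] assms by (simp add: h_def)
  have "(n i \<bullet> f j \<bullet> n i) \<bullet> h = n i \<bullet> f j \<bullet> (n i \<bullet> h)" using assms h by (simp add: G.m_assoc)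
  also have "\<dots> = n i \<bullet> (f j \<bullet> h) \<bullet> n i" unfolding nh using assms h by (simp add: G.m_assoc)
  also have "\<dots> = (n i \<bullet> h) \<bullet> f j \<bullet> n i" unfolding fh using assms h by (simp add: G.m_assoc)
  also have "\<dots> = h \<bullet> (n i \<bullet> f j \<bullet> n i)" unfolding nh using assms h by (simp add: G.m_assoc)
  finally show ?thesis unfolding h_def .
qed

text \<open>The commutator of \<open>f i\<close> and \<open>f j\<close> is a product of at most two commuting root elements. It lies in the
  double coset of the longest element, so both of them occur.\<close>

lemma commutator_eq:
  assumes "i \<in> S" "j \<in> S" "i \<noteq> j"
  shows "f i \<bullet> f j \<bullet> f i \<bullet> f j = (n i \<bullet> f j \<bullet> n i) \<bullet> (n j \<bullet> f i \<bullet> n j)"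
proof -
  have dist: "j \<noteq> i" using assms by simp
  let ?a = "n i \<bullet> f j \<bullet> n i" and ?b = "n j \<bullet> f i \<bullet> n j" and ?z = "f i \<bullet> f j \<bullet> f i \<bullet> f j"
  let ?w = "i \<otimes> (j \<otimes> (i \<otimes> j))"
  have "?z \<in> generate G ((\<lambda>\<gamma>. x (opp W \<gamma>)) ` {i \<cdot> sr j, j \<cdot> sr i})"
  proof (rule opp_comm[of _ _ ?w])
    show "sr i \<noteq> sr j" using in_sr[of i i] in_sr[of j i] assms dist by auto
    show "?w \<notin> sr i" using assms dist by (simp add: in_sr)
    show "?w \<notin> sr j" using assms dist by (subst braid4) (simp_all add: in_sr)
    show "\<gamma> \<in> {sr i, sr j, i \<cdot> sr j, j \<cdot> sr i}" if "\<gamma> \<in> prts" "?w \<notin> \<gamma>" for \<gamma>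
      using pos_root_notin_4[OF that(1) assms that(2)] by blast
  qed (use assms sr_pos in auto)
  then have "?z \<in> generate G {?a, ?b}"
    using assms by (simp add: f_n_conj)
  then have z: "?z \<in> {\<one>g, ?a, ?b, ?a \<bullet> ?b}"
    using assms adjacent_commute[OF assms]
    by (intro G.generate_commuting_involutions) (simp_all add: G.m_assoc)
  have zC: "?z \<in> C ?w"
  proof -
    have "f i \<bullet> (f j \<bullet> (f i \<bullet> f j)) \<in> C ?w"
      using assms dist f_C by (intro C_f) (auto simp: generator_involutive)
    then show ?thesis using assms by (simp add: G.m_assoc)
  qed
  have aC: "?a \<in> C (i \<otimes> (j \<otimes> i))"
  proof -
    have "n i \<bullet> (f j \<bullet> n i) \<in> C (i \<otimes> (j \<otimes> i))"
      using assms dist n_C by (intro C_f C_n) auto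
    then show ?thesis using assms by (simp add: G.m_assoc)
  qed
  have bC: "?b \<in> C (j \<otimes> (i \<otimes> j))"
  proof -
    have "n j \<bullet> (f i \<bullet> n j) \<in> C (j \<otimes> (i \<otimes> j))"
      using assms dist n_C by (intro C_f C_n) auto
    then show ?thesis using assms by (simp add: G.m_assoc)
  qed
  have cl: "?w \<in> carrier W" "i \<otimes> (j \<otimes> i) \<in> carrier W" "j \<otimes> (i \<otimes> j) \<in> carrier W"
    using assms by simp_all
  have di: "des i ?w" using assms dist by simp
  have dj: "des j ?w" using assms dist by (subst braid4) simp_all
  have "?z \<noteq> \<one>g"
  proof
    assume "?z = \<one>g"
    then have "?w = \<one>" using C_disjoint[OF _ one_closed zC] one_C assms by simp
    from di show False unfolding \<open>?w = \<one>\<close> using assms by simp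
  qed
  moreover have "?z \<noteq> ?a"
  proof
    assume "?z = ?a"
    with aC have "?z \<in> C (i \<otimes> (j \<otimes> i))" by simp
    from C_disjoint[OF cl(1,2) zC this] have "?w = i \<otimes> (j \<otimes> i)" .
    from dj show False unfolding \<open>?w = i \<otimes> (j \<otimes> i)\<close> using assms dist by simp
  qed
  moreover have "?z \<noteq> ?b"
  proof
    assume "?z = ?b"
    with bC have "?z \<in> C (j \<otimes> (i \<otimes> j))" by simp
    from C_disjoint[OF cl(1,3) zC this] have "?w = j \<otimes> (i \<otimes> j)" .
    from di show False unfolding \<open>?w = j \<otimes> (i \<otimes> j)\<close> using assms dist by simp
  qed
  ultimately show ?thesis using z by blast
qed

lemma commutator_sq:
  assumes "i \<in> S" "j \<in> S" "i \<noteq> j"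
  shows "f i \<bullet> (f j \<bullet> (f i \<bullet> f j)) = f j \<bullet> (f i \<bullet> (f j \<bullet> f i))"
proof -
  have "f i \<bullet> f j \<bullet> f i \<bullet> f j = f j \<bullet> f i \<bullet> f j \<bullet> f i"
    using commutator_eq[OF assms] commutator_eq[of j i] adjacent_commute[OF assms] assms by simp
  then show ?thesis using assms by (simp add: G.m_assoc)
qed

text \<open>Of the two factors of the commutator, \<open>n i\<close> fixes one and turns the other
  into \<open>f j\<close>. This is what shortens the long words in \<open>YXY_conj\<close> and
  \<open>XYX_conj\<close>.\<close>

lemma n_conj_commutator:
  assumes "i \<in> S" "j \<in> S" "i \<noteq> j"
  shows "n i \<bullet> (f i \<bullet> f j \<bullet> f i \<bullet> f j) \<bullet> n i = n j \<bullet> (e j \<bullet> (f i \<bullet> n j))"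
proof -
  let ?a = "n i \<bullet> f j \<bullet> n i" and ?b = "n j \<bullet> f i \<bullet> n j"
  have "n i \<bullet> (?a \<bullet> ?b) \<bullet> n i = (n i \<bullet> ?a \<bullet> n i) \<bullet> (n i \<bullet> ?b \<bullet> n i)"
    using assms by (simp add: G.m_assoc)
  also have "n i \<bullet> ?b \<bullet> n i = ?b" using n_conj_adjacent[OF assms] .
  also have "n i \<bullet> ?a \<bullet> n i = f j" using assms by (simp add: G.m_assoc)
  also have "f j \<bullet> ?b = n j \<bullet> (e j \<bullet> (f i \<bullet> n j))"
    using assms by (simp add: G.m_assoc f_n_left)
  finally show ?thesis unfolding commutator_eq[OF assms] .
qed

text \<open>By \<open>commutator_eq\<close> the involution \<open>f j f i f j\<close> equals
  \<open>f i ?a ?b\<close>. As \<open>?a\<close> commutes with \<open>f i\<close> and with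
  \<open>?b\<close>, it cancels from the square and leaves \<open>(f i ?b)^2 = 1\<close>.\<close>

lemma f_commute_opposite:
  assumes "i \<in> S" "j \<in> S" "i \<noteq> j"
  shows "f i \<bullet> (n j \<bullet> f i \<bullet> n j) = (n j \<bullet> f i \<bullet> n j) \<bullet> f i"
proof (rule commute_of_comm)
  let ?a = "n i \<bullet> f j \<bullet> n i" and ?b = "n j \<bullet> f i \<bullet> n j"
  have c: "?a \<in> carrier G" "?b \<in> carrier G" "f i \<in> carrier G" "f j \<in> carrier G" using assms by auto
  have sq: "?a \<bullet> ?a = \<one>g" "?b \<bullet> ?b = \<one>g" using assms by (simp_all add: G.m_assoc)
  then have acan: "?a \<bullet> (?a \<bullet> h) = h" if "h \<in> carrier G" for h
    using c(1) that by (metis G.l_one G.m_assoc)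
  have ab: "?a \<bullet> ?b = ?b \<bullet> ?a" using adjacent_commute[OF assms] .
  have fa: "f i \<bullet> ?a = ?a \<bullet> f i" using f_commute_adjacent[OF assms] .
  have "f j \<bullet> f i \<bullet> f j = f i \<bullet> (f i \<bullet> f j \<bullet> f i \<bullet> f j)"
    using assms by (simp add: G.m_assoc)
  also have "\<dots> = f i \<bullet> (?a \<bullet> ?b)" unfolding commutator_eq[OF assms] ..
  finally have y: "f j \<bullet> f i \<bullet> f j = f i \<bullet> (?a \<bullet> ?b)" .
  have "(f j \<bullet> f i \<bullet> f j) \<bullet> (f j \<bullet> f i \<bullet> f j) = \<one>g" using assms by (simp add: G.m_assoc)
  then have 1: "f i \<bullet> (?a \<bullet> ?b) \<bullet> (f i \<bullet> (?a \<bullet> ?b)) = \<one>g" unfolding y .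
  define A where "A = ?a"
  define B where "B = ?b"
  have "f i \<bullet> (A \<bullet> B) \<bullet> (f i \<bullet> (A \<bullet> B)) = f i \<bullet> B \<bullet> (A \<bullet> f i) \<bullet> (A \<bullet> B)"
    using c ab unfolding A_def[symmetric] B_def[symmetric] by (simp add: G.m_assoc)
  also have "\<dots> = f i \<bullet> B \<bullet> (f i \<bullet> A) \<bullet> (A \<bullet> B)" using fa unfolding A_def by simp
  also have "\<dots> = f i \<bullet> B \<bullet> f i \<bullet> B"
    using c acan unfolding A_def[symmetric] B_def[symmetric] by (simp add: G.m_assoc)
  finally show "f i \<bullet> ?b \<bullet> f i \<bullet> ?b = \<one>g" using 1 unfolding A_def B_def by simp
qed (use assms in \<open>simp_all add: G.m_assoc\<close>)

end

section \<open>Ping-pong\<close>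

locale rgd_F2_rst = rgd_F2 W S G x
  for W :: "('w, 'm) monoid_scheme" (structure) and S :: "'w set"
    and G :: "('g, 'n) monoid_scheme" and x :: "'w set \<Rightarrow> 'g" +
  fixes r s t :: 'w
  assumes S_eq: "S = {r, s, t}" and distinct: "r \<noteq> s" "r \<noteq> t" "s \<noteq> t"
begin

lemma rst [simp]: "r \<in> S" "s \<in> S" "t \<in> S" "r \<noteq> s" "r \<noteq> t" "s \<noteq> t" "s \<noteq> r" "t \<noteq> r" "t \<noteq> s"
  using S_eq distinct by auto

text \<open>These are root elements of \<open>- \<alpha>\<^sub>s\<close>, \<open>- \<alpha>\<^sub>t\<close>, \<open>- s \<alpha>\<^sub>r\<close>, \<open>- t \<alpha>\<^sub>r\<close> and \<open>- r \<alpha>\<^sub>t\<close>: in the end \<open>x\<close> is the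
  system with all signs exchanged.\<close>

abbreviation X :: 'g where "X \<equiv> f s"
abbreviation Y :: 'g where "Y \<equiv> f t"
definition a :: 'g where "a = n s \<bullet> f r \<bullet> n s"
definition b1 :: 'g where "b1 = n t \<bullet> f r \<bullet> n t"
definition b2 :: 'g where "b2 = n r \<bullet> f t \<bullet> n r"

lemma ab_closed [simp]: "a \<in> carrier G" "b1 \<in> carrier G" "b2 \<in> carrier G"
  by (simp_all add: a_def b1_def b2_def)

lemma ab_sq [simp]: "a \<bullet> a = \<one>g" "b1 \<bullet> b1 = \<one>g" "b2 \<bullet> b2 = \<one>g"
  by (simp_all add: a_def b1_def b2_def G.m_assoc)

lemma ab_commute: "X \<bullet> a = a \<bullet> X" "Y \<bullet> b1 = b1 \<bullet> Y" "Y \<bullet> b2 = b2 \<bullet> Y" "b1 \<bullet> b2 = b2 \<bullet> b1"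
  unfolding a_def b1_def b2_def
  by (rule f_commute_adjacent f_commute_opposite adjacent_commute; simp)+

abbreviation V :: "'g set" where "V \<equiv> generate G {X, Y}"

lemma V_closed [simp]: "v \<in> V \<Longrightarrow> v \<in> carrier G"
  using G.generate_in_carrier[of "{X, Y}" v] by simp

text \<open>By \<open>commutator_sq\<close> the group is a quotient of the dihedral group of order
  eight. The factor \<open>u\<close> is set apart because \<open>n i f i = e i n i\<close> lets it
  disappear in the Borel subgroup, see \<open>X_coset\<close> and \<open>Y_coset\<close>.\<close>

lemma dihedral_normal_form:
  assumes "i \<in> S" "j \<in> S" "i \<noteq> j" "v \<in> generate G {f i, f j}"
  shows "\<exists>u\<in>{\<one>g, f i}. \<exists>m\<in>{\<one>g, f j, f j \<bullet> f i, f j \<bullet> (f i \<bullet> f j)}. v = u \<bullet> m"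
proof -
  define M where "M = {\<one>g, f j, f j \<bullet> f i, f j \<bullet> (f i \<bullet> f j)}"
  define D where "D = M \<union> (\<lambda>m. f i \<bullet> m) ` M"
  have z: "f j \<bullet> (f i \<bullet> (f j \<bullet> f i)) = f i \<bullet> (f j \<bullet> (f i \<bullet> f j))"
    using commutator_sq[OF assms(1-3)] by simp
  have z': "f j \<bullet> (f i \<bullet> (f j \<bullet> (f i \<bullet> f j))) = f i \<bullet> (f j \<bullet> f i)"
  proof -
    have "f j \<bullet> (f i \<bullet> (f j \<bullet> (f i \<bullet> f j))) = (f j \<bullet> (f i \<bullet> (f j \<bullet> f i))) \<bullet> f j"
      using assms by (simp add: G.m_assoc)
    then show ?thesis unfolding z using assms by (simp add: G.m_assoc)
  qed
  have Dc: "d \<in> carrier G" if "d \<in> D" for d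
    using that assms unfolding D_def M_def by auto
  have Di: "f i \<bullet> d \<in> D" if "d \<in> D" for d
    using that assms unfolding D_def M_def by auto
  have Dj: "f j \<bullet> d \<in> D" if "d \<in> D" for d
    using that assms z z' unfolding D_def M_def by auto
  have gen: "h \<in> carrier G \<and> (\<forall>d\<in>D. h \<bullet> d \<in> D)" if "h \<in> generate G {f i, f j}" for h
    using that
  proof (induction rule: generate.induct)
    case (inv h)
    then have "ginv h = h" using assms by (auto simp: sr_root opp_root)
    then show ?case using inv Di Dj assms by auto
  next
    case (eng h1 h2)
    then show ?case using Dc by (auto simp: G.m_assoc)
  qed (use Dc Di Dj assms in auto)
  have "\<one>g \<in> D" unfolding D_def M_def by simp
  then have "v \<bullet> \<one>g \<in> D" "v \<in> carrier G" using gen[OF assms(4)] by blast+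
  then have "v \<in> D" by simp
  then show ?thesis using assms unfolding D_def M_def[symmetric] by (auto simp: M_def)
qed

lemma V_cases_s:
  assumes "v \<in> V"
  obtains u m where "u \<in> {\<one>g, X}" "m \<in> {\<one>g, Y, Y \<bullet> X, Y \<bullet> (X \<bullet> Y)}" "v = u \<bullet> m"
proof -
  obtain u m where "u \<in> {\<one>g, X}" "m \<in> {\<one>g, Y, Y \<bullet> X, Y \<bullet> (X \<bullet> Y)}" "v = u \<bullet> m"
    using dihedral_normal_form[OF rst(2,3,6) assms] by blast
  then show thesis by (rule that)
qed

lemma V_cases_t:
  assumes "v \<in> V"
  obtains u m where "u \<in> {\<one>g, Y}" "m \<in> {\<one>g, X, X \<bullet> Y, X \<bullet> (Y \<bullet> X)}" "v = u \<bullet> m"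
proof -
  have "v \<in> generate G {Y, X}" using assms by (simp add: insert_commute)
  then obtain u m where "u \<in> {\<one>g, Y}" "m \<in> {\<one>g, X, X \<bullet> Y, X \<bullet> (Y \<bullet> X)}" "v = u \<bullet> m"
    using dihedral_normal_form[OF rst(3,2,9)] by blast
  then show thesis by (rule that)
qed

text \<open>The chambers are cosets \<open>g C \<one>\<close>. The invariants below describe their position relative to the
  \<open>{s, t}\<close>-residue of the fundamental chamber: the Weyl distance to it lies in one of three sets,
  which are unions of cone types. Its projection to that residue is the chamber of \<open>n s\<close>
  (after a syllable \<open>a\<close>), of \<open>n t\<close>, or of \<open>\<one>\<close> or \<open>Y\<close> (after a syllable from \<open>b1\<close>, \<open>b2\<close>).\<close>

definition pA :: "'w \<Rightarrow> bool" where
  "pA w \<longleftrightarrow> w \<in> carrier W \<and> des r w \<and> \<not> des s w \<and> \<not> des t w \<and> \<not> des r (t \<otimes> w)"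

definition pC :: "'w \<Rightarrow> bool" where
  "pC w \<longleftrightarrow> w \<in> carrier W \<and> des r w \<and> \<not> des s w \<and> \<not> des t w \<and> \<not> des r (s \<otimes> w)"

text \<open>In terms of reduced words beginning with \<open>r\<close>: \<open>pA\<close> forbids the
  beginning \<open>r t r\<close>, \<open>pC\<close> forbids \<open>r s r\<close>, and
  \<open>pX\<close> forbids even \<open>r s\<close>.\<close>

definition pX :: "'w \<Rightarrow> bool" where
  "pX w \<longleftrightarrow> pC w \<and> \<not> des s (r \<otimes> w)"

definition stA :: "'g \<Rightarrow> bool" where
  "stA g \<longleftrightarrow> g \<in> carrier G \<and> (\<exists>w. pA w \<and> n s \<bullet> g \<in> C w)"

definition stC :: "'g \<Rightarrow> bool" where
  "stC g \<longleftrightarrow> g \<in> carrier G \<and> (\<exists>w. pC w \<and> n t \<bullet> g \<in> C w)"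

definition stX :: "'g \<Rightarrow> bool" where
  "stX g \<longleftrightarrow> g \<in> carrier G \<and> (\<exists>w. pX w \<and> (g \<in> C w \<or> Y \<bullet> g \<in> C w))"

section \<open>How the syllables act on the double cosets\<close>

lemma up_st:
  assumes "w \<in> carrier W" "\<not> des s w" "\<not> des t w"
  shows "\<not> des t (s \<otimes> w)" "\<not> des s (t \<otimes> w)"
  using not_des_rank2[of t s w] not_des_rank2[of s t w] assms by auto

lemma C_st:
  assumes w: "w \<in> carrier W" "\<not> des s w" "\<not> des t w" and g: "g \<in> C w"
  shows "c1 \<in> C s \<Longrightarrow> c1 \<bullet> g \<in> C (s \<otimes> w)"
    and "c1 \<in> C s \<Longrightarrow> c2 \<in> C t \<Longrightarrow> c2 \<bullet> (c1 \<bullet> g) \<in> C (t \<otimes> (s \<otimes> w))"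
    and "c1 \<in> C s \<Longrightarrow> c2 \<in> C t \<Longrightarrow> c3 \<in> C s \<Longrightarrow> c3 \<bullet> (c2 \<bullet> (c1 \<bullet> g)) \<in> C (s \<otimes> (t \<otimes> (s \<otimes> w)))"
    and "c1 \<in> C s \<Longrightarrow> c2 \<in> C t \<Longrightarrow> c3 \<in> C s \<Longrightarrow> c4 \<in> C t \<Longrightarrow>
      c4 \<bullet> (c3 \<bullet> (c2 \<bullet> (c1 \<bullet> g))) \<in> C (t \<otimes> (s \<otimes> (t \<otimes> (s \<otimes> w))))"
    and "c1 \<in> C t \<Longrightarrow> c1 \<bullet> g \<in> C (t \<otimes> w)"
    and "c1 \<in> C t \<Longrightarrow> c2 \<in> C s \<Longrightarrow> c2 \<bullet> (c1 \<bullet> g) \<in> C (s \<otimes> (t \<otimes> w))"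
    and "c1 \<in> C t \<Longrightarrow> c2 \<in> C s \<Longrightarrow> c3 \<in> C t \<Longrightarrow> c3 \<bullet> (c2 \<bullet> (c1 \<bullet> g)) \<in> C (t \<otimes> (s \<otimes> (t \<otimes> w)))"
    and "c1 \<in> C t \<Longrightarrow> c2 \<in> C s \<Longrightarrow> c3 \<in> C t \<Longrightarrow> c4 \<in> C s \<Longrightarrow>
      c4 \<bullet> (c3 \<bullet> (c2 \<bullet> (c1 \<bullet> g))) \<in> C (s \<otimes> (t \<otimes> (s \<otimes> (t \<otimes> w))))"
  using w g up_st[OF w] by (intro C_mult; simp)+

lemma X_coset: "g \<in> carrier G \<Longrightarrow> n s \<bullet> g \<in> C w \<Longrightarrow> n s \<bullet> (X \<bullet> g) \<in> C w"
  by (simp add: n_f_left C_e)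

lemma Y_coset: "g \<in> carrier G \<Longrightarrow> n t \<bullet> g \<in> C w \<Longrightarrow> n t \<bullet> (Y \<bullet> g) \<in> C w"
  by (simp add: n_f_left C_e)

text \<open>The letters on the left spell \<open>s t s t s\<close>, which is too long to be reduced.
  The commutator relation replaces it by \<open>t s t\<close>.\<close>

lemma YXY_conj:
  assumes "h \<in> carrier G"
  shows "n s \<bullet> (Y \<bullet> (X \<bullet> (Y \<bullet> (n s \<bullet> h)))) = e s \<bullet> (n t \<bullet> (e t \<bullet> (X \<bullet> (n t \<bullet> h))))"
proof -
  have "Y \<bullet> (X \<bullet> (Y \<bullet> (n s \<bullet> h))) = X \<bullet> ((X \<bullet> Y \<bullet> X \<bullet> Y) \<bullet> (n s \<bullet> h))"
    using assms by (simp add: G.m_assoc)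
  then have "n s \<bullet> (Y \<bullet> (X \<bullet> (Y \<bullet> (n s \<bullet> h)))) = e s \<bullet> ((n s \<bullet> (X \<bullet> Y \<bullet> X \<bullet> Y) \<bullet> n s) \<bullet> h)"
    using assms by (simp add: n_f_left G.m_assoc)
  then show ?thesis unfolding n_conj_commutator[OF rst(2,3,6)] using assms by (simp add: G.m_assoc)
qed

lemma XYX_conj:
  assumes "h \<in> carrier G"
  shows "n t \<bullet> (X \<bullet> (Y \<bullet> (X \<bullet> (n t \<bullet> h)))) = e t \<bullet> (n s \<bullet> (e s \<bullet> (Y \<bullet> (n s \<bullet> h))))"
proof -
  have "X \<bullet> (Y \<bullet> (X \<bullet> (n t \<bullet> h))) = Y \<bullet> ((Y \<bullet> X \<bullet> Y \<bullet> X) \<bullet> (n t \<bullet> h))"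
    using assms by (simp add: G.m_assoc)
  then have "n t \<bullet> (X \<bullet> (Y \<bullet> (X \<bullet> (n t \<bullet> h)))) = e t \<bullet> ((n t \<bullet> (Y \<bullet> X \<bullet> Y \<bullet> X) \<bullet> n t) \<bullet> h)"
    using assms by (simp add: n_f_left G.m_assoc)
  then show ?thesis unfolding n_conj_commutator[OF rst(3,2,9)] using assms by (simp add: G.m_assoc)
qed

lemma a_step:
  assumes "h \<in> carrier G" "n s \<bullet> h \<in> C w" "w \<in> carrier W" "\<not> des r w" "pA (r \<otimes> w)"
  shows "stA (a \<bullet> h)"
proof -
  have "n s \<bullet> (a \<bullet> h) = f r \<bullet> (n s \<bullet> h)" using assms by (simp add: a_def G.m_assoc)
  also have "\<dots> \<in> C (r \<otimes> w)" using assms by (intro C_f) auto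
  finally show ?thesis unfolding stA_def using assms by auto
qed

lemma b1_step:
  assumes "h \<in> carrier G" "n t \<bullet> h \<in> C w" "w \<in> carrier W" "\<not> des r w" "pC (r \<otimes> w)"
  shows "stC (b1 \<bullet> h)"
proof -
  have "n t \<bullet> (b1 \<bullet> h) = f r \<bullet> (n t \<bullet> h)" using assms by (simp add: b1_def G.m_assoc)
  also have "\<dots> \<in> C (r \<otimes> w)" using assms by (intro C_f) auto
  finally show ?thesis unfolding stC_def using assms by auto
qed

text \<open>The elements of the group of \<open>b1\<close> and \<open>b2\<close> that involve
  \<open>b2\<close>; only these bring in a full \<open>r t r\<close>.\<close>

definition B2 :: "'g set" where "B2 = {b2, b1 \<bullet> b2}"

lemma B2_closed [simp]: "c \<in> B2 \<Longrightarrow> c \<in> carrier G"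
  by (auto simp: B2_def)

lemma B2_commute: "c \<in> B2 \<Longrightarrow> Y \<bullet> c = c \<bullet> Y"
proof -
  have "Y \<bullet> (b1 \<bullet> b2) = (Y \<bullet> b1) \<bullet> b2" by (simp add: G.m_assoc)
  also have "\<dots> = b1 \<bullet> (Y \<bullet> b2)" unfolding ab_commute(2) by (simp add: G.m_assoc)
  also have "\<dots> = b1 \<bullet> b2 \<bullet> Y" unfolding ab_commute(3) by (simp add: G.m_assoc)
  finally show "c \<in> B2 \<Longrightarrow> Y \<bullet> c = c \<bullet> Y" using ab_commute(3) by (auto simp only: B2_def)
qed

lemma b2_conj: "n t \<bullet> b2 \<bullet> n t = b2"
  unfolding b2_def by (rule n_conj_adjacent) auto

lemma B2_conj_C:
  assumes "c \<in> B2"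
  shows "\<exists>c1\<in>C r. \<exists>c2\<in>C t. \<exists>c3\<in>C r. n t \<bullet> c \<bullet> n t = c1 \<bullet> (c2 \<bullet> c3)"
proof (cases "c = b2")
  case True
  then have "n t \<bullet> c \<bullet> n t = n r \<bullet> (f t \<bullet> n r)" using b2_conj by (simp add: b2_def G.m_assoc)
  then show ?thesis using n_C f_C rst by blast
next
  case False
  then have "n t \<bullet> c \<bullet> n t = (n t \<bullet> b1 \<bullet> n t) \<bullet> (n t \<bullet> b2 \<bullet> n t)"
    using assms by (simp add: B2_def G.m_assoc)
  also have "\<dots> = f r \<bullet> b2" unfolding b2_conj by (simp add: b1_def G.m_assoc)
  also have "\<dots> = n r \<bullet> ((e r \<bullet> f t) \<bullet> n r)" by (simp add: b2_def G.m_assoc f_n_left)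
  finally show ?thesis using n_C[of r] U_C[OF e_U f_C, of r t] rst by blast
qed

text \<open>The element \<open>c n t\<close> lies in the double coset of
  \<open>t r t r = r t r t\<close>, so its \<open>t\<close>-panel contains a chamber at distance
  \<open>r t r\<close>. The other chambers of this panel are those of \<open>c\<close> and
  \<open>c Y\<close>.\<close>

lemma B2_C:
  assumes c: "c \<in> B2"
  shows "c \<in> C (r \<otimes> (t \<otimes> r)) \<or> c \<bullet> Y \<in> C (r \<otimes> (t \<otimes> r))"
proof -
  obtain c1 c2 c3 where c123: "c1 \<in> C r" "c2 \<in> C t" "c3 \<in> C r" "n t \<bullet> c \<bullet> n t = c1 \<bullet> (c2 \<bullet> c3)"
    using B2_conj_C[OF c] by blast
  have "c1 \<bullet> (c2 \<bullet> c3) \<in> C (r \<otimes> (t \<otimes> r))" using c123 by (intro C_mult) auto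
  then have "n t \<bullet> (n t \<bullet> c \<bullet> n t) \<in> C (t \<otimes> (r \<otimes> (t \<otimes> r)))"
    unfolding c123(4) by (intro C_n) auto
  then have "c \<bullet> n t \<in> C ((r \<otimes> (t \<otimes> r)) \<otimes> t)"
    using c braid4[of r t] by (simp add: G.m_assoc m_assoc)
  then obtain d b where db: "d \<in> C (r \<otimes> (t \<otimes> r))" "b \<in> C t" "c \<bullet> n t = d \<bullet> b"
    using C_factor[of "c \<bullet> n t" "r \<otimes> (t \<otimes> r)" t] by auto
  obtain u m u' where um: "u \<in> U" "m \<in> N t" "u' \<in> U" "b = u \<bullet> m \<bullet> u'" using db(2) by (auto elim: CE)
  obtain q where q: "q \<in> U" "n t \<bullet> q \<bullet> n t \<in> U" "u' = q \<or> u' = q \<bullet> e t"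
    using U_split_right[of t u'] um by auto
  have mn: "m \<bullet> n t \<in> N \<one>" using N_mult[OF um(2) N_n[of t]] by simp
  have p: "u \<bullet> (m \<bullet> n t) \<bullet> (n t \<bullet> q \<bullet> n t) \<in> C \<one>" using um mn q by (intro CI)
  have cl: "d \<in> carrier G" "m \<in> carrier G" using db C_closed um N_closed by auto
  have c': "c = d \<bullet> b \<bullet> n t"
    using arg_cong[OF db(3), of "\<lambda>y. y \<bullet> n t"] c by (simp add: G.m_assoc)
  from q(3) show ?thesis
  proof
    assume "u' = q"
    then have "c = d \<bullet> (u \<bullet> (m \<bullet> n t) \<bullet> (n t \<bullet> q \<bullet> n t))"
      using c' um q cl by (simp add: G.m_assoc)
    then show ?thesis using C_C1[OF db(1) p] by simp
  next
    assume "u' = q \<bullet> e t"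
    then have "c \<bullet> Y = d \<bullet> (u \<bullet> m \<bullet> q) \<bullet> (e t \<bullet> (n t \<bullet> Y))"
      using c' um q cl by (simp add: G.m_assoc)
    also have "e t \<bullet> (n t \<bullet> Y) = n t" using n_f[of t] by simp
    finally have "c \<bullet> Y = d \<bullet> (u \<bullet> (m \<bullet> n t) \<bullet> (n t \<bullet> q \<bullet> n t))"
      using um q cl by (simp add: G.m_assoc)
    then show ?thesis using C_C1[OF db(1) p] by simp
  qed
qed

lemma B2_step_C:
  assumes c: "c \<in> B2" and h: "h \<in> carrier G" "n t \<bullet> h \<in> C w" and w: "w \<in> carrier W"
    "\<not> des r w" "\<not> des t (r \<otimes> w)" "\<not> des r (t \<otimes> (r \<otimes> w))" "pC (r \<otimes> (t \<otimes> (r \<otimes> w)))"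
  shows "stC (c \<bullet> h)"
proof -
  obtain c1 c2 c3 where c123: "c1 \<in> C r" "c2 \<in> C t" "c3 \<in> C r" "n t \<bullet> c \<bullet> n t = c1 \<bullet> (c2 \<bullet> c3)"
    using B2_conj_C[OF c] by blast
  have "n t \<bullet> (c \<bullet> h) = (n t \<bullet> c \<bullet> n t) \<bullet> (n t \<bullet> h)" using c h by (simp add: G.m_assoc)
  also have "\<dots> = c1 \<bullet> (c2 \<bullet> (c3 \<bullet> (n t \<bullet> h)))"
    unfolding c123(4) using c123(1-3) C_closed h by (simp add: G.m_assoc)
  also have "\<dots> \<in> C (r \<otimes> (t \<otimes> (r \<otimes> w)))" using c123 h w by (intro C_mult) auto
  finally show ?thesis unfolding stC_def using c h w by auto
qed

text \<open>Since \<open>Y\<close> commutes with \<open>c\<close>, membership of either \<open>h\<close> or \<open>Y h\<close> in the double coset suffices.\<close>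

lemma B2_step_X:
  assumes c: "c \<in> B2" and h: "h \<in> carrier G" "h \<in> C w \<or> Y \<bullet> h \<in> C w"
    and step: "\<And>d h'. d \<in> C (r \<otimes> (t \<otimes> r)) \<Longrightarrow> h' \<in> C w \<Longrightarrow> \<exists>w'. pX w' \<and> d \<bullet> h' \<in> C w'"
  shows "stX (c \<bullet> h)"
proof -
  have eq: "c \<bullet> (Y \<bullet> h) = Y \<bullet> (c \<bullet> h)" "c \<bullet> Y \<bullet> h = Y \<bullet> (c \<bullet> h)" "c \<bullet> Y \<bullet> (Y \<bullet> h) = c \<bullet> h"
  proof -
    show 1: "c \<bullet> Y \<bullet> h = Y \<bullet> (c \<bullet> h)"
      unfolding B2_commute[OF c, symmetric] using c h by (simp add: G.m_assoc)
    then show "c \<bullet> (Y \<bullet> h) = Y \<bullet> (c \<bullet> h)" using c h by (simp add: G.m_assoc)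
    show "c \<bullet> Y \<bullet> (Y \<bullet> h) = c \<bullet> h" using c h by (simp add: G.m_assoc)
  qed
  have "\<exists>w'. pX w' \<and> (c \<bullet> h \<in> C w' \<or> Y \<bullet> (c \<bullet> h) \<in> C w')"
    using B2_C[OF c]
  proof
    assume C: "c \<in> C (r \<otimes> (t \<otimes> r))"
    from h(2) show ?thesis using step[OF C] unfolding eq(1)[symmetric] by blast
  next
    assume C: "c \<bullet> Y \<in> C (r \<otimes> (t \<otimes> r))"
    from h(2) show ?thesis using step[OF C] unfolding eq(2)[symmetric] eq(3)[symmetric]
      by (metis eq(2,3))
  qed
  then show ?thesis unfolding stX_def using c h by simp
qed

lemma rtr_step:
  assumes d: "d \<in> C (r \<otimes> (t \<otimes> r))" "h \<in> C w" and w: "w \<in> carrier W"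
    "\<not> des r w" "\<not> des t (r \<otimes> w)" "\<not> des r (t \<otimes> (r \<otimes> w))" "pX (r \<otimes> (t \<otimes> (r \<otimes> w)))"
  shows "\<exists>w'. pX w' \<and> d \<bullet> h \<in> C w'"
proof -
  obtain d1 d' where 1: "d1 \<in> C r" "d' \<in> C (t \<otimes> r)" "d = d1 \<bullet> d'" using C_factor[OF d(1)] by auto
  obtain d2 d3 where 2: "d2 \<in> C t" "d3 \<in> C r" "d' = d2 \<bullet> d3" using C_factor[OF 1(2)] by auto
  have "d1 \<bullet> (d2 \<bullet> (d3 \<bullet> h)) \<in> C (r \<otimes> (t \<otimes> (r \<otimes> w)))" using 1 2 d w by (intro C_mult) auto
  moreover have "d \<bullet> h = d1 \<bullet> (d2 \<bullet> (d3 \<bullet> h))" using 1 2 d C_closed by (simp add: G.m_assoc)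
  ultimately show ?thesis using w by auto
qed

text \<open>Here \<open>w\<close> begins with \<open>r s r\<close>, so \<open>s w\<close> has both
  descents \<open>r\<close> and \<open>s\<close>, and the factor \<open>d3\<close> may lower the
  distance or keep it. In either case \<open>t\<close> and \<open>r\<close> are ascents afterwards
  by \<open>not_des_triple\<close>, and the result is again of type \<open>pX\<close>.\<close>

lemma rtr_step_weak:
  assumes d: "d \<in> C (r \<otimes> (t \<otimes> r))" "h \<in> C (s \<otimes> w)" and w: "pA w" and des: "des r (s \<otimes> w)"
  shows "\<exists>w'. pX w' \<and> d \<bullet> h \<in> C w'"
proof -
  obtain d1 d' where 1: "d1 \<in> C r" "d' \<in> C (t \<otimes> r)" "d = d1 \<bullet> d'" using C_factor[OF d(1)] by auto
  obtain d2 d3 where 2: "d2 \<in> C t" "d3 \<in> C r" "d' = d2 \<bullet> d3" using C_factor[OF 1(2)] by auto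
  have dh: "d \<bullet> h = d1 \<bullet> (d2 \<bullet> (d3 \<bullet> h))" using 1 2 d C_closed by (simp add: G.m_assoc)
  define v where "v = s \<otimes> w"
  have wW: "w \<in> carrier W" "des r w" "\<not> des s w" "\<not> des t w" using w by (auto simp: pA_def)
  have v: "v \<in> carrier W" "des s v" "des r v" "\<not> des t v"
    using wW des up_st by (auto simp: v_def)
  define m where "m = r \<otimes> v"
  have m: "m \<in> carrier W" "\<not> des r m" "r \<otimes> m = v" using v by (simp_all add: m_def)
  have tm: "\<not> des t m" unfolding m_def using v by (intro not_des_triple[of s r t v]) auto
  have rtv: "\<not> des r (t \<otimes> v)" using v by (intro not_des_triple[of s t r v]) auto
  have rtm: "\<not> des r (t \<otimes> m)" unfolding m_def using v rtv by simp
  have sm: "des s m" unfolding m_def using v by (intro des_rank2) auto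
  have rsm: "des r (s \<otimes> m)" unfolding m_def v_def using wW by simp
  have stm: "\<not> des s (t \<otimes> m)"
  proof -
    have "\<not> des s (t \<otimes> (s \<otimes> m))"
      using rsm m by (intro not_des_triple[of r t s "s \<otimes> m"]) auto
    then show ?thesis using m by simp
  qed
  have "d3 \<bullet> h \<in> C (r \<otimes> v) \<union> C v" using 2 d v by (intro C_mult_cases) (auto simp: v_def)
  then show ?thesis
  proof
    assume "d3 \<bullet> h \<in> C (r \<otimes> v)"
    then have "d1 \<bullet> (d2 \<bullet> (d3 \<bullet> h)) \<in> C (r \<otimes> (t \<otimes> m))"
      using 1 2 m tm rtv rtm unfolding m_def[symmetric] by (intro C_mult) auto
    moreover have "pX (r \<otimes> (t \<otimes> m))"
      unfolding pX_def pC_def using m tm rtm stm v by simp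
    ultimately show ?thesis using dh by auto
  next
    assume "d3 \<bullet> h \<in> C v"
    then have "d1 \<bullet> (d2 \<bullet> (d3 \<bullet> h)) \<in> C (r \<otimes> (t \<otimes> v))"
      using 1 2 v rtv by (intro C_mult) auto
    moreover have "pX (r \<otimes> (t \<otimes> v))"
    proof -
      have "\<not> des s (t \<otimes> v)" unfolding v_def using wW up_st by simp
      moreover have "\<not> des t (r \<otimes> v)" using tm by (simp add: m_def)
      ultimately show ?thesis unfolding pX_def pC_def using v rtv by simp
    qed
    ultimately show ?thesis using dh by auto
  qed
qed

text \<open>As \<open>X\<close> commutes with \<open>a\<close>, two syllables \<open>a\<close> are
  separated only by a \<open>v\<close> outside \<open>{\<one>g, X}\<close>. Such a \<open>v\<close>
  gives the word \<open>s t s\<close>, except that for \<open>m = Y X Y\<close> the shortened word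
  is \<open>t s t\<close>.\<close>

lemma step_A_A:
  assumes g: "stA g" and v: "v \<in> V" "v \<notin> {\<one>g, X}"
  shows "stA (a \<bullet> (v \<bullet> g))"
proof -
  obtain w where w: "g \<in> carrier G" "pA w" "n s \<bullet> g \<in> C w" using g by (auto simp: stA_def)
  define h where "h = n s \<bullet> g"
  have h: "h \<in> carrier G" "h \<in> C w" "g = n s \<bullet> h" using w by (auto simp: h_def)
  have wW: "w \<in> carrier W" "des r w" "\<not> des s w" "\<not> des t w" "\<not> des r (t \<otimes> w)" using w by (auto simp: pA_def)
  note st = up_st[OF wW(1,3,4)] and Cst = C_st[OF wW(1,3,4)]
  obtain u m where um: "u \<in> {\<one>g, X}" "m \<in> {\<one>g, Y, Y \<bullet> X, Y \<bullet> (X \<bullet> Y)}" "v = u \<bullet> m"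
    using v(1) by (rule V_cases_s)
  have m: "m \<in> {Y, Y \<bullet> X, Y \<bullet> (X \<bullet> Y)}" using um v by auto
  have mc: "m \<in> carrier G" using m by auto
  have "n s \<bullet> (m \<bullet> g) \<in> C (s \<otimes> (t \<otimes> (s \<otimes> w))) \<or> n s \<bullet> (m \<bullet> g) \<in> C (t \<otimes> (s \<otimes> (t \<otimes> w)))"
  proof -
    have "n s \<bullet> (Y \<bullet> (n s \<bullet> k)) \<in> C (s \<otimes> (t \<otimes> (s \<otimes> w)))" if "k \<in> C w" for k
      using Cst(3)[OF that n_C f_C n_C] by simp
    moreover have "e s \<bullet> h \<in> C w" using h by (intro C_e) auto
    moreover have "X \<bullet> (n s \<bullet> h) = n s \<bullet> (e s \<bullet> h)" using h by (simp add: f_n_left)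
    moreover have "n s \<bullet> (Y \<bullet> (X \<bullet> (Y \<bullet> (n s \<bullet> h)))) \<in> C (t \<otimes> (s \<otimes> (t \<otimes> w)))"
      unfolding YXY_conj[OF h(1)] using Cst(7)[OF h(2) n_C f_C n_C]
      by (intro C_e) (auto intro!: C_e Cst(7) C_n C_f simp: h wW st)
    ultimately show ?thesis using m h by (auto simp: G.m_assoc)
  qed
  then have "n s \<bullet> (v \<bullet> g) \<in> C (s \<otimes> (t \<otimes> (s \<otimes> w))) \<or> n s \<bullet> (v \<bullet> g) \<in> C (t \<otimes> (s \<otimes> (t \<otimes> w)))"
    using um(1) X_coset[of "m \<bullet> g"] mc w(1) unfolding um(3) by (auto simp: G.m_assoc)
  then show ?thesis
  proof
    assume "n s \<bullet> (v \<bullet> g) \<in> C (s \<otimes> (t \<otimes> (s \<otimes> w)))"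
    then show ?thesis using v w wW st by (intro a_step[of _ "s \<otimes> (t \<otimes> (s \<otimes> w))"]) (auto simp: pA_def)
  next
    assume "n s \<bullet> (v \<bullet> g) \<in> C (t \<otimes> (s \<otimes> (t \<otimes> w)))"
    then show ?thesis using v w wW st by (intro a_step[of _ "t \<otimes> (s \<otimes> (t \<otimes> w))"]) (auto simp: pA_def)
  qed
qed

text \<open>A trailing \<open>Y\<close> is absorbed by \<open>Y n t = n t e t\<close>. What remains
  are the words \<open>s t\<close> and \<open>s t s t\<close>, which are reduced above
  \<open>w\<close>, so every \<open>v\<close> is admissible.\<close>

lemma step_C_A:
  assumes g: "stC g" and v: "v \<in> V"
  shows "stA (a \<bullet> (v \<bullet> g))"
proof -
  obtain w where w: "g \<in> carrier G" "pC w" "n t \<bullet> g \<in> C w" using g by (auto simp: stC_def)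
  define h where "h = n t \<bullet> g"
  have h: "h \<in> carrier G" "h \<in> C w" "g = n t \<bullet> h" using w by (auto simp: h_def)
  have wW: "w \<in> carrier W" "des r w" "\<not> des s w" "\<not> des t w" "\<not> des r (s \<otimes> w)" using w by (auto simp: pC_def)
  note st = up_st[OF wW(1,3,4)] and Cst = C_st[OF wW(1,3,4)]
  obtain u m where um: "u \<in> {\<one>g, X}" "m \<in> {\<one>g, Y, Y \<bullet> X, Y \<bullet> (X \<bullet> Y)}" "v = u \<bullet> m"
    using v(1) by (rule V_cases_s)
  have mc: "m \<in> carrier G" using um by auto
  have eh: "e t \<bullet> h \<in> C w" "Y \<bullet> (n t \<bullet> h) = n t \<bullet> (e t \<bullet> h)" using h by (auto simp: f_n_left intro!: C_e)
  have "n s \<bullet> (m \<bullet> g) \<in> C (s \<otimes> (t \<otimes> w)) \<or> n s \<bullet> (m \<bullet> g) \<in> C (s \<otimes> (t \<otimes> (s \<otimes> (t \<otimes> w))))"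
  proof -
    have "n s \<bullet> (n t \<bullet> k) \<in> C (s \<otimes> (t \<otimes> w))"
      "n s \<bullet> (Y \<bullet> (X \<bullet> (n t \<bullet> k))) \<in> C (s \<otimes> (t \<otimes> (s \<otimes> (t \<otimes> w))))" if "k \<in> C w" for k
      using Cst(6)[OF that n_C n_C] Cst(8)[OF that n_C f_C f_C n_C] by simp_all
    then show ?thesis using um(2) h eh by (auto simp: G.m_assoc)
  qed
  then have "n s \<bullet> (v \<bullet> g) \<in> C (s \<otimes> (t \<otimes> w)) \<or> n s \<bullet> (v \<bullet> g) \<in> C (s \<otimes> (t \<otimes> (s \<otimes> (t \<otimes> w))))"
    using um(1) X_coset[of "m \<bullet> g"] mc w(1) unfolding um(3) by (auto simp: G.m_assoc)
  then show ?thesis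
  proof
    assume "n s \<bullet> (v \<bullet> g) \<in> C (s \<otimes> (t \<otimes> w))"
    then show ?thesis using v w wW st by (intro a_step[of _ "s \<otimes> (t \<otimes> w)"]) (auto simp: pA_def)
  next
    assume "n s \<bullet> (v \<bullet> g) \<in> C (s \<otimes> (t \<otimes> (s \<otimes> (t \<otimes> w))))"
    then show ?thesis using v w wW st by (intro a_step[of _ "s \<otimes> (t \<otimes> (s \<otimes> (t \<otimes> w)))"]) (auto simp: pA_def)
  qed
qed

lemma V_mult: "v \<in> V \<Longrightarrow> w \<in> V \<Longrightarrow> v \<bullet> w \<in> V"
  by (rule generate.eng)

lemma XY_V: "X \<in> V" "Y \<in> V"
  by (auto intro: generate.incl)

lemma stX_cases:
  assumes "stX g"
  obtains y h w where "y \<in> {\<one>g, Y}" "h \<in> carrier G" "g = y \<bullet> h" "pX w" "h \<in> C w"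
proof -
  obtain w where w: "g \<in> carrier G" "pX w" "g \<in> C w \<or> Y \<bullet> g \<in> C w" using assms by (auto simp: stX_def)
  show thesis
  proof (cases "g \<in> C w")
    case True
    then show ?thesis using that[of "\<one>g" g w] w by simp
  next
    case False
    then show ?thesis using that[of Y "Y \<bullet> g" w] w by simp
  qed
qed

lemma step_X_A:
  assumes g: "stX g" and v: "v \<in> V"
  shows "stA (a \<bullet> (v \<bullet> g))"
proof -
  obtain y h w where w: "y \<in> {\<one>g, Y}" "h \<in> carrier G" "g = y \<bullet> h" "pX w" "h \<in> C w" using g by (rule stX_cases)
  have wW: "w \<in> carrier W" "des r w" "\<not> des s w" "\<not> des t w" "\<not> des r (s \<otimes> w)" "\<not> des s (r \<otimes> w)"
    using w by (auto simp: pX_def pC_def)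
  note st = up_st[OF wW(1,3,4)] and Cst = C_st[OF wW(1,3,4) w(5)]
  have vy: "v \<bullet> y \<in> V" using w(1) v XY_V V_mult by (auto intro: generate.one)
  have vg: "v \<bullet> g = (v \<bullet> y) \<bullet> h" using w v by (auto simp: G.m_assoc)
  obtain u m where um: "u \<in> {\<one>g, X}" "m \<in> {\<one>g, Y, Y \<bullet> X, Y \<bullet> (X \<bullet> Y)}" "v \<bullet> y = u \<bullet> m"
    using vy by (rule V_cases_s)
  have mc: "m \<in> carrier G" using um by auto
  let ?L = "{s \<otimes> w, s \<otimes> (t \<otimes> w), s \<otimes> (t \<otimes> (s \<otimes> w)), s \<otimes> (t \<otimes> (s \<otimes> (t \<otimes> w)))}"
  have "\<exists>w'\<in>?L. n s \<bullet> (m \<bullet> h) \<in> C w'"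
    using um(2) Cst(1)[OF n_C] Cst(6)[OF f_C n_C] Cst(3)[OF f_C f_C n_C] Cst(8)[OF f_C f_C f_C n_C] w(2)
    by (auto simp: G.m_assoc)
  then obtain w' where w': "w' \<in> ?L" "n s \<bullet> (m \<bullet> h) \<in> C w'" by blast
  have nvg: "n s \<bullet> (v \<bullet> g) \<in> C w'"
    using um(1) X_coset[of "m \<bullet> h"] w'(2) mc w(2) unfolding vg um(3) by (auto simp: G.m_assoc)
  have "w' \<in> carrier W \<and> \<not> des r w' \<and> pA (r \<otimes> w')" using w'(1) wW st by (auto simp: pA_def)
  then show ?thesis using nvg v w by (intro a_step[of _ w']) auto
qed

text \<open>A trailing \<open>X\<close> is absorbed by \<open>X n s = n s e s\<close>. If
  \<open>r\<close> is a descent of \<open>s w\<close>, a syllable from \<open>B2\<close> need not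
  increase the distance by three, which is why \<open>rtr_step_weak\<close> is called.\<close>

lemma step_A_C:
  assumes g: "stA g" and v: "v \<in> V"
  shows "stC (b1 \<bullet> (v \<bullet> g))" and "c \<in> B2 \<Longrightarrow> stX (c \<bullet> (v \<bullet> g))"
proof -
  obtain w where w: "g \<in> carrier G" "pA w" "n s \<bullet> g \<in> C w" using g by (auto simp: stA_def)
  define h where "h = n s \<bullet> g"
  have h: "h \<in> carrier G" "h \<in> C w" "g = n s \<bullet> h" using w by (auto simp: h_def)
  have wW: "w \<in> carrier W" "des r w" "\<not> des s w" "\<not> des t w" "\<not> des r (t \<otimes> w)" using w by (auto simp: pA_def)
  note st = up_st[OF wW(1,3,4)] and Cst = C_st[OF wW(1,3,4)]
  obtain u m where um: "u \<in> {\<one>g, Y}" "m \<in> {\<one>g, X, X \<bullet> Y, X \<bullet> (Y \<bullet> X)}" "v = u \<bullet> m"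
    using v(1) by (rule V_cases_t)
  have mc: "m \<in> carrier G" using um by auto
  have eh: "e s \<bullet> h \<in> C w" "X \<bullet> (n s \<bullet> h) = n s \<bullet> (e s \<bullet> h)" using h by (auto simp: f_n_left intro!: C_e)
  have mg: "m \<bullet> g \<in> C (s \<otimes> w) \<and> n t \<bullet> (m \<bullet> g) \<in> C (t \<otimes> (s \<otimes> w)) \<or>
    m \<bullet> g \<in> C (s \<otimes> (t \<otimes> (s \<otimes> w))) \<and> n t \<bullet> (m \<bullet> g) \<in> C (t \<otimes> (s \<otimes> (t \<otimes> (s \<otimes> w))))"
  proof -
    have "n s \<bullet> k \<in> C (s \<otimes> w)" "n t \<bullet> (n s \<bullet> k) \<in> C (t \<otimes> (s \<otimes> w))"
      "X \<bullet> (Y \<bullet> (n s \<bullet> k)) \<in> C (s \<otimes> (t \<otimes> (s \<otimes> w)))"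
      "n t \<bullet> (X \<bullet> (Y \<bullet> (n s \<bullet> k))) \<in> C (t \<otimes> (s \<otimes> (t \<otimes> (s \<otimes> w))))" if "k \<in> C w" for k
      using Cst(1)[OF that n_C] Cst(2)[OF that n_C n_C] Cst(3)[OF that n_C f_C f_C]
        Cst(4)[OF that n_C f_C f_C n_C] by simp_all
    then show ?thesis using um(2) h eh by (auto simp: G.m_assoc)
  qed
  have vg: "v \<bullet> g = u \<bullet> (m \<bullet> g)" using um mc w(1) by (auto simp: G.m_assoc)
  have nvg: "n t \<bullet> (v \<bullet> g) \<in> C w'" if "n t \<bullet> (m \<bullet> g) \<in> C w'" for w'
    using um(1) Y_coset[of "m \<bullet> g"] that mc w(1) unfolding vg by auto
  have Yvg: "v \<bullet> g \<in> C w' \<or> Y \<bullet> (v \<bullet> g) \<in> C w'" if "m \<bullet> g \<in> C w'" for w'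
    using um(1) that mc w(1) unfolding vg by auto
  have vgc: "v \<bullet> g \<in> carrier G" using v w by simp
  show "stC (b1 \<bullet> (v \<bullet> g))"
    using mg
  proof (elim disjE conjE)
    assume "n t \<bullet> (m \<bullet> g) \<in> C (t \<otimes> (s \<otimes> w))"
    then show ?thesis using nvg vgc wW st by (intro b1_step[of _ "t \<otimes> (s \<otimes> w)"]) (auto simp: pC_def)
  next
    assume "n t \<bullet> (m \<bullet> g) \<in> C (t \<otimes> (s \<otimes> (t \<otimes> (s \<otimes> w))))"
    then show ?thesis using nvg vgc wW st by (intro b1_step[of _ "t \<otimes> (s \<otimes> (t \<otimes> (s \<otimes> w)))"]) (auto simp: pC_def)
  qed
  show "stX (c \<bullet> (v \<bullet> g))" if c: "c \<in> B2"
    using mg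
  proof (elim disjE conjE)
    assume *: "m \<bullet> g \<in> C (s \<otimes> w)"
    show ?thesis
    proof (rule B2_step_X[OF c vgc Yvg[OF *]])
      fix d h' assume d: "d \<in> C (r \<otimes> (t \<otimes> r))" "h' \<in> C (s \<otimes> w)"
      show "\<exists>w'. pX w' \<and> d \<bullet> h' \<in> C w'"
      proof (cases "des r (s \<otimes> w)")
        case True
        then show ?thesis using rtr_step_weak[OF d w(2)] by blast
      next
        case False
        then show ?thesis using wW st by (intro rtr_step[OF d]) (auto simp: pX_def pC_def)
      qed
    qed
  next
    assume *: "m \<bullet> g \<in> C (s \<otimes> (t \<otimes> (s \<otimes> w)))"
    show ?thesis
    proof (rule B2_step_X[OF c vgc Yvg[OF *]])
      fix d h' assume d: "d \<in> C (r \<otimes> (t \<otimes> r))" "h' \<in> C (s \<otimes> (t \<otimes> (s \<otimes> w)))"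
      show "\<exists>w'. pX w' \<and> d \<bullet> h' \<in> C w'"
        using wW st by (intro rtr_step[OF d]) (auto simp: pX_def pC_def)
    qed
  qed
qed

text \<open>For \<open>m = X Y X\<close> the shortened word locates \<open>n t m g\<close> but not
  \<open>m g\<close> itself. A syllable from \<open>B2\<close> is then evaluated through
  \<open>n t\<close> and leads to \<open>stC\<close>, whence the disjunction.\<close>

lemma step_C_C:
  assumes g: "stC g" and v: "v \<in> V" "v \<notin> {\<one>g, Y}"
  shows "stC (b1 \<bullet> (v \<bullet> g))" and "c \<in> B2 \<Longrightarrow> stC (c \<bullet> (v \<bullet> g)) \<or> stX (c \<bullet> (v \<bullet> g))"
proof -
  obtain w where w: "g \<in> carrier G" "pC w" "n t \<bullet> g \<in> C w" using g by (auto simp: stC_def)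
  define h where "h = n t \<bullet> g"
  have h: "h \<in> carrier G" "h \<in> C w" "g = n t \<bullet> h" using w by (auto simp: h_def)
  have wW: "w \<in> carrier W" "des r w" "\<not> des s w" "\<not> des t w" "\<not> des r (s \<otimes> w)" using w by (auto simp: pC_def)
  note st = up_st[OF wW(1,3,4)] and Cst = C_st[OF wW(1,3,4)]
  obtain u m where um: "u \<in> {\<one>g, Y}" "m \<in> {\<one>g, X, X \<bullet> Y, X \<bullet> (Y \<bullet> X)}" "v = u \<bullet> m"
    using v(1) by (rule V_cases_t)
  have m: "m \<in> {X, X \<bullet> Y, X \<bullet> (Y \<bullet> X)}" using um v by auto
  have mc: "m \<in> carrier G" using m by auto
  have eh: "e t \<bullet> h \<in> C w" "Y \<bullet> (n t \<bullet> h) = n t \<bullet> (e t \<bullet> h)" using h by (auto simp: f_n_left intro!: C_e)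
  have mg: "m \<bullet> g \<in> C (s \<otimes> (t \<otimes> w)) \<and> n t \<bullet> (m \<bullet> g) \<in> C (t \<otimes> (s \<otimes> (t \<otimes> w))) \<or>
    n t \<bullet> (m \<bullet> g) \<in> C (s \<otimes> (t \<otimes> (s \<otimes> w)))"
  proof -
    have "X \<bullet> (n t \<bullet> k) \<in> C (s \<otimes> (t \<otimes> w))"
      "n t \<bullet> (X \<bullet> (n t \<bullet> k)) \<in> C (t \<otimes> (s \<otimes> (t \<otimes> w)))" if "k \<in> C w" for k
      using Cst(6)[OF that n_C f_C] Cst(7)[OF that n_C f_C n_C] by simp_all
    moreover have "n t \<bullet> (X \<bullet> (Y \<bullet> (X \<bullet> (n t \<bullet> h)))) \<in> C (s \<otimes> (t \<otimes> (s \<otimes> w)))"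
      unfolding XYX_conj[OF h(1)]
      by (intro C_e) (auto intro!: C_e C_n C_f simp: h wW st)
    ultimately show ?thesis using m h eh by (auto simp: G.m_assoc)
  qed
  have vg: "v \<bullet> g = u \<bullet> (m \<bullet> g)" using um mc w(1) by (auto simp: G.m_assoc)
  have nvg: "n t \<bullet> (v \<bullet> g) \<in> C w'" if "n t \<bullet> (m \<bullet> g) \<in> C w'" for w'
    using um(1) Y_coset[of "m \<bullet> g"] that mc w(1) unfolding vg by auto
  have Yvg: "v \<bullet> g \<in> C w' \<or> Y \<bullet> (v \<bullet> g) \<in> C w'" if "m \<bullet> g \<in> C w'" for w'
    using um(1) that mc w(1) unfolding vg by auto
  have vgc: "v \<bullet> g \<in> carrier G" using v w by simp
  show "stC (b1 \<bullet> (v \<bullet> g))"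
    using mg
  proof (elim disjE conjE)
    assume "n t \<bullet> (m \<bullet> g) \<in> C (t \<otimes> (s \<otimes> (t \<otimes> w)))"
    then show ?thesis using nvg vgc wW st by (intro b1_step[of _ "t \<otimes> (s \<otimes> (t \<otimes> w))"]) (auto simp: pC_def)
  next
    assume "n t \<bullet> (m \<bullet> g) \<in> C (s \<otimes> (t \<otimes> (s \<otimes> w)))"
    then show ?thesis using nvg vgc wW st by (intro b1_step[of _ "s \<otimes> (t \<otimes> (s \<otimes> w))"]) (auto simp: pC_def)
  qed
  show "stC (c \<bullet> (v \<bullet> g)) \<or> stX (c \<bullet> (v \<bullet> g))" if c: "c \<in> B2"
    using mg
  proof (elim disjE conjE)
    assume *: "m \<bullet> g \<in> C (s \<otimes> (t \<otimes> w))"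
    have "stX (c \<bullet> (v \<bullet> g))"
    proof (rule B2_step_X[OF c vgc Yvg[OF *]])
      fix d h' assume d: "d \<in> C (r \<otimes> (t \<otimes> r))" "h' \<in> C (s \<otimes> (t \<otimes> w))"
      show "\<exists>w'. pX w' \<and> d \<bullet> h' \<in> C w'"
        using wW st by (intro rtr_step[OF d]) (auto simp: pX_def pC_def)
    qed
    then show ?thesis ..
  next
    assume "n t \<bullet> (m \<bullet> g) \<in> C (s \<otimes> (t \<otimes> (s \<otimes> w)))"
    then have "stC (c \<bullet> (v \<bullet> g))"
      using nvg wW st by (intro B2_step_C[OF c vgc, of "s \<otimes> (t \<otimes> (s \<otimes> w))"]) (auto simp: pC_def)
    then show ?thesis ..
  qed
qed

text \<open>The ambiguity \<open>y\<close> of the projection is moved into \<open>v\<close>, which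
  keeps it outside \<open>{\<one>g, Y}\<close>. So \<open>m\<close> begins with \<open>X\<close>,
  and \<open>n t\<close> can be added on the left of a reduced word.\<close>

lemma step_X_C:
  assumes g: "stX g" and v: "v \<in> V" "v \<notin> {\<one>g, Y}"
  shows "stC (b1 \<bullet> (v \<bullet> g))" and "c \<in> B2 \<Longrightarrow> stX (c \<bullet> (v \<bullet> g))"
proof -
  obtain y h w where w: "y \<in> {\<one>g, Y}" "h \<in> carrier G" "g = y \<bullet> h" "pX w" "h \<in> C w" using g by (rule stX_cases)
  have wW: "w \<in> carrier W" "des r w" "\<not> des s w" "\<not> des t w" "\<not> des r (s \<otimes> w)" "\<not> des s (r \<otimes> w)"
    using w by (auto simp: pX_def pC_def)
  note st = up_st[OF wW(1,3,4)] and Cst = C_st[OF wW(1,3,4) w(5)]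
  have yc: "y \<in> carrier G" "y \<bullet> y = \<one>g" using w(1) by auto
  have vy: "v \<bullet> y \<in> V" using w(1) v XY_V V_mult by (auto intro: generate.one)
  have vy': "v \<bullet> y \<notin> {\<one>g, Y}"
  proof
    assume "v \<bullet> y \<in> {\<one>g, Y}"
    then have "v \<bullet> y \<bullet> y \<in> {\<one>g, Y}" using w(1) by auto
    then show False using v yc by (simp add: G.m_assoc)
  qed
  have vg: "v \<bullet> g = (v \<bullet> y) \<bullet> h" using w v yc by (simp add: G.m_assoc)
  obtain u m where um: "u \<in> {\<one>g, Y}" "m \<in> {\<one>g, X, X \<bullet> Y, X \<bullet> (Y \<bullet> X)}" "v \<bullet> y = u \<bullet> m"
    using vy by (rule V_cases_t)
  have m: "m \<in> {X, X \<bullet> Y, X \<bullet> (Y \<bullet> X)}" using um vy' by auto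
  have mc: "m \<in> carrier G" using m by auto
  let ?L = "{s \<otimes> w, s \<otimes> (t \<otimes> w), s \<otimes> (t \<otimes> (s \<otimes> w))}"
  have "\<exists>w'\<in>?L. m \<bullet> h \<in> C w' \<and> n t \<bullet> (m \<bullet> h) \<in> C (t \<otimes> w')"
    using m Cst(1)[OF f_C] Cst(6)[OF f_C f_C] Cst(3)[OF f_C f_C f_C]
      Cst(2)[OF f_C n_C] Cst(7)[OF f_C f_C n_C] Cst(4)[OF f_C f_C f_C n_C] w(2)
    by (auto simp: G.m_assoc)
  then obtain w' where w': "w' \<in> ?L" "m \<bullet> h \<in> C w'" "n t \<bullet> (m \<bullet> h) \<in> C (t \<otimes> w')" by blast
  have vg': "v \<bullet> g = u \<bullet> (m \<bullet> h)" using um mc w(2) unfolding vg by (auto simp: G.m_assoc)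
  have nvg: "n t \<bullet> (v \<bullet> g) \<in> C (t \<otimes> w')"
    using um(1) Y_coset[of "m \<bullet> h"] w' mc w(2) unfolding vg' by auto
  have Yvg: "v \<bullet> g \<in> C w' \<or> Y \<bullet> (v \<bullet> g) \<in> C w'"
    using um(1) w' mc w(2) unfolding vg' by auto
  have vgc: "v \<bullet> g \<in> carrier G" using v w yc by simp
  have "t \<otimes> w' \<in> carrier W \<and> \<not> des r (t \<otimes> w') \<and> pC (r \<otimes> (t \<otimes> w'))"
    using w'(1) wW st by (auto simp: pC_def)
  then show "stC (b1 \<bullet> (v \<bullet> g))" using nvg vgc by (intro b1_step[of _ "t \<otimes> w'"]) auto
  have p: "w' \<in> carrier W \<and> \<not> des r w' \<and> \<not> des t (r \<otimes> w') \<and> \<not> des r (t \<otimes> (r \<otimes> w')) \<and>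
      pX (r \<otimes> (t \<otimes> (r \<otimes> w')))"
    using w'(1) wW st by (auto simp: pX_def pC_def)
  show "stX (c \<bullet> (v \<bullet> g))" if c: "c \<in> B2"
  proof (rule B2_step_X[OF c vgc Yvg])
    fix d h' assume d: "d \<in> C (r \<otimes> (t \<otimes> r))" "h' \<in> C w'"
    then show "\<exists>w'. pX w' \<and> d \<bullet> h' \<in> C w'"
      using p by (intro rtr_step[OF d]) auto
  qed
qed

text \<open>The chamber opposite to the fundamental one in its \<open>{s, t}\<close>-residue is fixed by \<open>V\<close>.\<close>

definition w0 :: 'w where "w0 = s \<otimes> (t \<otimes> (s \<otimes> t))"
definition d0 :: 'g where "d0 = n s \<bullet> (n t \<bullet> (n s \<bullet> n t))"

lemma w0_closed [simp]: "w0 \<in> carrier W" and d0_closed [simp]: "d0 \<in> carrier G"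
  by (simp_all add: w0_def d0_def)

lemma d0_N: "d0 \<in> N w0"
  unfolding w0_def d0_def by (intro N_mult N_n) auto

lemma w0_alt: "w0 = t \<otimes> (s \<otimes> (t \<otimes> s))"
  unfolding w0_def by (rule braid4) auto

text \<open>Both \<open>s\<close> and \<open>t\<close> are descents of \<open>w0\<close>, so
  conjugation by the inverse of \<open>d0\<close> turns \<open>X\<close> and \<open>Y\<close> into
  elements of positive roots.\<close>

lemma V_d0:
  assumes "v \<in> V"
  shows "\<exists>u\<in>U. v \<bullet> d0 = d0 \<bullet> u"
proof -
  have "ginv d0 \<bullet> v \<bullet> ginv (ginv d0) \<in> U"
  proof (rule G.conj_generate[OF _ _ U_subgroup _ assms])
    fix g assume "g \<in> {X, Y}"
    then obtain i where i: "i \<in> {s, t}" "g = f i" by blast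
    have des: "des i w0"
    proof (cases "i = s")
      case True
      then show ?thesis by (simp add: w0_def)
    next
      case False
      then show ?thesis using i by (simp add: w0_alt)
    qed
    have "ginv d0 \<bullet> x (opp W (sr i)) \<bullet> ginv (ginv d0) = x (inv w0 \<cdot> opp W (sr i))"
      using i by (intro N_conj N_inv d0_N) (auto simp: opp_root sr_root)
    moreover have "inv w0 \<cdot> opp W (sr i) \<in> prts"
      using i des by (auto simp: pos_roots_def act_root opp_root sr_root in_act_iff root_int_opp in_sr)
    ultimately show "ginv d0 \<bullet> g \<bullet> ginv (ginv d0) \<in> U" using i gen_incl by simp
  qed auto
  moreover have "v \<bullet> d0 = d0 \<bullet> (ginv d0 \<bullet> v \<bullet> ginv (ginv d0))"
    using assms by (simp add: G.m_assoc)
  ultimately show ?thesis by blast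
qed

lemma V_d0_C:
  assumes "v \<in> V"
  shows "v \<bullet> d0 \<in> C w0" "n s \<bullet> (v \<bullet> d0) \<in> C (t \<otimes> (s \<otimes> t))" "n t \<bullet> (v \<bullet> d0) \<in> C (s \<otimes> (t \<otimes> s))"
proof -
  obtain u where u: "u \<in> U" "v \<bullet> d0 = d0 \<bullet> u" using V_d0[OF assms] by blast
  show "v \<bullet> d0 \<in> C w0" unfolding u(2) using u(1) d0_N by (intro C_U N_C)
  have "n s \<bullet> d0 \<in> N (s \<otimes> w0)" "n t \<bullet> d0 \<in> N (t \<otimes> w0)" using d0_N by (auto intro!: N_mult N_n)
  then have "n s \<bullet> d0 \<in> C (t \<otimes> (s \<otimes> t))" "n t \<bullet> d0 \<in> C (s \<otimes> (t \<otimes> s))"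
    using N_C by (auto simp: w0_def) (auto simp: w0_alt simp flip: w0_def)
  then have "n s \<bullet> d0 \<bullet> u \<in> C (t \<otimes> (s \<otimes> t))" "n t \<bullet> d0 \<bullet> u \<in> C (s \<otimes> (t \<otimes> s))"
    using u C_U by auto
  then show "n s \<bullet> (v \<bullet> d0) \<in> C (t \<otimes> (s \<otimes> t))" "n t \<bullet> (v \<bullet> d0) \<in> C (s \<otimes> (t \<otimes> s))"
    using u by (simp_all add: G.m_assoc)
qed

lemma not_des_short: "\<not> des r (t \<otimes> (s \<otimes> t))" "\<not> des r (s \<otimes> (t \<otimes> s))" "\<not> des r w0"
  unfolding w0_def by simp_all

lemma base_A: "v \<in> V \<Longrightarrow> stA (a \<bullet> (v \<bullet> d0))"
  using V_d0_C(2) by (intro a_step[of _ "t \<otimes> (s \<otimes> t)"]) (auto simp: pA_def)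

lemma base_C: "v \<in> V \<Longrightarrow> stC (b1 \<bullet> (v \<bullet> d0))" "v \<in> V \<Longrightarrow> c \<in> B2 \<Longrightarrow> stC (c \<bullet> (v \<bullet> d0))"
  using V_d0_C(3)
  by (auto intro!: b1_step[of _ "s \<otimes> (t \<otimes> s)"] B2_step_C[of _ _ "s \<otimes> (t \<otimes> s)"] simp: pC_def)

text \<open>The labels attached to \<open>v d0\<close> are words in \<open>s\<close> and
  \<open>t\<close> without left descent \<open>r\<close>, whereas each of the three states demands
  such a descent.\<close>

lemma st_neq:
  assumes "stA g \<or> stC g \<or> stX g" "v \<in> V"
  shows "g \<noteq> v \<bullet> d0"
proof
  assume g: "g = v \<bullet> d0"
  have no: False if "des r w" "w \<in> carrier W" "h \<in> C w" "h \<in> C w'" "w' \<in> carrier W" "\<not> des r w'" for w w' h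
    using C_disjoint[OF that(2,5,3,4)] that by blast
  note c = V_d0_C[OF assms(2)]
  have Y: "Y \<bullet> (v \<bullet> d0) \<in> C w0"
    using V_d0_C(1)[OF V_mult[OF XY_V(2) assms(2)]] assms(2) by (simp add: G.m_assoc)
  consider "stA g" | "stC g" | "stX g" using assms(1) by blast
  then show False
  proof cases
    case 1
    then obtain w where "des r w" "w \<in> carrier W" "n s \<bullet> g \<in> C w" by (auto simp: stA_def pA_def)
    then show False using no[OF _ _ _ c(2)] not_des_short(1) unfolding g by simp
  next
    case 2
    then obtain w where "des r w" "w \<in> carrier W" "n t \<bullet> g \<in> C w" by (auto simp: stC_def pC_def)
    then show False using no[OF _ _ _ c(3)] not_des_short(2) unfolding g by simp
  next
    case 3
    then obtain w where "des r w" "w \<in> carrier W" "g \<in> C w \<or> Y \<bullet> g \<in> C w"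
      by (auto simp: stX_def pX_def pC_def)
    then show False using no[OF _ _ _ c(1)] no[OF _ _ _ Y] not_des_short(3) unfolding g by auto
  qed
qed

end

section \<open>Normal forms in the tree product\<close>

text \<open>\<open>P\<close> and \<open>Q\<close> are bounded from above only, so membership of
  syllables in them is carried along as a premise. \<open>generated\<close> expresses generation by
  the three images in the form of a stability criterion, which suits an induction on syllables from
  the left.\<close>

locale amalgam = rgd_F2_rst W S G x r s t + T: group T
  for W :: "('w, 'm) monoid_scheme" (structure) and S :: "'w set"
    and G :: "('g, 'n) monoid_scheme" and x :: "'w set \<Rightarrow> 'g" and r s t :: 'w
    and T :: "('c, 'k) monoid_scheme" +
  fixes \<alpha> \<beta> \<gamma> :: "'g \<Rightarrow> 'c" and \<phi> :: "'c \<Rightarrow> 'g" and P Q :: "'g set"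
  assumes P: "subgroup P G" "X \<in> P" "\<And>p. p \<in> P \<Longrightarrow> p \<in> {\<one>g, X, a, X \<bullet> a}"
    and Q: "subgroup Q G" "Y \<in> Q" "\<And>q. q \<in> Q \<Longrightarrow> \<exists>y\<in>{\<one>g, Y}. \<exists>c\<in>{\<one>g, b1, b2, b1 \<bullet> b2}. q = y \<bullet> c"
    and homs: "\<alpha> \<in> hom (restr G P) T" "\<beta> \<in> hom (restr G V) T" "\<gamma> \<in> hom (restr G Q) T"
    and edges: "\<alpha> X = \<beta> X" "\<beta> Y = \<gamma> Y"
    and \<phi>: "\<phi> \<in> hom T G" "\<And>p. p \<in> P \<Longrightarrow> \<phi> (\<alpha> p) = p" "\<And>v. v \<in> V \<Longrightarrow> \<phi> (\<beta> v) = v"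
      "\<And>q. q \<in> Q \<Longrightarrow> \<phi> (\<gamma> q) = q"
    and generated: "\<And>D. \<lbrakk>\<one>\<^bsub>T\<^esub> \<in> D; \<And>p d. p \<in> P \<Longrightarrow> d \<in> D \<Longrightarrow> \<alpha> p \<otimes>\<^bsub>T\<^esub> d \<in> D;
      \<And>v d. v \<in> V \<Longrightarrow> d \<in> D \<Longrightarrow> \<beta> v \<otimes>\<^bsub>T\<^esub> d \<in> D; \<And>q d. q \<in> Q \<Longrightarrow> d \<in> D \<Longrightarrow> \<gamma> q \<otimes>\<^bsub>T\<^esub> d \<in> D\<rbrakk>
      \<Longrightarrow> carrier T \<subseteq> D"
begin

abbreviation tmult :: "'c \<Rightarrow> 'c \<Rightarrow> 'c" (infixl "\<star>" 70) where "u \<star> v \<equiv> u \<otimes>\<^bsub>T\<^esub> v"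

lemma closed [simp]:
  "p \<in> P \<Longrightarrow> \<alpha> p \<in> carrier T" "v \<in> V \<Longrightarrow> \<beta> v \<in> carrier T" "q \<in> Q \<Longrightarrow> \<gamma> q \<in> carrier T"
  using homs by (auto simp: hom_def)

lemma mult:
  "p \<in> P \<Longrightarrow> p' \<in> P \<Longrightarrow> \<alpha> (p \<bullet> p') = \<alpha> p \<star> \<alpha> p'"
  "v \<in> V \<Longrightarrow> v' \<in> V \<Longrightarrow> \<beta> (v \<bullet> v') = \<beta> v \<star> \<beta> v'"
  "q \<in> Q \<Longrightarrow> q' \<in> Q \<Longrightarrow> \<gamma> (q \<bullet> q') = \<gamma> q \<star> \<gamma> q'"
  using homs by (auto simp: hom_def)

lemma subgroup_V: "subgroup V G"
  by (intro G.generate_is_subgroup) simp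

lemma ones: "\<alpha> \<one>g = \<one>\<^bsub>T\<^esub>" "\<beta> \<one>g = \<one>\<^bsub>T\<^esub>" "\<gamma> \<one>g = \<one>\<^bsub>T\<^esub>"
  using hom_one[OF homs(1) G.subgroup_imp_group[OF P(1)] T.group_axioms]
    hom_one[OF homs(2) G.subgroup_imp_group[OF subgroup_V] T.group_axioms]
    hom_one[OF homs(3) G.subgroup_imp_group[OF Q(1)] T.group_axioms] by simp_all

text \<open>Together with \<open>\<one>g\<close> these contain representatives for the cosets of
  \<open>{\<one>g, Y}\<close> in \<open>Q\<close>. They form a set closed under products up to
  \<open>\<one>g\<close>, so merging two of them yields again one syllable or none.\<close>

definition E :: "'g set" where "E = {b1, b2, b1 \<bullet> b2}"

lemma E_mult:
  assumes "c \<in> E" "c' \<in> E"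
  shows "c \<bullet> c' = \<one>g \<or> c \<bullet> c' \<in> E"
proof -
  have "E \<subseteq> generate G {b1, b2}"
    unfolding E_def by (auto intro: generate.incl generate.eng)
  then have "c \<bullet> c' \<in> generate G {b1, b2}" using assms by (blast intro: generate.eng)
  then have "c \<bullet> c' \<in> {\<one>g, b1, b2, b1 \<bullet> b2}"
    using ab_commute(4) by (intro G.generate_commuting_involutions) auto
  then show ?thesis unfolding E_def by blast
qed

text \<open>\<open>nf True\<close> and \<open>nf False\<close> are the reduced products whose first syllable is \<open>a\<close> and an element of
  \<open>E\<close>, respectively.\<close>

inductive nf :: "bool \<Rightarrow> 'c \<Rightarrow> bool" where
  A0: "v \<in> V \<Longrightarrow> a \<in> P \<Longrightarrow> nf True (\<alpha> a \<star> \<beta> v)"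
| C0: "v \<in> V \<Longrightarrow> c \<in> E \<Longrightarrow> c \<in> Q \<Longrightarrow> nf False (\<gamma> c \<star> \<beta> v)"
| A1: "nf k q \<Longrightarrow> v \<in> V \<Longrightarrow> (k \<Longrightarrow> v \<notin> {\<one>g, X}) \<Longrightarrow> a \<in> P \<Longrightarrow> nf True (\<alpha> a \<star> (\<beta> v \<star> q))"
| C1: "nf k q \<Longrightarrow> v \<in> V \<Longrightarrow> (\<not> k \<Longrightarrow> v \<notin> {\<one>g, Y}) \<Longrightarrow> c \<in> E \<Longrightarrow> c \<in> Q \<Longrightarrow>
    nf False (\<gamma> c \<star> (\<beta> v \<star> q))"

lemma nf_closed: "nf k q \<Longrightarrow> q \<in> carrier T"
  by (induction rule: nf.induct) auto

lemma \<phi>_mult: "u \<in> carrier T \<Longrightarrow> v \<in> carrier T \<Longrightarrow> \<phi> (u \<star> v) = \<phi> u \<bullet> \<phi> v"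
  using \<phi>(1) by (auto simp: hom_def)

lemma \<phi>_closed: "u \<in> carrier T \<Longrightarrow> \<phi> u \<in> carrier G"
  using \<phi>(1) by (auto simp: hom_def)

lemma nf_state:
  "nf k q \<Longrightarrow> (k \<longrightarrow> stA (\<phi> q \<bullet> d0)) \<and> (\<not> k \<longrightarrow> stC (\<phi> q \<bullet> d0) \<or> stX (\<phi> q \<bullet> d0))"
proof (induction rule: nf.induct)
  case (A0 v)
  then show ?case using base_A[of v] by (simp add: \<phi>_mult \<phi> G.m_assoc)
next
  case (C0 v c)
  then show ?case using base_C(1)[of v] base_C(2)[of v c]
    by (auto simp: \<phi>_mult \<phi> G.m_assoc E_def B2_def)
next
  case (A1 k q v)
  then have cl: "q \<in> carrier T" "\<phi> q \<in> carrier G" "\<phi> q \<bullet> d0 \<in> carrier G" using nf_closed \<phi>_closed by auto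
  have eq: "\<phi> (\<alpha> a \<star> (\<beta> v \<star> q)) \<bullet> d0 = a \<bullet> (v \<bullet> (\<phi> q \<bullet> d0))"
    using A1.hyps cl by (simp add: \<phi>_mult \<phi> G.m_assoc)
  show ?case unfolding eq
    using A1 step_A_A[of "\<phi> q \<bullet> d0" v] step_C_A[of "\<phi> q \<bullet> d0" v] step_X_A[of "\<phi> q \<bullet> d0" v] by auto
next
  case (C1 k q v c)
  then have cl: "q \<in> carrier T" "\<phi> q \<in> carrier G" "\<phi> q \<bullet> d0 \<in> carrier G" using nf_closed \<phi>_closed by auto
  have cc: "c \<in> carrier G" using C1.hyps by (auto simp: E_def)
  have eq: "\<phi> (\<gamma> c \<star> (\<beta> v \<star> q)) \<bullet> d0 = c \<bullet> (v \<bullet> (\<phi> q \<bullet> d0))"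
    using C1.hyps cl cc by (simp add: \<phi>_mult \<phi> G.m_assoc)
  consider "c = b1" | "c \<in> B2" using C1.hyps by (auto simp: E_def B2_def)
  then have "stC (c \<bullet> (v \<bullet> (\<phi> q \<bullet> d0))) \<or> stX (c \<bullet> (v \<bullet> (\<phi> q \<bullet> d0)))"
  proof cases
    case 1
    then show ?thesis
      using C1 step_A_C(1)[of "\<phi> q \<bullet> d0" v] step_C_C(1)[of "\<phi> q \<bullet> d0" v] step_X_C(1)[of "\<phi> q \<bullet> d0" v]
      by (cases k) auto
  next
    case 2
    then show ?thesis
      using C1 step_A_C(2)[of "\<phi> q \<bullet> d0" v c] step_C_C(2)[of "\<phi> q \<bullet> d0" v c] step_X_C(2)[of "\<phi> q \<bullet> d0" v c]
      by (cases k) auto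
  qed
  then show ?case unfolding eq by simp
qed

text \<open>The reduced products preceded by an arbitrary syllable from \<open>V\<close>. That every
  element has this form is shown by stability under left multiplication.\<close>

definition D :: "'c set" where
  "D = \<beta> ` V \<union> {\<beta> v \<star> q | v q k. v \<in> V \<and> nf k q}"

lemma D_nf: "nf k q \<Longrightarrow> q \<in> D"
proof -
  assume "nf k q"
  moreover from this have "q = \<beta> \<one>g \<star> q" using nf_closed by (simp add: ones)
  moreover have "\<one>g \<in> V" by (rule generate.one)
  ultimately show ?thesis unfolding D_def by blast
qed

lemma D_\<beta>: "v \<in> V \<Longrightarrow> d \<in> D \<Longrightarrow> \<beta> v \<star> d \<in> D"
proof -
  assume v: "v \<in> V" and "d \<in> D"
  then consider v' where "v' \<in> V" "d = \<beta> v'" | v' q k where "v' \<in> V" "nf k q" "d = \<beta> v' \<star> q"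
    unfolding D_def by blast
  then show ?thesis
  proof cases
    case 1
    then have "\<beta> v \<star> d = \<beta> (v \<bullet> v')" using v by (simp add: mult)
    then show ?thesis using 1 v V_mult unfolding D_def by blast
  next
    case 2
    then have "\<beta> v \<star> d = \<beta> (v \<bullet> v') \<star> q" using v nf_closed by (simp add: mult T.m_assoc)
    then show ?thesis using 2 v V_mult unfolding D_def by blast
  qed
qed

lemma D_closed: "d \<in> D \<Longrightarrow> d \<in> carrier T"
  unfolding D_def using nf_closed by auto

text \<open>The only conflict is \<open>v \<in> {\<one>g, X}\<close> followed by a syllable
  \<open>a\<close>. Then \<open>a\<close> moves across \<open>v\<close> and cancels with that
  syllable, being an involution.\<close>

lemma D_a:
  assumes aP: "a \<in> P" and d: "d \<in> D"
  shows "\<alpha> a \<star> d \<in> D"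
proof -
  consider v where "v \<in> V" "d = \<beta> v" | v q k where "v \<in> V" "nf k q" "d = \<beta> v \<star> q"
    using d unfolding D_def by blast
  then show ?thesis
  proof cases
    case 1
    then show ?thesis using D_nf nf.A0 aP by blast
  next
    case 2
    show ?thesis
    proof (cases "k \<and> v \<in> {\<one>g, X}")
      case False
      then have "nf True (\<alpha> a \<star> (\<beta> v \<star> q))" using 2 aP False by (intro nf.A1[of k]) auto
      then show ?thesis using D_nf 2 by blast
    next
      case True
      have comm: "\<alpha> a \<star> \<beta> v = \<beta> v \<star> \<alpha> a"
      proof (cases "v = X")
        case True
        have "\<alpha> a \<star> \<alpha> X = \<alpha> (a \<bullet> X)" using aP P(2) by (simp add: mult)
        also have "\<dots> = \<alpha> X \<star> \<alpha> a" using aP P(2) by (simp add: mult flip: ab_commute(1))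
        finally show ?thesis using True edges by simp
      next
        case False
        then show ?thesis using \<open>k \<and> v \<in> {\<one>g, X}\<close> aP by (simp add: ones)
      qed
      have aa: "\<alpha> a \<star> \<alpha> a = \<one>\<^bsub>T\<^esub>" using mult(1)[OF aP aP] by (simp add: ones)
      obtain z where z: "z \<in> D" "q = \<alpha> a \<star> z"
        using 2(2) True
      proof (cases rule: nf.cases)
        case (A0 v)
        then show ?thesis using that[of "\<beta> v"] unfolding D_def by blast
      next
        case (A1 k q v)
        then show ?thesis using that[of "\<beta> v \<star> q"] unfolding D_def by blast
      qed auto
      have zc: "z \<in> carrier T" using z D_closed by blast
      have "\<alpha> a \<star> d = (\<alpha> a \<star> \<beta> v) \<star> (\<alpha> a \<star> z)" using 2 z zc aP by (simp add: T.m_assoc)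
      also have "\<dots> = \<beta> v \<star> ((\<alpha> a \<star> \<alpha> a) \<star> z)" unfolding comm using 2 zc aP by (simp add: T.m_assoc)
      also have "\<dots> = \<beta> v \<star> z" unfolding aa using zc by simp
      finally show ?thesis using D_\<beta> 2 z by simp
    qed
  qed
qed

text \<open>The conditions on the remaining syllables do not involve the first one. So it may be
  exchanged within \<open>E\<close>, as happens when two syllables merge in
  \<open>D_c\<close>.\<close>

lemma nf_False_syllable:
  assumes "nf False q"
  obtains c z where "c \<in> E" "c \<in> Q" "z \<in> D" "q = \<gamma> c \<star> z" "\<And>c'. c' \<in> E \<Longrightarrow> c' \<in> Q \<Longrightarrow> nf False (\<gamma> c' \<star> z)"
  using assms
proof (cases rule: nf.cases)
  case (C0 v c)
  then show ?thesis using that[of c "\<beta> v"] nf.C0 unfolding D_def by blast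
next
  case (C1 k q' v c)
  have "\<beta> v \<star> q' \<in> D" using C1 unfolding D_def by blast
  moreover have "nf False (\<gamma> c' \<star> (\<beta> v \<star> q'))" if "c' \<in> E" "c' \<in> Q" for c'
    using C1(2-5) that by (intro nf.C1[of k]) auto
  ultimately show ?thesis using that C1 by blast
qed simp_all

lemma D_c:
  assumes c: "c \<in> E" "c \<in> Q" and d: "d \<in> D"
  shows "\<gamma> c \<star> d \<in> D"
proof -
  consider v where "v \<in> V" "d = \<beta> v" | v q k where "v \<in> V" "nf k q" "d = \<beta> v \<star> q"
    using d unfolding D_def by blast
  then show ?thesis
  proof cases
    case 1
    then show ?thesis using D_nf nf.C0 c by blast
  next
    case 2
    show ?thesis
    proof (cases "\<not> k \<and> v \<in> {\<one>g, Y}")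
      case False
      then have "nf False (\<gamma> c \<star> (\<beta> v \<star> q))" using 2 c False by (intro nf.C1[of k]) auto
      then show ?thesis using D_nf 2 by blast
    next
      case True
      have Yc: "Y \<bullet> c = c \<bullet> Y" using c(1) ab_commute(2) B2_commute by (auto simp: E_def B2_def)
      have comm: "\<gamma> c \<star> \<beta> v = \<beta> v \<star> \<gamma> c"
      proof (cases "v = Y")
        case True
        have "\<gamma> c \<star> \<gamma> Y = \<gamma> (c \<bullet> Y)" using c Q(2) by (simp add: mult)
        also have "\<dots> = \<gamma> Y \<star> \<gamma> c" using c Q(2) by (simp add: mult flip: Yc)
        finally show ?thesis using True edges by simp
      next
        case False
        then show ?thesis using \<open>\<not> k \<and> v \<in> {\<one>g, Y}\<close> c by (simp add: ones)
      qed
      have "nf False q" using 2 True by simp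
      then obtain c' z where z: "c' \<in> E" "c' \<in> Q" "z \<in> D" "q = \<gamma> c' \<star> z"
        "\<And>c'. c' \<in> E \<Longrightarrow> c' \<in> Q \<Longrightarrow> nf False (\<gamma> c' \<star> z)"
        using nf_False_syllable[OF \<open>nf False q\<close>] by blast
      have zc: "z \<in> carrier T" using z D_closed by blast
      have ccQ: "c \<bullet> c' \<in> Q" using subgroup.m_closed[OF Q(1)] c z by blast
      have "\<gamma> c \<star> d = (\<gamma> c \<star> \<beta> v) \<star> (\<gamma> c' \<star> z)" using 2 z(2,4) zc c by (simp add: T.m_assoc)
      also have "\<dots> = \<beta> v \<star> (\<gamma> (c \<bullet> c') \<star> z)"
        unfolding comm using 2 zc c z(2) by (simp add: T.m_assoc mult)
      finally have eq: "\<gamma> c \<star> d = \<beta> v \<star> (\<gamma> (c \<bullet> c') \<star> z)" .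
      have "\<gamma> (c \<bullet> c') \<star> z \<in> D"
        using E_mult[OF c(1) z(1)]
      proof
        assume "c \<bullet> c' = \<one>g"
        then show ?thesis using z(3) zc by (simp add: ones)
      next
        assume "c \<bullet> c' \<in> E"
        then show ?thesis using z(5) ccQ D_nf by blast
      qed
      then show ?thesis unfolding eq using D_\<beta> 2 by blast
    qed
  qed
qed

lemma carrier_D: "carrier T \<subseteq> D"
proof (rule generated)
  have "\<one>g \<in> V" by (rule generate.one)
  then show "\<one>\<^bsub>T\<^esub> \<in> D" using ones(2) unfolding D_def by force
next
  fix p d assume p: "p \<in> P" and d: "d \<in> D"
  have dc: "d \<in> carrier T" using d D_closed by blast
  have XD: "\<alpha> X \<star> d' \<in> D" if "d' \<in> D" for d'
    using D_\<beta>[OF XY_V(1) that] edges by simp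
  from P(3)[OF p] consider "p = \<one>g" | "p = X" | "p = a" | "p = X \<bullet> a" by blast
  then show "\<alpha> p \<star> d \<in> D"
  proof cases
    case 1
    then show ?thesis using d dc by (simp add: ones)
  next
    case 4
    have "X \<bullet> p \<in> P" using subgroup.m_closed[OF P(1,2) p] .
    then have aP: "a \<in> P" using 4 by simp
    have "\<alpha> p \<star> d = \<alpha> X \<star> (\<alpha> a \<star> d)" using 4 aP P(2) dc by (simp add: mult T.m_assoc)
    then show ?thesis using XD D_a[OF aP d] by simp
  qed (use XD D_a d p in auto)
next
  fix q d assume q: "q \<in> Q" and d: "d \<in> D"
  have dc: "d \<in> carrier T" using d D_closed by blast
  obtain y c where yc: "y \<in> {\<one>g, Y}" "c \<in> {\<one>g, b1, b2, b1 \<bullet> b2}" "q = y \<bullet> c" using Q(3)[OF q] by blast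
  have yQ: "y \<in> Q" using yc Q subgroup.one_closed by blast
  have cc: "c \<in> carrier G" using yc by auto
  have "y \<bullet> q \<in> Q" using subgroup.m_closed[OF Q(1) yQ q] .
  moreover have "y \<bullet> q = c" using yc cc by auto
  ultimately have cQ: "c \<in> Q" by simp
  have "\<gamma> q \<star> d = \<gamma> y \<star> (\<gamma> c \<star> d)" using yc(3) yQ cQ dc by (simp add: mult T.m_assoc)
  moreover have "\<gamma> c \<star> d \<in> D"
  proof (cases "c = \<one>g")
    case True
    then show ?thesis using d dc by (simp add: ones)
  next
    case False
    then show ?thesis using D_c[OF _ cQ d] yc(2) by (simp add: E_def)
  qed
  moreover have "\<gamma> y \<star> d' \<in> D" if "d' \<in> D" for d'
  proof (cases "y = Y")
    case True
    then show ?thesis using D_\<beta>[OF XY_V(2) that] edges by simp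
  next
    case False
    then show ?thesis using yc(1) that D_closed[OF that] by (simp add: ones)
  qed
  ultimately show "\<gamma> q \<star> d \<in> D" by simp
qed (rule D_\<beta>)

text \<open>A kernel element \<open>\<beta> v \<star> q\<close> with \<open>q\<close> reduced would
  make \<open>\<phi> q\<close> agree with an element of \<open>V\<close>, so it would send
  \<open>d0\<close> to a place forbidden by \<open>st_neq\<close>.\<close>

lemma \<phi>_kernel:
  assumes "z \<in> carrier T" "\<phi> z = \<one>g"
  shows "z = \<one>\<^bsub>T\<^esub>"
proof -
  have "z \<in> D" using assms carrier_D by blast
  then consider v where "v \<in> V" "z = \<beta> v" | v q k where "v \<in> V" "nf k q" "z = \<beta> v \<star> q"
    unfolding D_def by blast
  then show ?thesis
  proof cases
    case 1
    then show ?thesis using assms \<phi>(3) ones by simp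
  next
    case 2
    have qc: "q \<in> carrier T" "\<phi> q \<in> carrier G" using 2 nf_closed \<phi>_closed by auto
    have "v \<bullet> \<phi> q = \<one>g" using assms(2) 2 qc by (simp add: \<phi>_mult \<phi>)
    then have "\<phi> q = ginv v" using 2 qc by (metis G.inv_equality G.inv_inv V_closed)
    moreover have "ginv v \<in> V" using subgroup.m_inv_closed[OF subgroup_V] 2 by blast
    ultimately have "\<phi> q \<bullet> d0 = ginv v \<bullet> d0" "ginv v \<in> V" by auto
    moreover have "stA (\<phi> q \<bullet> d0) \<or> stC (\<phi> q \<bullet> d0) \<or> stX (\<phi> q \<bullet> d0)"
      using nf_state[OF 2(2)] by blast
    ultimately show ?thesis using st_neq by blast
  qed
qed

lemma \<phi>_mon: "\<phi> \<in> mon T G"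
proof -
  have "inj_on \<phi> (carrier T)"
  proof (rule inj_onI)
    fix y z assume yz: "y \<in> carrier T" "z \<in> carrier T" "\<phi> y = \<phi> z"
    have "\<phi> (inv\<^bsub>T\<^esub> z \<star> y) = \<phi> (inv\<^bsub>T\<^esub> z) \<bullet> \<phi> z" using yz by (simp add: \<phi>_mult)
    also have "\<dots> = \<phi> (inv\<^bsub>T\<^esub> z \<star> z)" using \<phi>_mult[of "inv\<^bsub>T\<^esub> z" z] yz by simp
    also have "\<dots> = \<one>g" using yz hom_one[OF \<phi>(1) T.group_axioms G.group_axioms] by simp
    finally have "\<phi> (inv\<^bsub>T\<^esub> z \<star> y) = \<one>g" .
    then have "inv\<^bsub>T\<^esub> z \<star> y = \<one>\<^bsub>T\<^esub>" using \<phi>_kernel yz by simp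
    then show "y = z" using yz by (metis T.inv_closed T.inv_equality T.inv_inv)
  qed
  then show ?thesis using \<phi>(1) by (simp add: mon_def)
qed

end

lemma (in tree_diagram) carrier_tree_product_subset:
  assumes "\<one>\<^bsub>T\<^esub> \<in> D"
    and "\<And>x d. x \<in> carrier G1 \<Longrightarrow> d \<in> D \<Longrightarrow> cls [in1 x] \<otimes>\<^bsub>T\<^esub> d \<in> D"
    and "\<And>y d. y \<in> carrier G2 \<Longrightarrow> d \<in> D \<Longrightarrow> cls [in2 y] \<otimes>\<^bsub>T\<^esub> d \<in> D"
    and "\<And>z d. z \<in> carrier G3 \<Longrightarrow> d \<in> D \<Longrightarrow> cls [in3 z] \<otimes>\<^bsub>T\<^esub> d \<in> D"
  shows "carrier T \<subseteq> D"
proof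
  fix X assume "X \<in> carrier T"
  then obtain ws where ws: "ws \<in> lists A" "X = cls ws"
    unfolding tree_product_def by (rule presented_carrier_cases)
  have "cls ws \<in> D" using ws(1)
  proof (induction ws)
    case Nil
    then show ?case using assms(1) by (simp add: tree_product_def presented_one)
  next
    case (Cons l ws)
    have "cls (l # ws) = cls [l] \<otimes>\<^bsub>T\<^esub> cls ws"
      using Cons.hyps by (simp add: tree_product_def presented_mult)
    then show ?case using Cons assms(2-4) by auto
  qed
  then show "X \<in> D" using ws by simp
qed

section \<open>RGD-systems over the field with two elements\<close>

context RGD_system
begin

abbreviation gmult :: "'g \<Rightarrow> 'g \<Rightarrow> 'g" (infixl "\<bullet>" 70) where "a \<bullet> b \<equiv> a \<otimes>\<^bsub>G\<^esub> b"
abbreviation gone :: 'g ("\<one>g") where "\<one>g \<equiv> \<one>\<^bsub>G\<^esub>"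
abbreviation ginv :: "'g \<Rightarrow> 'g" where "ginv a \<equiv> inv\<^bsub>G\<^esub> a"

definition nontriv :: "'w set \<Rightarrow> 'g" where
  "nontriv \<alpha> = (SOME g. g \<in> U \<alpha> \<and> g \<noteq> \<one>g)"

lemma U_eq:
  assumes "over_F2 W S U" "\<alpha> \<in> rts"
  shows "U \<alpha> = {\<one>g, nontriv \<alpha>}" "nontriv \<alpha> \<noteq> \<one>g"
proof -
  have c: "card (U \<alpha>) = 2" using assms by (simp add: over_F2_def)
  have one: "\<one>g \<in> U \<alpha>" using root_subgroup[OF assms(2)] subgroup.one_closed by blast
  obtain p q where pq: "U \<alpha> = {p, q}" "p \<noteq> q" using c by (meson card_2_iff)
  then have "\<exists>g. g \<in> U \<alpha> \<and> g \<noteq> \<one>g" by auto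
  then have n: "nontriv \<alpha> \<in> U \<alpha> \<and> nontriv \<alpha> \<noteq> \<one>g" unfolding nontriv_def by (rule someI_ex)
  then show "nontriv \<alpha> \<noteq> \<one>g" by blast
  show "U \<alpha> = {\<one>g, nontriv \<alpha>}" using pq one n by auto
qed

lemma generate_U:
  assumes "over_F2 W S U" "A \<subseteq> rts"
  shows "generate G (\<Union>\<gamma>\<in>A. U \<gamma>) = generate G (nontriv ` A)"
proof
  have sub: "nontriv ` A \<subseteq> carrier G"
    using U_eq[OF assms(1)] assms(2) root_subgroup subgroup.subset by blast
  have "(\<Union>\<gamma>\<in>A. U \<gamma>) \<subseteq> generate G (nontriv ` A)"
  proof
    fix g assume "g \<in> (\<Union>\<gamma>\<in>A. U \<gamma>)"
    then obtain \<gamma> where "\<gamma> \<in> A" "g = \<one>g \<or> g = nontriv \<gamma>" using U_eq(1)[OF assms(1)] assms(2) by blast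
    then show "g \<in> generate G (nontriv ` A)" by (auto intro: generate.one generate.incl)
  qed
  then show "generate G (\<Union>\<gamma>\<in>A. U \<gamma>) \<subseteq> generate G (nontriv ` A)"
    using G.generate_subgroup_incl G.generate_is_subgroup[OF sub] by blast
  have "nontriv ` A \<subseteq> (\<Union>\<gamma>\<in>A. U \<gamma>)" using U_eq(1)[OF assms(1)] assms(2) by blast
  then show "generate G (nontriv ` A) \<subseteq> generate G (\<Union>\<gamma>\<in>A. U \<gamma>)"
    by (rule G.mono_generate)
qed

text \<open>The two factors \<open>x'\<close>, \<open>x''\<close> in axiom RGD2 are both forced to be the nontrivial element.\<close>

lemma rgd_F2_nontriv:
  assumes t: "type_444 W S" and F2: "over_F2 W S U"
  shows "rgd_F2 W S G nontriv"
proof -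
  have closed: "nontriv \<alpha> \<in> carrier G" if "\<alpha> \<in> rts" for \<alpha>
    using U_eq[OF F2 that] root_subgroup[OF that] subgroup.subset by blast
  have sq: "nontriv \<alpha> \<bullet> nontriv \<alpha> = \<one>g" if "\<alpha> \<in> rts" for \<alpha>
  proof -
    have "nontriv \<alpha> \<bullet> nontriv \<alpha> \<in> {\<one>g, nontriv \<alpha>}"
      using subgroup.m_closed[OF root_subgroup[OF that]] U_eq[OF F2 that] by blast
    then show ?thesis using closed[OF that] U_eq(2)[OF F2 that] by auto
  qed
  have inv: "ginv (nontriv \<alpha>) = nontriv \<alpha>" if "\<alpha> \<in> rts" for \<alpha>
    using closed sq that by (intro G.inv_equality) auto
  have cancel: "nontriv \<alpha> \<bullet> (nontriv \<alpha> \<bullet> g) = g" if "\<alpha> \<in> rts" "g \<in> carrier G" for \<alpha> g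
    using closed[OF that(1)] sq[OF that(1)] that(2) by (simp flip: G.m_assoc)
  have opp_notin: "nontriv (opp W (sr u)) \<notin> generate G (nontriv ` prts)" if u: "u \<in> S" for u
  proof
    assume "nontriv (opp W (sr u)) \<in> generate G (nontriv ` prts)"
    then have "U (opp W (sr u)) \<subseteq> generate G (nontriv ` prts)"
      using U_eq(1)[OF F2 opp_root[OF sr_root[OF u]]] by (auto intro: generate.one)
    moreover have "prts \<subseteq> rts" using prts_rts by blast
    ultimately show False using RGD3[OF u] generate_U[OF F2] by auto
  qed
  have reflect: "nontriv (opp W (sr u)) \<bullet> nontriv (sr u) \<bullet> nontriv (opp W (sr u)) \<bullet> nontriv \<beta> \<bullet>
      (nontriv (opp W (sr u)) \<bullet> nontriv (sr u) \<bullet> nontriv (opp W (sr u))) = nontriv (u \<cdot> \<beta>)"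
    if u: "u \<in> S" and \<beta>: "\<beta> \<in> rts" for u \<beta>
  proof -
    let ?e = "nontriv (sr u)" and ?f = "nontriv (opp W (sr u))"
    have r: "sr u \<in> rts" "opp W (sr u) \<in> rts" using sr_root opp_root u by auto
    have "?e \<in> generate G (nontriv ` prts)" by (intro generate.incl imageI sr_pos[OF u])
    then have ne: "?e \<noteq> ?f" using opp_notin[OF u] by auto
    have cl: "?e \<in> carrier G" "?f \<in> carrier G" using closed r by auto
    obtain p q where pq: "p \<in> U (opp W (sr u))" "q \<in> U (opp W (sr u))"
      and conj: "\<And>\<beta>. \<beta> \<in> rts \<Longrightarrow> (p \<bullet> ?e \<bullet> q) <#\<^bsub>G\<^esub> U \<beta> #>\<^bsub>G\<^esub> ginv (p \<bullet> ?e \<bullet> q) = U (u \<cdot> \<beta>)"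
      using RGD2[OF u, of ?e] U_eq[OF F2 r(1)] by auto
    have pq': "p \<in> {\<one>g, ?f}" "q \<in> {\<one>g, ?f}" using pq U_eq(1)[OF F2 r(2)] by auto
    define m where "m = p \<bullet> ?e \<bullet> q"
    have m: "m \<in> carrier G" using pq' cl unfolding m_def by auto
    \<comment> \<open>A conjugation from one group of order two onto another matches the nontrivial
      elements.\<close>
    have mc: "m \<bullet> nontriv \<delta> = nontriv (u \<cdot> \<delta>) \<bullet> m" if d: "\<delta> \<in> rts" for \<delta>
    proof -
      have dc: "nontriv \<delta> \<in> carrier G" "nontriv (u \<cdot> \<delta>) \<in> carrier G" using closed d act_root u by auto
      have "m \<bullet> nontriv \<delta> \<bullet> ginv m \<in> m <#\<^bsub>G\<^esub> U \<delta> #>\<^bsub>G\<^esub> ginv m"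
        using U_eq(1)[OF F2 d] by (auto simp: l_coset_def r_coset_def)
      also have "\<dots> = {\<one>g, nontriv (u \<cdot> \<delta>)}"
        using conj[OF d] U_eq(1)[OF F2 act_root[OF _ d], of u] u unfolding m_def by simp
      finally have "m \<bullet> nontriv \<delta> \<bullet> ginv m = \<one>g \<or> m \<bullet> nontriv \<delta> \<bullet> ginv m = nontriv (u \<cdot> \<delta>)" by blast
      then show ?thesis
      proof
        assume "m \<bullet> nontriv \<delta> \<bullet> ginv m = \<one>g"
        then have "m \<bullet> nontriv \<delta> = \<one>g \<bullet> m" using m dc by (metis G.inv_closed G.inv_equality G.inv_inv G.l_one G.m_closed)
        then have "nontriv \<delta> = \<one>g" using m dc by simp
        then show ?thesis using U_eq(2)[OF F2 d] by blast
      next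
        assume "m \<bullet> nontriv \<delta> \<bullet> ginv m = nontriv (u \<cdot> \<delta>)"
        then have "m \<bullet> nontriv \<delta> \<bullet> ginv m \<bullet> m = nontriv (u \<cdot> \<delta>) \<bullet> m" by simp
        then show ?thesis using m dc by (simp add: G.m_assoc)
      qed
    qed
    have me: "m \<bullet> ?e = ?f \<bullet> m" using mc[OF r(1)] u by (simp add: opp_sr)
    have mf: "m \<bullet> ?f = ?e \<bullet> m" using mc[OF r(2)] u by (simp add: opp_sr act_cancel sr_root)
    \<comment> \<open>Conjugation by \<open>m\<close> exchanges \<open>?e\<close> and
      \<open>?f\<close>. If one of the factors \<open>p\<close>, \<open>q\<close> were trivial, this
      would force \<open>?e = ?f\<close>.\<close>
    have "p \<noteq> \<one>g"
    proof
      assume p: "p = \<one>g"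
      show False
      proof (cases "q = \<one>g")
        case True
        then have "?e \<bullet> ?e = ?f \<bullet> ?e" using me p cl unfolding m_def by simp
        then show False using ne cl by simp
      next
        case False
        then have "?e \<bullet> ?f \<bullet> ?f = ?e \<bullet> (?e \<bullet> ?f)" using mf p pq' cl unfolding m_def by simp
        then have "?e = ?f" using cl cancel r sq by (simp add: G.m_assoc)
        then show False using ne by simp
      qed
    qed
    then have p: "p = ?f" using pq' by blast
    have "q \<noteq> \<one>g"
    proof
      assume "q = \<one>g"
      then have "?f \<bullet> ?e \<bullet> ?e = ?f \<bullet> (?f \<bullet> ?e)" using me p cl unfolding m_def by simp
      then have "?f = ?e" using cl cancel r sq by (simp add: G.m_assoc)
      then show False using ne by simp
    qed
    then have q: "q = ?f" using pq' by blast
    have mm: "m \<bullet> m = \<one>g" unfolding m_def p q using cl cancel r sq by (simp add: G.m_assoc)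
    have bc: "nontriv \<beta> \<in> carrier G" "nontriv (u \<cdot> \<beta>) \<in> carrier G" using closed \<beta> act_root u by auto
    have "m \<bullet> nontriv \<beta> \<bullet> m = nontriv (u \<cdot> \<beta>) \<bullet> (m \<bullet> m)"
      unfolding mc[OF \<beta>] using m bc by (simp add: G.m_assoc)
    then show ?thesis using mm bc unfolding m_def p q by simp
  qed
  show ?thesis
  proof (intro rgd_F2.intro rgd_F2_axioms.intro coxeter_444.intro coxeter_444_axioms.intro)
    fix \<alpha> \<beta> assume ab: "\<alpha> \<in> rts" "\<beta> \<in> rts" "\<alpha> \<noteq> \<beta>" "prenilpotent W \<alpha> \<beta>"
    have "ginv (nontriv \<alpha>) \<bullet> ginv (nontriv \<beta>) \<bullet> nontriv \<alpha> \<bullet> nontriv \<beta> \<in> commutator_subgroup G (U \<alpha>) (U \<beta>)"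
      unfolding commutator_subgroup_def using U_eq(1)[OF F2] ab by (intro generate.incl) blast
    also have "\<dots> \<subseteq> generate G (\<Union>\<gamma>\<in>open_root_interval W S \<alpha> \<beta>. U \<gamma>)" using RGD1 ab by blast
    also have "\<dots> = generate G (nontriv ` open_root_interval W S \<alpha> \<beta>)"
      by (rule generate_U[OF F2]) (auto simp: open_root_interval_def root_interval_def)
    finally show "nontriv \<alpha> \<bullet> nontriv \<beta> \<bullet> nontriv \<alpha> \<bullet> nontriv \<beta> \<in> generate G (nontriv ` open_root_interval W S \<alpha> \<beta>)"
      using inv ab by simp
  qed (use closed sq reflect opp_notin t in \<open>auto intro: coxeter_system_axioms G.group_axioms\<close>)
qed

end

theorem theorem1:
  fixes W :: "('w, 'm) monoid_scheme" and S :: "'w set" and r s t :: 'w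
    and G :: "('g, 'n) monoid_scheme" and U :: "'w set \<Rightarrow> 'g set"
    and V_st :: "'g set"
  assumes "RGD_system W S G U"
    and "type_444 W S"
    and "S = {r, s, t}"
    and "over_F2 W S U"
    and "V_st = generate G (U_of W S G U s \<union> U_of W S G U t)"
  shows "canonical_map G \<in>
    mon (subgroup_tree_product G
           (U_of W S G U (s \<otimes>\<^bsub>W\<^esub> r)) (U_of W S G U s) V_st
           (U_of W S G U t) (U_of W S G U (t \<otimes>\<^bsub>W\<^esub> r \<otimes>\<^bsub>W\<^esub> t)))
        G"
proof -
  interpret R: RGD_system W S G U by fact
  interpret pos: rgd_F2 W S G R.nontriv
    using R.rgd_F2_nontriv assms(2,4) .
  have "card S = 3" using assms(2) by (simp add: type_444_def)
  then have "r \<noteq> s \<and> r \<noteq> t \<and> s \<noteq> t"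
    unfolding assms(3) by (auto simp: card_insert_if split: if_splits)
  then interpret neg: rgd_F2_rst W S G "\<lambda>\<alpha>. R.nontriv (opp W \<alpha>)" r s t
    using pos.opposite assms(3) by (intro rgd_F2_rst.intro rgd_F2_rst_axioms.intro) auto
  \<comment> \<open>In the system with exchanged signs the elements \<open>f u\<close> belong to the
    positive simple roots of the original one.\<close>
  have gX: "R.nontriv (simple_root W S s) = neg.X" and gY: "R.nontriv (simple_root W S t) = neg.Y"
    by (simp_all add: R.opp_opp R.sr_root)
  have ga: "R.nontriv (s <#\<^bsub>W\<^esub> simple_root W S r) = neg.a"
    unfolding neg.a_def using neg.f_n_conj[of s r] by (simp add: R.opp_opp R.sr_root R.act_root)
  have gb1: "R.nontriv (t <#\<^bsub>W\<^esub> simple_root W S r) = neg.b1"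
    unfolding neg.b1_def using neg.f_n_conj[of t r] by (simp add: R.opp_opp R.sr_root R.act_root)
  have gb2: "R.nontriv (r <#\<^bsub>W\<^esub> simple_root W S t) = neg.b2"
    unfolding neg.b2_def using neg.f_n_conj[of r t] by (simp add: R.opp_opp R.sr_root R.act_root)
  let ?R = "\<lambda>w. {\<alpha> \<in> pos_roots W S. w \<notin> \<alpha>}"
  have Uof: "U_of W S G U w = generate G (R.nontriv ` ?R w)" for w
    unfolding U_of_def using R.prts_rts by (intro R.generate_U assms(4)) blast
  have sub: "subgroup (U_of W S G U w) G" for w
    unfolding Uof using pos.gen_subgroup[OF pos.K_rts] .
  have Xin: "neg.X \<in> U_of W S G U w" if "w \<in> carrier W" "R.des s w" for w
    unfolding Uof gX[symmetric] using that by (intro generate.incl imageI) (simp add: R.sr_pos R.in_sr)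
  have Yin: "neg.Y \<in> U_of W S G U w" if "w \<in> carrier W" "R.des t w" for w
    unfolding Uof gY[symmetric] using that by (intro generate.incl imageI) (simp add: R.sr_pos R.in_sr)
  have single: "generate G {g} \<subseteq> {\<one>\<^bsub>G\<^esub>, g}" if "g \<in> carrier G" "g \<otimes>\<^bsub>G\<^esub> g = \<one>\<^bsub>G\<^esub>" for g
    using R.G.generate_commuting_involutions[of g g] that by auto
  have Us: "U_of W S G U s = {\<one>\<^bsub>G\<^esub>, neg.X}"
  proof
    have "R.nontriv ` ?R s \<subseteq> {neg.X}"
      unfolding gX[symmetric] using R.gen_in_pos_root[of _ s] by auto
    then have "U_of W S G U s \<subseteq> generate G {neg.X}" unfolding Uof by (rule R.G.mono_generate)
    then show "U_of W S G U s \<subseteq> {\<one>\<^bsub>G\<^esub>, neg.X}" using single[of neg.X] by simp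
    show "{\<one>\<^bsub>G\<^esub>, neg.X} \<subseteq> U_of W S G U s" using Xin[of s] subgroup.one_closed[OF sub] by simp
  qed
  have Ut: "U_of W S G U t = {\<one>\<^bsub>G\<^esub>, neg.Y}"
  proof
    have "R.nontriv ` ?R t \<subseteq> {neg.Y}"
      unfolding gY[symmetric] using R.gen_in_pos_root[of _ t] by auto
    then have "U_of W S G U t \<subseteq> generate G {neg.Y}" unfolding Uof by (rule R.G.mono_generate)
    then show "U_of W S G U t \<subseteq> {\<one>\<^bsub>G\<^esub>, neg.Y}" using single[of neg.Y] by simp
    show "{\<one>\<^bsub>G\<^esub>, neg.Y} \<subseteq> U_of W S G U t" using Yin[of t] subgroup.one_closed[OF sub] by simp
  qed
  have V: "V_st = neg.V"
  proof
    have XYs: "{neg.X, neg.Y} \<subseteq> carrier G" by simp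
    have "U_of W S G U s \<union> U_of W S G U t \<subseteq> neg.V"
      unfolding Us Ut using neg.XY_V generate.one[of G] by auto
    then show "V_st \<subseteq> neg.V" unfolding assms(5)
      using R.G.generate_subgroup_incl R.G.generate_is_subgroup[OF XYs] by blast
    show "neg.V \<subseteq> V_st" unfolding assms(5) Us Ut by (intro R.G.mono_generate) auto
  qed
  let ?P = "U_of W S G U (s \<otimes>\<^bsub>W\<^esub> r)" and ?Q = "U_of W S G U (t \<otimes>\<^bsub>W\<^esub> r \<otimes>\<^bsub>W\<^esub> t)"
  have P: "p \<in> {\<one>\<^bsub>G\<^esub>, neg.X, neg.a, neg.X \<otimes>\<^bsub>G\<^esub> neg.a}" if "p \<in> ?P" for p
  proof -
    have "R.nontriv ` ?R (s \<otimes>\<^bsub>W\<^esub> r) \<subseteq> {neg.X, neg.a}"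
      unfolding gX[symmetric] ga[symmetric] using pos.pos_root_notin_2[of _ s r] by auto
    then have "?P \<subseteq> generate G {neg.X, neg.a}" unfolding Uof by (rule R.G.mono_generate)
    then show ?thesis
      using that neg.ab_commute(1) by (intro R.G.generate_commuting_involutions) auto
  qed
  have Q: "\<exists>y\<in>{\<one>\<^bsub>G\<^esub>, neg.Y}. \<exists>c\<in>{\<one>\<^bsub>G\<^esub>, neg.b1, neg.b2, neg.b1 \<otimes>\<^bsub>G\<^esub> neg.b2}. q = y \<otimes>\<^bsub>G\<^esub> c" if "q \<in> ?Q" for q
  proof -
    \<comment> \<open>The third root met by the gallery is
      \<open>t \<cdot> (r \<cdot> sr t)\<close>. By \<open>rank2_act\<close> it equals
      \<open>r \<cdot> sr t\<close>, so its element is \<open>b2\<close>.\<close>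
    have "R.nontriv ` ?R (t \<otimes>\<^bsub>W\<^esub> r \<otimes>\<^bsub>W\<^esub> t) \<subseteq> {neg.Y, neg.b1, neg.b2}"
      unfolding gY[symmetric] gb1[symmetric] gb2[symmetric]
      using pos.pos_root_notin_3[of _ t r t] pos.rank2_act[of t r] by auto
    then have "?Q \<subseteq> generate G {neg.Y, neg.b1, neg.b2}" unfolding Uof by (rule R.G.mono_generate)
    then have q: "q \<in> generate G (insert neg.Y {neg.b1, neg.b2})" using that by auto
    let ?K = "generate G {neg.b1, neg.b2}"
    have K: "subgroup ?K G" by (intro R.G.generate_is_subgroup) simp
    have Kc: "k \<in> {\<one>\<^bsub>G\<^esub>, neg.b1, neg.b2, neg.b1 \<otimes>\<^bsub>G\<^esub> neg.b2}" if "k \<in> ?K" for k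
      using that neg.ab_commute(4) by (intro R.G.generate_commuting_involutions) auto
    have "neg.Y \<otimes>\<^bsub>G\<^esub> k = k \<otimes>\<^bsub>G\<^esub> neg.Y" if "k \<in> ?K" for k
      using Kc[OF that] neg.ab_commute(2) neg.B2_commute[of k] by (auto simp: neg.B2_def)
    moreover have "k \<in> carrier G" if "k \<in> ?K" for k using Kc[OF that] by auto
    ultimately have "neg.Y \<otimes>\<^bsub>G\<^esub> k \<otimes>\<^bsub>G\<^esub> neg.Y \<in> ?K" if "k \<in> ?K" for k
      using that by (simp add: R.G.m_assoc)
    then have "\<exists>k\<in>?K. q = k \<or> q = neg.Y \<otimes>\<^bsub>G\<^esub> k"
      using q by (intro R.G.generate_insert_involution[OF K]) (auto intro: generate.incl)
    then obtain k where k: "k \<in> ?K" "q = k \<or> q = neg.Y \<otimes>\<^bsub>G\<^esub> k" by blast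
    then have "q = \<one>\<^bsub>G\<^esub> \<otimes>\<^bsub>G\<^esub> k \<or> q = neg.Y \<otimes>\<^bsub>G\<^esub> k" using Kc[OF k(1)] by auto
    then show ?thesis using Kc[OF k(1)] by blast
  qed
  have W: "r \<in> carrier W" "s \<in> carrier W" "t \<in> carrier W" by simp_all
  have dP: "neg.X \<in> ?P" by (rule Xin) simp_all
  have dQ: "neg.Y \<in> ?Q" by (rule Yin) (simp_all add: R.m_assoc)
  have subV: "subgroup V_st G" unfolding V by (intro R.G.generate_is_subgroup) simp
  have car: "carrier (restr G A) = A" for A by simp
  have grp: "group (restr G ?P)" "group (restr G V_st)" "group (restr G ?Q)"
    using R.G.subgroup_imp_group sub subV by auto
  have incl: "id \<in> hom (restr G A) (restr G B)" if "A \<subseteq> B" for A B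
    using that by (auto simp: hom_def)
  have le: "U_of W S G U s \<subseteq> ?P" "U_of W S G U s \<subseteq> V_st" "U_of W S G U t \<subseteq> V_st" "U_of W S G U t \<subseteq> ?Q"
    unfolding Us Ut V using dP dQ subgroup.one_closed[OF sub] neg.XY_V generate.one[of G] by auto
  interpret td: tree_diagram "restr G ?P" id "restr G (U_of W S G U s)" id "restr G V_st" id
    "restr G (U_of W S G U t)" id "restr G ?Q"
    using grp incl le by (intro tree_diagram.intro tree_diagram_axioms.intro) auto
  have idG: "id \<in> hom (restr G A) G" if "subgroup A G" for A
    using subgroup.subset[OF that] by (auto simp: hom_def)
  note idh = idG[OF sub] idG[OF subV] idG[OF sub]
  let ?T = "subgroup_tree_product G ?P (U_of W S G U s) V_st (U_of W S G U t) ?Q"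
  have T: "?T = td.T" by (simp add: subgroup_tree_product_def)
  note map_in = td.tree_product_map_in[OF R.G.group_axioms idh]
  interpret amalgam W S G "\<lambda>\<alpha>. R.nontriv (opp W \<alpha>)" r s t ?T
    "\<lambda>p. td.cls [in1 p]" "\<lambda>v. td.cls [in2 v]" "\<lambda>q. td.cls [in3 q]" "canonical_map G" ?P ?Q
  proof (intro amalgam.intro amalgam_axioms.intro)
    show "group ?T" unfolding T by (rule td.tree_product_group)
    show "canonical_map G \<in> hom ?T G"
      unfolding T canonical_map_def by (rule td.tree_product_map_hom[OF R.G.group_axioms idh]) auto
    show "carrier ?T \<subseteq> D" if D: "\<one>\<^bsub>?T\<^esub> \<in> D" "\<And>p d. p \<in> ?P \<Longrightarrow> d \<in> D \<Longrightarrow> td.cls [in1 p] \<otimes>\<^bsub>?T\<^esub> d \<in> D"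
      "\<And>v d. v \<in> neg.V \<Longrightarrow> d \<in> D \<Longrightarrow> td.cls [in2 v] \<otimes>\<^bsub>?T\<^esub> d \<in> D"
      "\<And>q d. q \<in> ?Q \<Longrightarrow> d \<in> D \<Longrightarrow> td.cls [in3 q] \<otimes>\<^bsub>?T\<^esub> d \<in> D" for D
      using D unfolding T V[symmetric] by (intro td.carrier_tree_product_subset) (simp_all only: car)
    show "(\<lambda>p. td.cls [in1 p]) \<in> hom (restr G ?P) ?T" "(\<lambda>v. td.cls [in2 v]) \<in> hom (restr G neg.V) ?T"
      "(\<lambda>q. td.cls [in3 q]) \<in> hom (restr G ?Q) ?T"
      unfolding T V[symmetric] by (rule td.tree_product_in_hom)+
    show "td.cls [in1 neg.X] = td.cls [in2 neg.X]"
      by (rule td.tree_product_in_edges(1)[of neg.X, unfolded id_apply[of neg.X]]) (simp add: Us)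
    show "td.cls [in2 neg.Y] = td.cls [in3 neg.Y]"
      by (rule td.tree_product_in_edges(2)[of neg.Y, unfolded id_apply[of neg.Y]]) (simp add: Ut)
    show "canonical_map G (td.cls [in1 p]) = p" if "p \<in> ?P" for p
      by (rule map_in(1)[of p, unfolded id_apply[of p], folded canonical_map_def]) (use that in simp_all)
    show "canonical_map G (td.cls [in2 v]) = v" if "v \<in> neg.V" for v
      by (rule map_in(2)[of v, unfolded id_apply[of v], folded canonical_map_def]) (use that V in simp_all)
    show "canonical_map G (td.cls [in3 q]) = q" if "q \<in> ?Q" for q
      by (rule map_in(3)[of q, unfolded id_apply[of q], folded canonical_map_def]) (use that in simp_all)
  qed (use neg.rgd_F2_rst_axioms sub dP dQ P Q in auto)
  show ?thesis by (rule \<phi>_mon)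
qed

end
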